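(* Let $1<p,q<\infty$ and let $X=\bigoplus_{\ell_p}\ell_q^n$. If $X$ admits a $T^p$-smooth bump function, then $p$ and $q$ are both even integers and $p$ is a multiple of $q$; moreover, $X$ admits a separating polynomial.
   Context: $\bigoplus_{\ell_p}\ell_q^n$ is the space of sequences $x=(x_n)_{n\ge1}$ with $x_n\in\ell_q^n$ ($\mathbb{R}^n$ with the $q$-norm) and $\|x\|=(\sum_n\|x_n\|_q^p)^{1/p}<\infty$. For real $s\ge1$, $f$ is $T^s$-smooth if at every $x$ there is a continuous polynomial $P$ of degree at most $[s]$ with $|f(x+h)-f(x)-P(h)|=o(\|h\|^s)$ as $h\to0$. A bump function is a real-valued function with bounded nonempty support. A separating polynomial is a continuous polynomial $P$ with $P(0)=0$ and $P(x)\ge1$ on the unit sphere. *)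

theory Defs
  imports Complex_Main
begin

text \<open>Elements of X = (sum_{l_p} l_q^n) are represented as x :: nat => nat => real,
  where block n (n >= 1) is the vector (x n 0, ..., x n (n-1)) in R^n; all other
  entries (block 0, and entries i >= n of block n) are zero.\<close>

type_synonym seqvec = "nat \<Rightarrow> nat \<Rightarrow> real"

definition blk_norm :: "real \<Rightarrow> nat \<Rightarrow> (nat \<Rightarrow> real) \<Rightarrow> real" where
  "blk_norm q n v = (\<Sum>i<n. \<bar>v i\<bar> powr q) powr (1 / q)"

definition X_space :: "real \<Rightarrow> real \<Rightarrow> seqvec set" where
  "X_space p q = {x. (\<forall>n i. (n = 0 \<or> n \<le> i) \<longrightarrow> x n i = 0)
                    \<and> summable (\<lambda>n. (blk_norm q n (x n)) powr p)}"

definition X_norm :: "real \<Rightarrow> real \<Rightarrow> seqvec \<Rightarrow> real" where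
  "X_norm p q x = (\<Sum>n. (blk_norm q n (x n)) powr p) powr (1 / p)"

definition vzero :: seqvec where
  "vzero = (\<lambda>n i. 0)"

definition vadd :: "seqvec \<Rightarrow> seqvec \<Rightarrow> seqvec" where
  "vadd x y = (\<lambda>n i. x n i + y n i)"

definition vscale :: "real \<Rightarrow> seqvec \<Rightarrow> seqvec" where
  "vscale c x = (\<lambda>n i. c * x n i)"

definition bounded_multilinear_X :: "real \<Rightarrow> real \<Rightarrow> nat \<Rightarrow> (seqvec list \<Rightarrow> real) \<Rightarrow> bool" where
  "bounded_multilinear_X p q k A \<longleftrightarrow>
     (\<forall>xs j y c. length xs = k \<and> set xs \<subseteq> X_space p q \<and> j < k \<and> y \<in> X_space p q \<longrightarrow>
        A (xs[j := vadd (xs ! j) (vscale c y)]) = A xs + c * A (xs[j := y])) \<and>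
     (\<exists>C. \<forall>xs. length xs = k \<and> set xs \<subseteq> X_space p q \<longrightarrow>
        \<bar>A xs\<bar> \<le> C * prod_list (map (X_norm p q) xs))"

definition cont_poly_X :: "real \<Rightarrow> real \<Rightarrow> nat \<Rightarrow> (seqvec \<Rightarrow> real) \<Rightarrow> bool" where
  "cont_poly_X p q d P \<longleftrightarrow>
     (\<exists>A. (\<forall>k\<le>d. bounded_multilinear_X p q k (A k)) \<and>
          (\<forall>h\<in>X_space p q. P h = (\<Sum>k\<le>d. A k (replicate k h))))"

definition T_smooth_X :: "real \<Rightarrow> real \<Rightarrow> real \<Rightarrow> (seqvec \<Rightarrow> real) \<Rightarrow> bool" where
  "T_smooth_X p q s f \<longleftrightarrow>
     (\<forall>x\<in>X_space p q. \<exists>P. cont_poly_X p q (nat \<lfloor>s\<rfloor>) P \<and>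
        (\<forall>\<epsilon>>0. \<exists>\<delta>>0. \<forall>h\<in>X_space p q. X_norm p q h < \<delta> \<longrightarrow>
            \<bar>f (vadd x h) - f x - P h\<bar> \<le> \<epsilon> * X_norm p q h powr s))"

definition bump_X :: "real \<Rightarrow> real \<Rightarrow> (seqvec \<Rightarrow> real) \<Rightarrow> bool" where
  "bump_X p q f \<longleftrightarrow>
     (\<exists>x\<in>X_space p q. f x \<noteq> 0) \<and>
     (\<exists>R. \<forall>x\<in>X_space p q. f x \<noteq> 0 \<longrightarrow> X_norm p q x \<le> R)"

definition separating_poly_X :: "real \<Rightarrow> real \<Rightarrow> (seqvec \<Rightarrow> real) \<Rightarrow> bool" where
  "separating_poly_X p q P \<longleftrightarrow>
     (\<exists>d. cont_poly_X p q d P) \<and> P vzero = 0 \<and>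
     (\<forall>x\<in>X_space p q. X_norm p q x = 1 \<longrightarrow> P x \<ge> 1)"

end

theory Submission
  imports Defs "HOL-Analysis.Analysis" "HOL-Real_Asymp.Real_Asymp"
begin

text \<open>Minimising (f - a)^2 - c * norm^p, up to a small perturbation, gives a point y at which every small
  vector h in a late block increases (f - a)^2 by at least a multiple of norm(h)^p. In the Taylor polynomial of
  f at y the terms of degree below p vanish asymptotically on the blocks, so the term of degree p must be present,
  and replacing h by -h shows that p is even. Hence the blocks carry p-homogeneous polynomials that are uniformly
  comparable to the p-th power of the q-norm.

  Evaluate such a polynomial on a random vector with independent symmetric coordinates: the expectation is a
  polynomial in the even power sums of the coordinate distribution, while the expectation of norm^p is comparable to
  \<mu>^(p/q), with \<mu> the expected q-th power sum. Taking the values 2^(-j) with weight 2^(qj) for j < L gives \<mu> = L,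
  whereas every power sum of even order other than q is an exponential sum in L; since an exponential sum cannot grow
  like a power of L, q is even. Taking the value 1 with weight 2^j shows in the same way that p/q is an integer k.
  Then norm^p, the sum over the blocks of the k-th powers of the sums of x_i^q, is itself a polynomial.\<close>

section \<open>Random vectors with independent coordinates\<close>

text \<open>Nothing relates the forms on blocks of different dimension n: degree and constants are
  uniform, coefficients are not. No limit in n can be taken, and the contradiction must occur inside
  one block. Hence the bound on exponential sums must not depend on the coefficients and may use
  only finitely many L: bases, bound and length of the range are fixed first, and n last, large
  enough to carry the total weight of the longest law. The laws are symmetric so that odd moments
  vanish and only even orders compete with q. For p/q, the expectation divided by \<mu>^(p/q) merely
  stays between positive constants, which is no contradiction yet; summing it over j produces linear
  growth. At the other end, the square (f - a)^2, with a a nonzero value of f, is 0 at one point and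
  a^2 outside a bounded set, which traps the minimum. The perturbation replaces compactness, and the
  minimum is tested only against vectors in late blocks, where p-th powers of norms almost
  add.\<close>

definition index_lists :: "nat \<Rightarrow> nat \<Rightarrow> nat list set" where
  "index_lists n k = {is. set is \<subseteq> {..<n} \<and> length is = k}"

lemma finite_index_lists [simp]: "finite (index_lists n k)"
  unfolding index_lists_def using finite_lists_length_eq[of "{..<n}" k] by simp

lemma index_lists_0 [simp]: "index_lists n 0 = {[]}"
  by (auto simp: index_lists_def)

lemma sum_index_lists_Suc:
  fixes f :: "nat list \<Rightarrow> 'a :: comm_monoid_add"
  shows "(\<Sum>is\<in>index_lists n (Suc k). f is) = (\<Sum>i<n. \<Sum>is\<in>index_lists n k. f (i # is))"
proof -
  have "index_lists n (Suc k) = (\<lambda>(i, is). i # is) ` ({..<n} \<times> index_lists n k)"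
    by (auto simp: index_lists_def image_iff length_Suc_conv)
  moreover have "inj_on (\<lambda>(i, is). i # is) ({..<n} \<times> index_lists n k)"
    by (auto simp: inj_on_def)
  ultimately show ?thesis
    by (simp add: sum.reindex sum.cartesian_product split_def)
qed

lemma power_sum_index_lists:
  fixes y :: "nat \<Rightarrow> 'a :: comm_semiring_1"
  shows "(\<Sum>i<n. y i) ^ k = (\<Sum>is\<in>index_lists n k. \<Prod>i\<leftarrow>is. y i)"
  by (induction k) (simp_all add: sum_index_lists_Suc sum_product)

lemma prod_list_map_eq_prod_count:
  fixes f :: "'b \<Rightarrow> 'a :: comm_monoid_mult"
  shows "prod_list (map f xs) = (\<Prod>x\<in>set xs. f x ^ count_list xs x)"
proof (induction xs)
  case (Cons a xs)
  show ?case
  proof (cases "a \<in> set xs")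
    case True
    have "(\<Prod>x\<in>set (a # xs). f x ^ count_list (a # xs) x)
        = f a ^ Suc (count_list xs a) * (\<Prod>x\<in>set xs - {a}. f x ^ count_list xs x)"
    proof -
      have "(\<Prod>x\<in>set xs - {a}. f x ^ count_list (a # xs) x) = (\<Prod>x\<in>set xs - {a}. f x ^ count_list xs x)"
        by (rule prod.cong) auto
      then show ?thesis
        using True prod.remove[of "set xs" a "\<lambda>x. f x ^ count_list (a # xs) x"] by (simp add: insert_absorb)
    qed
    also have "\<dots> = f a * (\<Prod>x\<in>set xs. f x ^ count_list xs x)"
      using True by (simp add: prod.remove[of _ a] mult.assoc)
    finally show ?thesis using Cons by simp
  next
    case False
    have "(\<Prod>x\<in>set xs. f x ^ count_list (a # xs) x) = (\<Prod>x\<in>set xs. f x ^ count_list xs x)"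
      by (rule prod.cong) (use False in auto)
    then show ?thesis using False Cons by (simp add: count_list_0_iff)
  qed
qed simp

text \<open>If \<omega> sums to 1 on \<Omega>, this is the mean of G over vectors of n independent coordinates with law \<omega>.\<close>

definition expect :: "nat \<Rightarrow> real set \<Rightarrow> (real \<Rightarrow> real) \<Rightarrow> ((nat \<Rightarrow> real) \<Rightarrow> real) \<Rightarrow> real" where
  "expect n \<Omega> \<omega> G = (\<Sum>h\<in>{..<n} \<rightarrow>\<^sub>E \<Omega>. (\<Prod>i<n. \<omega> (h i)) * G h)"

lemma expect_add: "expect n \<Omega> \<omega> (\<lambda>h. G h + H h) = expect n \<Omega> \<omega> G + expect n \<Omega> \<omega> H"
  by (simp add: expect_def algebra_simps sum.distrib)

lemma expect_scale: "expect n \<Omega> \<omega> (\<lambda>h. c * G h) = c * expect n \<Omega> \<omega> G"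
  by (simp add: expect_def sum_distrib_left mult_ac)

lemma expect_sum: "expect n \<Omega> \<omega> (\<lambda>h. \<Sum>j\<in>J. G j h) = (\<Sum>j\<in>J. expect n \<Omega> \<omega> (G j))"
  unfolding expect_def sum_distrib_left by (rule sum.swap)

lemma expect_mono:
  assumes "\<And>x. x \<in> \<Omega> \<Longrightarrow> \<omega> x \<ge> 0"
    and "\<And>h. h \<in> {..<n} \<rightarrow>\<^sub>E \<Omega> \<Longrightarrow> G h \<le> H h"
  shows "expect n \<Omega> \<omega> G \<le> expect n \<Omega> \<omega> H"
  unfolding expect_def
  by (intro sum_mono mult_left_mono prod_nonneg ballI assms) (auto simp: PiE_iff)

lemma expect_prod:
  assumes "finite \<Omega>"
  shows "expect n \<Omega> \<omega> (\<lambda>h. \<Prod>i<n. g i (h i)) = (\<Prod>i<n. \<Sum>x\<in>\<Omega>. \<omega> x * g i x)"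
  using assms by (subst prod_sum_PiE) (auto simp: expect_def prod.distrib)

lemma expect_const:
  assumes "finite \<Omega>" "sum \<omega> \<Omega> = 1"
  shows "expect n \<Omega> \<omega> (\<lambda>h. c) = c"
  using expect_prod[OF assms(1), of n \<omega> "\<lambda>_ _. 1"] expect_scale[of n \<Omega> \<omega> c "\<lambda>_. 1"] assms(2)
  by simp

text \<open>Independence: equal indices are collected into a power, distinct ones factor, and a
  coordinate that is absent contributes the total mass 1.\<close>

lemma expect_prod_list:
  assumes "finite \<Omega>" "sum \<omega> \<Omega> = 1" "set is \<subseteq> {..<n}"
  shows "expect n \<Omega> \<omega> (\<lambda>h. \<Prod>i\<leftarrow>is. Y (h i)) = (\<Prod>i\<in>set is. \<Sum>x\<in>\<Omega>. \<omega> x * Y x ^ count_list is i)"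
proof -
  have "(\<Prod>i\<leftarrow>is. Y (h i)) = (\<Prod>i<n. Y (h i) ^ count_list is i)" for h
    unfolding prod_list_map_eq_prod_count
    by (rule prod.mono_neutral_left) (use assms(3) in \<open>auto simp: count_list_0_iff\<close>)
  then have "expect n \<Omega> \<omega> (\<lambda>h. \<Prod>i\<leftarrow>is. Y (h i)) = (\<Prod>i<n. \<Sum>x\<in>\<Omega>. \<omega> x * Y x ^ count_list is i)"
    using expect_prod[OF assms(1), of n \<omega> "\<lambda>i x. Y x ^ count_list is i"] by simp
  also have "\<dots> = (\<Prod>i\<in>set is. \<Sum>x\<in>\<Omega>. \<omega> x * Y x ^ count_list is i)"
    by (rule prod.mono_neutral_right) (use assms in \<open>auto simp: count_list_0_iff\<close>)
  finally show ?thesis .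
qed

text \<open>The left side is the k-th moment of a sum of n independent 0-1 variables of mean r. A
  new index either repeats one of at most k earlier ones, or is one of at most n new ones and costs
  a factor r.\<close>

lemma sum_index_lists_power_card_le:
  fixes r :: real
  assumes "r \<ge> 0"
  shows "(\<Sum>is\<in>index_lists n k. r ^ card (set is)) \<le> (\<Prod>j<k. real j + real n * r)"
proof (induction k)
  case (Suc k)
  have step: "(\<Sum>i<n. r ^ card (set (i # is))) \<le> r ^ card (set is) * (real k + real n * r)"
    if "is \<in> index_lists n k" for "is"
  proof -
    have sub: "set is \<subseteq> {..<n}" and len: "length is = k" using that by (auto simp: index_lists_def)
    have "(\<Sum>i<n. r ^ card (set (i # is)))
        = (\<Sum>i\<in>set is. r ^ card (set (i # is))) + (\<Sum>i\<in>{..<n} - set is. r ^ card (set (i # is)))"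
      using sub by (simp add: sum.subset_diff[of "set is" "{..<n}"])
    also have "(\<Sum>i\<in>set is. r ^ card (set (i # is))) = real (card (set is)) * r ^ card (set is)"
      by (simp add: insert_absorb)
    also have "(\<Sum>i\<in>{..<n} - set is. r ^ card (set (i # is)))
        = real (card ({..<n} - set is)) * (r * r ^ card (set is))"
      by simp
    also have "real (card (set is)) * r ^ card (set is) \<le> real k * r ^ card (set is)"
      using card_length[of "is"] len assms by (intro mult_right_mono) auto
    also have "real (card ({..<n} - set is)) * (r * r ^ card (set is)) \<le> real n * (r * r ^ card (set is))"
      using card_mono[of "{..<n}" "{..<n} - set is"] assms by (intro mult_right_mono) auto
    finally show ?thesis by (simp add: algebra_simps)
  qed
  have "(\<Sum>is\<in>index_lists n (Suc k). r ^ card (set is))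
      = (\<Sum>is\<in>index_lists n k. \<Sum>i<n. r ^ card (set (i # is)))"
    unfolding sum_index_lists_Suc by (rule sum.swap)
  also have "\<dots> \<le> (\<Sum>is\<in>index_lists n k. r ^ card (set is) * (real k + real n * r))"
    by (rule sum_mono) (rule step)
  also have "\<dots> = (\<Sum>is\<in>index_lists n k. r ^ card (set is)) * (real k + real n * r)"
    by (simp add: sum_distrib_right)
  also have "\<dots> \<le> (\<Prod>j<k. real j + real n * r) * (real k + real n * r)"
    using Suc assms by (intro mult_right_mono) auto
  finally show ?case by simp
qed simp

text \<open>A variable in [0,1] dominates its powers, so every joint moment is at most that of 0-1
  variables with the same mean. The bound sees n only through the mean of the sum, which is what
  makes later estimates uniform in n.\<close>

lemma expect_power_sum_le:
  assumes fin: "finite \<Omega>" and pos: "\<And>x. x \<in> \<Omega> \<Longrightarrow> \<omega> x \<ge> 0" and one: "sum \<omega> \<Omega> = 1"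
    and Y: "\<And>x. x \<in> \<Omega> \<Longrightarrow> 0 \<le> Y x \<and> Y x \<le> 1"
  shows "expect n \<Omega> \<omega> (\<lambda>h. (\<Sum>i<n. Y (h i)) ^ k)
       \<le> (\<Prod>j<k. real j + real n * (\<Sum>x\<in>\<Omega>. \<omega> x * Y x))"
proof -
  define r where "r = (\<Sum>x\<in>\<Omega>. \<omega> x * Y x)"
  have r0: "r \<ge> 0" unfolding r_def using pos Y by (intro sum_nonneg) auto
  have "expect n \<Omega> \<omega> (\<lambda>h. (\<Sum>i<n. Y (h i)) ^ k)
      = (\<Sum>is\<in>index_lists n k. expect n \<Omega> \<omega> (\<lambda>h. \<Prod>i\<leftarrow>is. Y (h i)))"
    by (simp add: power_sum_index_lists expect_sum)
  also have "\<dots> \<le> (\<Sum>is\<in>index_lists n k. r ^ card (set is))"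
  proof (rule sum_mono)
    fix "is" assume "is \<in> index_lists n k"
    then have "set is \<subseteq> {..<n}" by (auto simp: index_lists_def)
    then have "expect n \<Omega> \<omega> (\<lambda>h. \<Prod>i\<leftarrow>is. Y (h i)) = (\<Prod>i\<in>set is. \<Sum>x\<in>\<Omega>. \<omega> x * Y x ^ count_list is i)"
      using expect_prod_list fin one by blast
    also have "\<dots> \<le> (\<Prod>i\<in>set is. r)"
    proof (rule prod_mono, rule conjI)
      fix i assume "i \<in> set is"
      then have c: "count_list is i \<ge> 1" using count_list_0_iff[of "is" i] by linarith
      show "0 \<le> (\<Sum>x\<in>\<Omega>. \<omega> x * Y x ^ count_list is i)"
        using pos Y by (intro sum_nonneg) auto
      show "(\<Sum>x\<in>\<Omega>. \<omega> x * Y x ^ count_list is i) \<le> r"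
        unfolding r_def
      proof (intro sum_mono mult_left_mono pos)
        fix x assume "x \<in> \<Omega>"
        then show "Y x ^ count_list is i \<le> Y x"
          using power_decreasing[OF c, of "Y x"] Y by auto
      qed
    qed
    finally show "expect n \<Omega> \<omega> (\<lambda>h. \<Prod>i\<leftarrow>is. Y (h i)) \<le> r ^ card (set is)" by simp
  qed
  also have "\<dots> \<le> (\<Prod>j<k. real j + real n * r)"
    by (rule sum_index_lists_power_card_le[OF r0])
  finally show ?thesis by (simp add: r_def)
qed

lemma expect_sum_coords:
  assumes "finite \<Omega>" "sum \<omega> \<Omega> = 1"
  shows "expect n \<Omega> \<omega> (\<lambda>h. \<Sum>i<n. Y (h i)) = real n * (\<Sum>x\<in>\<Omega>. \<omega> x * Y x)"
proof -
  have "expect n \<Omega> \<omega> (\<lambda>h. Y (h i)) = (\<Sum>x\<in>\<Omega>. \<omega> x * Y x)" if "i < n" for i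
    using expect_prod_list[OF assms, of "[i]" n Y] that by simp
  then show ?thesis by (simp add: expect_sum)
qed

text \<open>A second moment argument: the variance of the sum is at most \<open>\<mu>\<close>. The
  quadratic 1 - 4 (s/\<mu> - 1)^2 is at most 1 everywhere and at most 0 for s < \<mu>/2, so it
  minorises (2s/\<mu>)^\<kappa>; its mean is at least 1 - 4/\<mu>, and \<open>\<mu> \<ge> 8\<close>
  makes this at least 1/2.\<close>

lemma expect_powr_lower:
  assumes fin: "finite \<Omega>" and pos: "\<And>x. x \<in> \<Omega> \<Longrightarrow> \<omega> x \<ge> 0" and one: "sum \<omega> \<Omega> = 1"
    and Y: "\<And>x. x \<in> \<Omega> \<Longrightarrow> 0 \<le> Y x \<and> Y x \<le> 1"
    and \<mu>: "\<mu> = real n * (\<Sum>x\<in>\<Omega>. \<omega> x * Y x)" "\<mu> \<ge> 8" and \<kappa>: "\<kappa> > 0"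
  shows "2 powr (-\<kappa>) / 2 * \<mu> powr \<kappa> \<le> expect n \<Omega> \<omega> (\<lambda>h. (\<Sum>i<n. Y (h i)) powr \<kappa>)"
proof -
  define S where "S = (\<lambda>h. \<Sum>i<n. Y (h i))"
  have S1: "expect n \<Omega> \<omega> S = \<mu>" unfolding S_def \<mu>(1) by (rule expect_sum_coords[OF fin one])
  have S2: "expect n \<Omega> \<omega> (\<lambda>h. S h ^ 2) \<le> \<mu> * (1 + \<mu>)"
    using expect_power_sum_le[where k = 2 and n = n, OF fin pos one Y] unfolding S_def \<mu>(1) by (simp add: eval_nat_numeral)
  have pt: "(\<mu>/2) powr \<kappa> * (1 - 4 * (s / \<mu> - 1)^2) \<le> s powr \<kappa>" if "s \<ge> 0" for s
  proof (cases "s \<ge> \<mu>/2")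
    case True
    have "(\<mu>/2) powr \<kappa> * (1 - 4 * (s / \<mu> - 1)^2) \<le> (\<mu>/2) powr \<kappa> * 1"
      by (intro mult_left_mono) auto
    also have "\<dots> \<le> s powr \<kappa>" using True \<mu>(2) \<kappa> by (auto intro!: powr_mono2)
    finally show ?thesis .
  next
    case False
    then have "1 - s / \<mu> \<ge> 1/2" using \<mu>(2) by (simp add: field_simps)
    then have "(1/2)^2 \<le> (1 - s/\<mu>)^2" by (intro power_mono) auto
    then have "1 - 4 * (s / \<mu> - 1)^2 \<le> 0" using power2_commute[of 1 "s/\<mu>"] by (simp add: power_divide)
    then have "(\<mu>/2) powr \<kappa> * (1 - 4 * (s / \<mu> - 1)^2) \<le> 0" by (intro mult_nonneg_nonpos) auto
    then show ?thesis using powr_ge_zero[of s \<kappa>] by linarith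
  qed
  have "expect n \<Omega> \<omega> (\<lambda>h. (\<mu>/2) powr \<kappa> * (1 - 4 * (S h / \<mu> - 1)^2)) \<le> expect n \<Omega> \<omega> (\<lambda>h. S h powr \<kappa>)"
  proof (rule expect_mono[OF pos])
    fix h assume "h \<in> {..<n} \<rightarrow>\<^sub>E \<Omega>"
    then have "S h \<ge> 0" unfolding S_def using Y by (intro sum_nonneg) (auto simp: PiE_iff)
    then show "(\<mu>/2) powr \<kappa> * (1 - 4 * (S h / \<mu> - 1)^2) \<le> S h powr \<kappa>" by (rule pt)
  qed
  moreover have "expect n \<Omega> \<omega> (\<lambda>h. (\<mu>/2) powr \<kappa> * (1 - 4 * (S h / \<mu> - 1)^2))
      \<ge> (\<mu>/2) powr \<kappa> * (1/2)"
  proof -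
    have "(\<lambda>h. 1 - 4 * (S h / \<mu> - 1)^2) = (\<lambda>h. ((-4/\<mu>^2) * S h ^ 2 + (8/\<mu>) * S h) + (-3))"
      using \<mu>(2) by (auto simp: fun_eq_iff field_simps power2_eq_square)
    then have "expect n \<Omega> \<omega> (\<lambda>h. 1 - 4 * (S h / \<mu> - 1)^2)
        = (-4/\<mu>^2) * expect n \<Omega> \<omega> (\<lambda>h. S h ^ 2) + (8/\<mu>) * \<mu> - 3"
      using S1 by (simp only: expect_add expect_scale expect_const[OF fin one])
    moreover have "(-4/\<mu>^2) * expect n \<Omega> \<omega> (\<lambda>h. S h ^ 2) \<ge> (-4/\<mu>^2) * (\<mu> * (1 + \<mu>))"
      by (rule mult_left_mono_neg[OF S2]) simp
    moreover have "(-4/\<mu>^2) * (\<mu> * (1 + \<mu>)) + (8/\<mu>) * \<mu> - 3 = 1 - 4/\<mu>"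
      using \<mu>(2) by (simp add: field_simps power2_eq_square)
    moreover have "4 / \<mu> \<le> 1/2" using \<mu>(2) by (simp add: field_simps)
    ultimately have "expect n \<Omega> \<omega> (\<lambda>h. 1 - 4 * (S h / \<mu> - 1)^2) \<ge> 1/2"
      by linarith
    then show ?thesis unfolding expect_scale by (intro mult_left_mono) auto
  qed
  moreover have "(\<mu>/2) powr \<kappa> * (1/2) = 2 powr (-\<kappa>) / 2 * \<mu> powr \<kappa>"
    using \<mu>(2) by (simp add: powr_divide powr_minus field_simps)
  ultimately show ?thesis by (simp add: S_def)
qed

text \<open>A real exponent is traded for the integer exponent k, whose moments are computable:
  (s/\<mu>)^\<kappa> is at most 1 if s \<le> \<mu>, and at most (s/\<mu>)^k otherwise.\<close>

lemma expect_powr_upper: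
  assumes fin: "finite \<Omega>" and pos: "\<And>x. x \<in> \<Omega> \<Longrightarrow> \<omega> x \<ge> 0" and one: "sum \<omega> \<Omega> = 1"
    and Y: "\<And>x. x \<in> \<Omega> \<Longrightarrow> 0 \<le> Y x \<and> Y x \<le> 1"
    and \<mu>: "\<mu> = real n * (\<Sum>x\<in>\<Omega>. \<omega> x * Y x)" "\<mu> \<ge> 1" and \<kappa>: "0 < \<kappa>" "\<kappa> \<le> real k"
  shows "expect n \<Omega> \<omega> (\<lambda>h. (\<Sum>i<n. Y (h i)) powr \<kappa>) \<le> (1 + (real k + 1) ^ k) * \<mu> powr \<kappa>"
proof -
  define S where "S = (\<lambda>h. \<Sum>i<n. Y (h i))"
  have pt: "s powr \<kappa> \<le> \<mu> powr \<kappa> * (1 + (1/\<mu>^k) * s^k)" if "s \<ge> 0" for s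
  proof -
    have "(s/\<mu>) powr \<kappa> \<le> 1 + (s/\<mu>)^k"
    proof (cases "s/\<mu> \<le> 1")
      case True
      then have "(s/\<mu>) powr \<kappa> \<le> 1" using that \<mu>(2) \<kappa> by (intro powr_le1) auto
      then show ?thesis using that \<mu>(2) by (smt (verit) divide_nonneg_nonneg zero_le_power)
    next
      case False
      then have "(s/\<mu>) powr \<kappa> \<le> (s/\<mu>) powr real k" using \<kappa> by (intro powr_mono) auto
      also have "\<dots> = (s/\<mu>)^k" using False by (intro powr_realpow) auto
      finally show ?thesis by simp
    qed
    then have "\<mu> powr \<kappa> * (s/\<mu>) powr \<kappa> \<le> \<mu> powr \<kappa> * (1 + (s/\<mu>)^k)"
      by (intro mult_left_mono) auto
    moreover have "\<mu> powr \<kappa> * (s/\<mu>) powr \<kappa> = s powr \<kappa>"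
      using that \<mu>(2) by (simp flip: powr_mult)
    ultimately show ?thesis by (simp add: power_divide)
  qed
  have Sk: "expect n \<Omega> \<omega> (\<lambda>h. S h ^ k) \<le> (real k + 1)^k * \<mu>^k"
  proof -
    have "expect n \<Omega> \<omega> (\<lambda>h. S h ^ k) \<le> (\<Prod>j<k. real j + \<mu>)"
      using expect_power_sum_le[where k = k and n = n, OF fin pos one Y] unfolding S_def \<mu>(1) by simp
    also have "\<dots> \<le> (\<Prod>j<k. (real k + 1) * \<mu>)"
    proof (rule prod_mono, rule conjI)
      fix j assume "j \<in> {..<k}"
      then have "real j \<le> real k * \<mu>" using \<mu>(2) by (smt (verit) lessThan_iff mult_le_cancel_left1 of_nat_0_le_iff of_nat_less_iff)
      then show "real j + \<mu> \<le> (real k + 1) * \<mu>" by (simp add: algebra_simps)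
    qed (use \<mu>(2) in auto)
    finally show ?thesis by (simp add: power_mult_distrib)
  qed
  have "expect n \<Omega> \<omega> (\<lambda>h. S h powr \<kappa>) \<le> expect n \<Omega> \<omega> (\<lambda>h. \<mu> powr \<kappa> * (1 + (1/\<mu>^k) * S h ^ k))"
  proof (rule expect_mono[OF pos])
    fix h assume "h \<in> {..<n} \<rightarrow>\<^sub>E \<Omega>"
    then have "S h \<ge> 0" unfolding S_def using Y by (intro sum_nonneg) (auto simp: PiE_iff)
    then show "S h powr \<kappa> \<le> \<mu> powr \<kappa> * (1 + (1/\<mu>^k) * S h ^ k)" by (rule pt)
  qed
  also have "\<dots> = \<mu> powr \<kappa> * (1 + (1/\<mu>^k) * expect n \<Omega> \<omega> (\<lambda>h. S h ^ k))"
    by (simp only: expect_add expect_scale expect_const[OF fin one])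
  also have "\<dots> \<le> \<mu> powr \<kappa> * (1 + (1/\<mu>^k) * ((real k + 1)^k * \<mu>^k))"
    using \<mu>(2) by (intro mult_left_mono add_left_mono Sk) auto
  also have "\<dots> = (1 + (real k + 1) ^ k) * \<mu> powr \<kappa>"
    using \<mu>(2) by simp
  finally show ?thesis by (simp add: S_def)
qed

section \<open>Exponential sums of polynomial growth\<close>

lemma poly_times_geometric_bounded:
  fixes b C :: real
  assumes "b > 1"
  shows "\<exists>D. \<forall>T::nat. C * (1 + 2 * real T) ^ m / b ^ T \<le> D"
proof -
  have "(\<lambda>T::nat. C * (1 + 2 * real T) ^ m / b ^ T) \<longlonglongrightarrow> 0"
    using assms by real_asymp
  then have "Bseq (\<lambda>T::nat. C * (1 + 2 * real T) ^ m / b ^ T)"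
    by (meson convergent_def convergent_imp_Bseq)
  then obtain D where "\<And>T. norm (C * (1 + 2 * real T) ^ m / b ^ T) \<le> D"
    using BseqE by blast
  then show ?thesis by (intro exI[of _ D] allI) (metis abs_le_D1 real_norm_def)
qed

text \<open>The recurrence is run backwards from L + M to L: each step divides by b > 1, so the
  errors add up to a geometric series and the far value is damped by b^M.\<close>

lemma recurrence_bound_gt1:
  fixes F :: "nat \<Rightarrow> real"
  assumes "b > 1" "\<And>i. i < M \<Longrightarrow> \<bar>F (Suc (L + i)) - b * F (L + i)\<bar> \<le> K"
  shows "\<bar>F L\<bar> \<le> \<bar>F (L + M)\<bar> / b ^ M + K / (b - 1) * (1 - 1 / b ^ M)"
  using assms(2)
proof (induction M)
  case (Suc M)
  have "\<bar>F (Suc (L + M)) - b * F (L + M)\<bar> \<le> K" by (rule Suc.prems) simp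
  then have "b * \<bar>F (L + M)\<bar> \<le> \<bar>F (Suc (L + M))\<bar> + K"
    using abs_mult[of b "F (L + M)"] assms(1) by linarith
  then have "\<bar>F (L + M)\<bar> \<le> (\<bar>F (Suc (L + M))\<bar> + K) / b"
    using assms(1) by (simp add: field_simps)
  then have "\<bar>F (L + M)\<bar> / b ^ M \<le> (\<bar>F (Suc (L + M))\<bar> + K) / b / b ^ M"
    using assms(1) by (intro divide_right_mono) auto
  moreover have "\<bar>F L\<bar> \<le> \<bar>F (L + M)\<bar> / b ^ M + K / (b - 1) * (1 - 1 / b ^ M)"
    using Suc by simp
  moreover have "(\<bar>F (Suc (L + M))\<bar> + K) / b / b ^ M + K / (b - 1) * (1 - 1 / b ^ M)
      = \<bar>F (L + Suc M)\<bar> / b ^ Suc M + K / (b - 1) * (1 - 1 / b ^ Suc M)"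
  proof -
    have "K / (b - 1) * (1 - 1 / b ^ Suc M) - K / (b - 1) * (1 - 1 / b ^ M)
        = K / (b - 1) * ((b - 1) / b ^ Suc M)"
      using assms(1) unfolding right_diff_distrib[symmetric] by (simp add: field_simps)
    also have "\<dots> = K / b ^ Suc M" using assms(1) by simp
    finally show ?thesis by (simp add: add_divide_distrib)
  qed
  ultimately show ?case by linarith
qed simp

text \<open>Run forwards, the recurrence contracts, so no value beyond L is needed.\<close>

lemma recurrence_bound_lt1:
  fixes F :: "nat \<Rightarrow> real"
  assumes "0 < b" "b < 1" "0 \<le> K" "\<And>i. i < L \<Longrightarrow> \<bar>F (Suc i) - b * F i\<bar> \<le> K"
  shows "\<bar>F L\<bar> \<le> \<bar>F 0\<bar> + K / (1 - b)"
  using assms(4)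
proof (induction L)
  case 0
  then show ?case using assms by simp
next
  case (Suc L)
  have "\<bar>F (Suc L) - b * F L\<bar> \<le> K" by (rule Suc.prems) simp
  then have "\<bar>F (Suc L)\<bar> \<le> b * \<bar>F L\<bar> + K"
    using abs_mult[of b "F L"] assms(1) by linarith
  also have "\<dots> \<le> b * (\<bar>F 0\<bar> + K / (1 - b)) + K"
    using Suc assms by (intro add_right_mono mult_left_mono) auto
  also have "\<dots> = b * \<bar>F 0\<bar> + K / (1 - b)"
    using assms by (simp add: field_simps)
  also have "\<dots> \<le> \<bar>F 0\<bar> + K / (1 - b)"
    using assms mult_right_mono[of b 1 "\<bar>F 0\<bar>"] by simp
  finally show ?case .
qed

text \<open>Each step F (L + 1) - b * F L removes one base b. The bound K does not depend on the coefficients, at the price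
  of knowing F on a longer initial segment than the one on which it is bounded.\<close>

lemma exp_sum_bounded:
  fixes B :: "real set" and C :: real
  assumes "finite B" "\<And>b. b \<in> B \<Longrightarrow> 0 < b \<and> b \<noteq> 1" "0 \<le> C"
  shows "\<exists>K. \<forall>T c \<gamma>. (\<forall>L \<le> 4 ^ card B * (T + 1).
             \<bar>c + (\<Sum>b\<in>B. \<gamma> b * b ^ L)\<bar> \<le> C * (1 + real L) ^ m) \<longrightarrow>
           (\<forall>L \<le> T. \<bar>c + (\<Sum>b\<in>B. \<gamma> b * b ^ L)\<bar> \<le> K)"
  using assms
proof (induction B arbitrary: C rule: finite_induct)
  case empty
  \<comment> \<open>Without bases only the constant c is left, and the hypothesis at L = 0 bounds it
    by C whatever m is.\<close>
  show ?case by (intro exI[of _ C]) (auto dest!: spec[of _ 0])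
next
  case (insert b B)
  have b: "0 < b" "b \<noteq> 1" using insert.prems(1) by auto
  \<comment> \<open>The factor 1 + b bounds the difference F (L + 1) - b * F L, and 2^m absorbs the
    shift, since 1 + (L + 1) \<le> 2 (1 + L).\<close>
  define C' where "C' = (1 + b) * C * 2 ^ m"
  have "C' \<ge> 0" using b insert.prems(2) by (simp add: C'_def)
  then obtain K where K: "\<And>T c \<gamma>. (\<forall>L \<le> 4 ^ card B * (T + 1).
             \<bar>c + (\<Sum>b\<in>B. \<gamma> b * b ^ L)\<bar> \<le> C' * (1 + real L) ^ m) \<Longrightarrow>
           (\<forall>L \<le> T. \<bar>c + (\<Sum>b\<in>B. \<gamma> b * b ^ L)\<bar> \<le> K)"
    using insert.IH[of C'] insert.prems(1) by auto
  obtain D where D: "b > 1 \<Longrightarrow> C * (1 + 2 * real T) ^ m / b ^ T \<le> D" for T :: nat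
    using poly_times_geometric_bounded[of b C m] by blast
  define K' where "K' = (if b > 1 then D + \<bar>K\<bar> / (b - 1) else C + \<bar>K\<bar> / (1 - b))"
  show ?case
  proof (intro exI[of _ K'] allI impI)
    fix T :: nat and c :: real and \<gamma> :: "real \<Rightarrow> real" and L :: nat
    define F where "F = (\<lambda>L. c + (\<Sum>b\<in>insert b B. \<gamma> b * b ^ L))"
    assume A: "\<forall>L \<le> 4 ^ card (insert b B) * (T + 1). \<bar>c + (\<Sum>b\<in>insert b B. \<gamma> b * b ^ L)\<bar> \<le> C * (1 + real L) ^ m"
    then have FC: "\<bar>F L\<bar> \<le> C * (1 + real L) ^ m" if "L \<le> 4 * 4 ^ card B * (T + 1)" for L
    proof -
      have "4 ^ card (insert b B) = (4 * 4 ^ card B :: nat)" using insert.hyps by simp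
      then show ?thesis using A that by (simp only: F_def)
    qed
    assume LT: "L \<le> T"
    define G where "G = (\<lambda>L. c * (1 - b) + (\<Sum>b'\<in>B. (\<gamma> b' * (b' - b)) * b' ^ L))"
    have G: "G L = F (Suc L) - b * F L" for L
    proof -
      have "F (Suc L) - b * F L = c * (1 - b) + (\<Sum>b'\<in>insert b B. \<gamma> b' * b' ^ Suc L - b * (\<gamma> b' * b' ^ L))"
        unfolding F_def sum_subtractf sum_distrib_left[symmetric] by algebra
      also have "(\<Sum>b'\<in>insert b B. \<gamma> b' * b' ^ Suc L - b * (\<gamma> b' * b' ^ L))
          = (\<Sum>b'\<in>B. \<gamma> b' * b' ^ Suc L - b * (\<gamma> b' * b' ^ L))"
        using insert.hyps by simp
      also have "\<dots> = (\<Sum>b'\<in>B. (\<gamma> b' * (b' - b)) * b' ^ L)"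
        by (rule sum.cong) (simp_all add: algebra_simps)
      finally show ?thesis by (simp add: G_def)
    qed
    \<comment> \<open>The induction hypothesis is applied with 2 * T in place of T, because for b >
      1 the recurrence is run backwards from L + T. This doubling and the shift by one are what the
      factor 4 per base pays for.\<close>
    have "\<bar>G L\<bar> \<le> C' * (1 + real L) ^ m" if "L \<le> 4 ^ card B * (2 * T + 1)" for L
    proof -
      have "4 ^ card B * (2 * T + 1) + 1 \<le> 4 * 4 ^ card B * (T + 1)"
      proof -
        have "4 ^ card B \<ge> (1::nat)" by simp
        then have "2 * (4 ^ card B * T) + 4 ^ card B + 1 \<le> 4 * (4 ^ card B * T) + 4 * (4 ^ card B :: nat)"
          by linarith
        then show ?thesis by (simp add: algebra_simps)
      qed
      then have r: "Suc L \<le> 4 * 4 ^ card B * (T + 1)" using that by linarith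
      have "\<bar>G L\<bar> \<le> \<bar>F (Suc L)\<bar> + b * \<bar>F L\<bar>"
        unfolding G using b abs_mult[of b "F L"] by linarith
      also have "\<dots> \<le> C * (1 + real (Suc L)) ^ m + b * (C * (1 + real L) ^ m)"
        using r b by (intro add_mono mult_left_mono FC) auto
      also have "\<dots> \<le> C * (2 * (1 + real L)) ^ m + b * (C * (2 * (1 + real L)) ^ m)"
        using b insert.prems(2) by (intro add_mono mult_left_mono power_mono) auto
      also have "\<dots> = C' * (1 + real L) ^ m"
        unfolding power_mult_distrib C'_def by algebra
      finally show ?thesis .
    qed
    then have "\<forall>L \<le> 2 * T. \<bar>G L\<bar> \<le> K"
      unfolding G_def by (intro K) auto
    then have GK: "\<bar>F (Suc L) - b * F L\<bar> \<le> \<bar>K\<bar>" if "L \<le> 2 * T" for L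
      using that unfolding G by fastforce
    have F0: "\<bar>F 0\<bar> \<le> C" using FC[of 0] by simp
    have "\<bar>F L\<bar> \<le> K'"
    proof (cases "b > 1")
      case True
      \<comment> \<open>At L + T only the polynomial bound is available, but division by b^T makes
        it bounded uniformly in T; this is the constant D.\<close>
      have "\<bar>F L\<bar> \<le> \<bar>F (L + T)\<bar> / b ^ T + \<bar>K\<bar> / (b - 1) * (1 - 1 / b ^ T)"
        by (rule recurrence_bound_gt1[OF True]) (use GK LT in auto)
      also have "\<dots> \<le> D + \<bar>K\<bar> / (b - 1) * 1"
      proof (rule add_mono)
        have "2 * T \<le> 4 * 4 ^ card B * (T + 1)"
        proof -
          have "1 * T \<le> 4 ^ card B * T" by (intro mult_right_mono) auto
          moreover have "4 * 4 ^ card B * (T + 1) = 4 * (4 ^ card B * T) + 4 * (4 ^ card B :: nat)"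
            by (simp add: algebra_simps)
          ultimately show ?thesis by linarith
        qed
        then have "\<bar>F (L + T)\<bar> \<le> C * (1 + real (L + T)) ^ m" using LT by (intro FC) linarith
        also have "\<dots> \<le> C * (1 + 2 * real T) ^ m"
          using LT insert.prems(2) by (intro mult_left_mono power_mono) auto
        finally have "\<bar>F (L + T)\<bar> / b ^ T \<le> C * (1 + 2 * real T) ^ m / b ^ T"
          using b by (intro divide_right_mono) auto
        then show "\<bar>F (L + T)\<bar> / b ^ T \<le> D" using D[OF True, of T] by linarith
        show "\<bar>K\<bar> / (b - 1) * (1 - 1 / b ^ T) \<le> \<bar>K\<bar> / (b - 1) * 1"
          using True by (intro mult_left_mono) auto
      qed
      finally show ?thesis using True by (simp add: K'_def)
    next
      case False
      then have "b < 1" using b by simp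
      then have "\<bar>F L\<bar> \<le> \<bar>F 0\<bar> + \<bar>K\<bar> / (1 - b)"
        using b GK LT by (intro recurrence_bound_lt1) auto
      then show ?thesis using False F0 by (simp add: K'_def)
    qed
    then show "\<bar>c + (\<Sum>b\<in>insert b B. \<gamma> b * b ^ L)\<bar> \<le> K'" by (simp add: F_def)
  qed
qed

text \<open>Only the bases are recorded and the coefficients are existential, because the later
  bounds may depend on the bases but not on the coefficients.\<close>

definition exp_sums :: "real set \<Rightarrow> (nat \<Rightarrow> real) set" where
  "exp_sums B = {F. \<exists>\<gamma>. \<forall>L. F L = (\<Sum>b\<in>B. \<gamma> b * b ^ L)}"

section \<open>Closure properties of exponential sums\<close>

lemma exp_sums_mono:
  assumes "finite B" "A \<subseteq> B"
  shows "exp_sums A \<subseteq> exp_sums B"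
proof
  fix F assume "F \<in> exp_sums A"
  then obtain \<gamma> where \<gamma>: "\<And>L. F L = (\<Sum>b\<in>A. \<gamma> b * b ^ L)" by (auto simp: exp_sums_def)
  have "F L = (\<Sum>b\<in>B. (if b \<in> A then \<gamma> b else 0) * b ^ L)" for L
    unfolding \<gamma> using assms by (intro sum.mono_neutral_cong_left) auto
  then show "F \<in> exp_sums B" by (auto simp: exp_sums_def)
qed

lemma exp_sums_scale:
  assumes "F \<in> exp_sums B"
  shows "(\<lambda>L. c * F L) \<in> exp_sums B"
proof -
  obtain \<gamma> where \<gamma>: "\<And>L. F L = (\<Sum>b\<in>B. \<gamma> b * b ^ L)" using assms by (auto simp: exp_sums_def)
  have "c * F L = (\<Sum>b\<in>B. (c * \<gamma> b) * b ^ L)" for L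
    unfolding \<gamma> by (simp add: sum_distrib_left mult.assoc)
  then show ?thesis by (auto simp: exp_sums_def)
qed

lemma exp_sums_zero: "(\<lambda>L. 0) \<in> exp_sums B"
  by (auto simp: exp_sums_def intro!: exI[of _ "\<lambda>_. 0"])

lemma exp_sums_add:
  assumes "F \<in> exp_sums B" "G \<in> exp_sums B"
  shows "(\<lambda>L. F L + G L) \<in> exp_sums B"
proof -
  obtain \<gamma> \<delta> where "\<And>L. F L = (\<Sum>b\<in>B. \<gamma> b * b ^ L)" "\<And>L. G L = (\<Sum>b\<in>B. \<delta> b * b ^ L)"
    using assms by (auto simp: exp_sums_def)
  then have "F L + G L = (\<Sum>b\<in>B. (\<gamma> b + \<delta> b) * b ^ L)" for L
    by (simp add: sum.distrib distrib_right)
  then show ?thesis by (auto simp: exp_sums_def)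
qed

lemma exp_sums_sum:
  assumes "\<And>i. i \<in> I \<Longrightarrow> F i \<in> exp_sums B"
  shows "(\<lambda>L. \<Sum>i\<in>I. F i L) \<in> exp_sums B"
  using assms by (induction I rule: infinite_finite_induct) (simp_all add: exp_sums_zero exp_sums_add)

lemma exp_sums_single: "b \<in> B \<Longrightarrow> finite B \<Longrightarrow> (\<lambda>L. b ^ L) \<in> exp_sums B"
  by (rule subsetD[OF exp_sums_mono[of B "{b}"]]) (auto simp: exp_sums_def intro!: exI[of _ "\<lambda>_. 1"])

lemma exp_sums_mult:
  assumes "finite A" "finite B" "F \<in> exp_sums A" "G \<in> exp_sums B"
  shows "(\<lambda>L. F L * G L) \<in> exp_sums ((\<lambda>(a, b). a * b) ` (A \<times> B))"
proof -
  obtain \<gamma> \<delta> where F: "\<And>L. F L = (\<Sum>b\<in>A. \<gamma> b * b ^ L)" and G: "\<And>L. G L = (\<Sum>b\<in>B. \<delta> b * b ^ L)"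
    using assms(3,4) by (auto simp: exp_sums_def)
  have "(\<lambda>L. F L * G L) = (\<lambda>L. \<Sum>a\<in>A. \<Sum>b\<in>B. (\<gamma> a * \<delta> b) * (a * b) ^ L)"
    unfolding F G sum_product by (simp add: power_mult_distrib mult.assoc mult.left_commute)
  also have "\<dots> \<in> exp_sums ((\<lambda>(a, b). a * b) ` (A \<times> B))"
    by (intro exp_sums_sum exp_sums_scale exp_sums_single) (use assms in auto)
  finally show ?thesis .
qed

fun set_power :: "real set \<Rightarrow> nat \<Rightarrow> real set" where
  "set_power A 0 = {1}"
| "set_power A (Suc k) = (\<lambda>(a, b). a * b) ` (A \<times> set_power A k)"

lemma finite_set_power: "finite A \<Longrightarrow> finite (set_power A k)"
  by (induction k) auto

lemma set_power_pos: "(\<And>a. a \<in> A \<Longrightarrow> 0 < a) \<Longrightarrow> b \<in> set_power A k \<Longrightarrow> 0 < b"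
  by (induction k arbitrary: b) auto

lemma set_power_mono:
  assumes "1 \<in> A" "j \<le> k"
  shows "set_power A j \<subseteq> set_power A k"
proof (rule lift_Suc_mono_le[OF _ assms(2)])
  fix n
  show "set_power A n \<subseteq> set_power A (Suc n)"
    using assms(1) by (force simp: image_iff)
qed

text \<open>The base 1 pads short products, so that index sets of every size up to k share one set
  of bases.\<close>

lemma exp_sums_prod:
  assumes "finite A" "1 \<in> A" "finite I" "card I \<le> k" "\<And>i. i \<in> I \<Longrightarrow> F i \<in> exp_sums A"
  shows "(\<lambda>L. \<Prod>i\<in>I. F i L) \<in> exp_sums (set_power A k)"
proof -
  have "(\<lambda>L. \<Prod>i\<in>I. F i L) \<in> exp_sums (set_power A (card I))"
    using assms(3,5)
  proof (induction I rule: finite_induct)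
    case empty
    show ?case using exp_sums_single[of 1 "{1}"] by simp
  next
    case (insert i I)
    then show ?case using exp_sums_mult[OF assms(1) finite_set_power[OF assms(1)]] by simp
  qed
  then show ?thesis
    using exp_sums_mono[OF finite_set_power[OF assms(1)] set_power_mono[OF assms(2,4)]] by blast
qed

text \<open>Base 1 cannot be removed by the difference step, as a bounded difference still allows
  linear growth. Its coefficient is therefore passed to \<open>exp_sum_bounded\<close> as the
  constant c.\<close>

lemma exp_sums_bounded:
  assumes "finite B" "\<And>b. b \<in> B \<Longrightarrow> 0 < b" "0 \<le> C"
  shows "\<exists>K. \<forall>T F. F \<in> exp_sums B \<longrightarrow>
           (\<forall>L \<le> 4 ^ card B * (T + 1). \<bar>F L\<bar> \<le> C * (1 + real L) ^ m) \<longrightarrow> \<bar>F T\<bar> \<le> K"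
proof -
  define B' where "B' = B - {1}"
  have fin: "finite B'" using assms(1) by (simp add: B'_def)
  obtain K where K: "\<And>T c \<gamma>. (\<forall>L \<le> 4 ^ card B' * (T + 1).
             \<bar>c + (\<Sum>b\<in>B'. \<gamma> b * b ^ L)\<bar> \<le> C * (1 + real L) ^ m) \<Longrightarrow>
           (\<forall>L \<le> T. \<bar>c + (\<Sum>b\<in>B'. \<gamma> b * b ^ L)\<bar> \<le> K)"
    using exp_sum_bounded[OF fin _ assms(3), of m] assms(2) by (auto simp: B'_def)
  show ?thesis
  proof (intro exI[of _ K] allI impI)
    fix T F
    assume "F \<in> exp_sums B" and bd: "\<forall>L \<le> 4 ^ card B * (T + 1). \<bar>F L\<bar> \<le> C * (1 + real L) ^ m"
    then obtain \<gamma> where \<gamma>: "\<And>L. F L = (\<Sum>b\<in>B. \<gamma> b * b ^ L)" by (auto simp: exp_sums_def)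
    define c where "c = (if 1 \<in> B then \<gamma> 1 else 0)"
    have F: "F L = c + (\<Sum>b\<in>B'. \<gamma> b * b ^ L)" for L
      unfolding \<gamma> c_def B'_def using assms(1) by (simp add: sum.remove[of B 1])
    have "4 ^ card B' \<le> (4 ^ card B :: nat)"
      using card_mono[OF assms(1), of B'] by (intro power_increasing) (auto simp: B'_def)
    then have "4 ^ card B' * (T + 1) \<le> 4 ^ card B * (T + 1)" by (rule mult_right_mono) simp
    then show "\<bar>F T\<bar> \<le> K"
      using K[of T c \<gamma>] bd unfolding F by (meson le_refl le_trans)
  qed
qed

section \<open>Forms comparable to a power of the q-norm\<close>

definition sym_support :: "real set \<Rightarrow> real set" where
  "sym_support V = insert 0 (V \<union> uminus ` V)"

text \<open>The law that puts mass w v / (2 * n) on each of v and -v, so that n independent coordinates take the values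
  of modulus v about w v times in total; the remaining mass sits at 0.\<close>

definition sym_weight :: "real set \<Rightarrow> (real \<Rightarrow> real) \<Rightarrow> nat \<Rightarrow> real \<Rightarrow> real" where
  "sym_weight V w n x = (if x = 0 then 1 - sum w V / n else w \<bar>x\<bar> / (2 * n))"

lemma sum_sym_weight:
  assumes "finite V" "V \<subseteq> {0<..}"
  shows "(\<Sum>x\<in>sym_support V. sym_weight V w n x * g x)
       = (1 - sum w V / n) * g 0 + (\<Sum>v\<in>V. w v / (2 * n) * (g v + g (- v)))"
proof -
  have 0: "0 \<notin> V \<union> uminus ` V" "V \<inter> uminus ` V = {}"
  proof -
    have pos: "v > 0" if "v \<in> V" for v using assms(2) that by auto
    then show "0 \<notin> V \<union> uminus ` V" by fastforce
    have "- v \<notin> V" if "v \<in> V" for v using pos[OF that] pos[of "- v"] by auto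
    then show "V \<inter> uminus ` V = {}" by auto
  qed
  have "(\<Sum>x\<in>sym_support V. sym_weight V w n x * g x)
      = (1 - sum w V / n) * g 0 + ((\<Sum>x\<in>V. sym_weight V w n x * g x) + (\<Sum>x\<in>uminus ` V. sym_weight V w n x * g x))"
    unfolding sym_support_def using assms(1) 0
    by (subst sum.insert) (auto simp: sum.union_disjoint sym_weight_def)
  also have "(\<Sum>x\<in>V. sym_weight V w n x * g x) = (\<Sum>v\<in>V. w v / (2 * n) * g v)"
    using assms(2) by (intro sum.cong) (force simp: sym_weight_def)+
  also have "(\<Sum>x\<in>uminus ` V. sym_weight V w n x * g x) = (\<Sum>v\<in>V. w v / (2 * n) * g (- v))"
    using assms(2) by (subst sum.reindex) (force simp: sym_weight_def intro!: sum.cong)+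
  finally show ?thesis by (simp add: sum.distrib distrib_left)
qed

text \<open>Both inequalities are averaged over the law \<open>sym_weight\<close>. F is the exact
  mean of the form: odd moments cancel, and the moment of even order c > 0 is (\<Sum>v. w v * v^c) /
  n. The condition \<open>sum w V \<le> real n\<close> keeps the mass at 0 nonnegative, and
  \<open>V \<subseteq> {0<..1}\<close> puts \<open>\<bar>x\<bar> powr q\<close> into [0,1], as the
  moment bounds require.\<close>

lemma symmetric_random_form_bounds:
  fixes a :: "nat list \<Rightarrow> real"
  assumes V: "finite V" "V \<subseteq> {0<..1}" and w: "\<And>v. v \<in> V \<Longrightarrow> 0 \<le> w v" "sum w V \<le> real n"
    and n: "0 < n" and q: "0 < q" and \<kappa>: "0 < \<kappa>" "\<kappa> \<le> real k" and C: "0 \<le> C"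
    and lower: "\<And>h. (\<Sum>i<n. \<bar>h i\<bar> powr q) powr \<kappa> \<le> (\<Sum>is\<in>index_lists n d. a is * (\<Prod>i\<leftarrow>is. h i))"
    and upper: "\<And>h. (\<Sum>is\<in>index_lists n d. a is * (\<Prod>i\<leftarrow>is. h i)) \<le> C * (\<Sum>i<n. \<bar>h i\<bar> powr q) powr \<kappa>"
    and \<mu>: "\<mu> = (\<Sum>v\<in>V. w v * v powr q)" "8 \<le> \<mu>"
    and F: "F = (\<Sum>is\<in>index_lists n d. a is * (\<Prod>i\<in>set is.
              if even (count_list is i) then (\<Sum>v\<in>V. w v * v ^ count_list is i) / real n else 0))"
  shows "2 powr (-\<kappa>) / 2 * \<mu> powr \<kappa> \<le> F" and "F \<le> C * (1 + (real k + 1) ^ k) * \<mu> powr \<kappa>"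
proof -
  define \<Omega> where "\<Omega> = sym_support V"
  define \<omega> where "\<omega> = sym_weight V w n"
  have V0: "V \<subseteq> {0<..}" using V by auto
  note S = sum_sym_weight[OF V(1) V0, of w n, folded \<Omega>_def \<omega>_def]
  have fin: "finite \<Omega>" using V by (simp add: \<Omega>_def sym_support_def)
  have pos: "\<omega> x \<ge> 0" if "x \<in> \<Omega>" for x
    using that w n V by (auto simp: \<omega>_def \<Omega>_def sym_weight_def sym_support_def field_simps)
  have one: "sum \<omega> \<Omega> = 1" using S[of "\<lambda>_. 1"] n by (simp add: field_simps flip: sum_distrib_left sum_divide_distrib)
  define Y where "Y = (\<lambda>x::real. \<bar>x\<bar> powr q)"
  have Y: "0 \<le> Y x \<and> Y x \<le> 1" if "x \<in> \<Omega>" for x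
    using that V q by (auto simp: Y_def \<Omega>_def sym_support_def intro!: powr_le1)
  have \<mu>': "\<mu> = real n * (\<Sum>x\<in>\<Omega>. \<omega> x * Y x)"
  proof -
    have "(\<Sum>x\<in>\<Omega>. \<omega> x * Y x) = (\<Sum>v\<in>V. w v * v powr q / n)"
      unfolding S using V0 q n by (simp add: Y_def) (intro sum.cong, auto simp: field_simps)
    then show ?thesis using n by (simp add: \<mu>(1) flip: sum_divide_distrib)
  qed
  define Q where "Q = (\<lambda>h. \<Sum>is\<in>index_lists n d. a is * (\<Prod>i\<leftarrow>is. h i))"
  have moment: "(\<Sum>x\<in>\<Omega>. \<omega> x * x ^ c) = (if even c then (\<Sum>v\<in>V. w v * v ^ c) / real n else 0)" if "0 < c" for c
    unfolding S using that n by (auto simp: sum_divide_distrib field_simps intro!: sum.cong)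
  have EQ: "expect n \<Omega> \<omega> Q = F"
  proof -
    have "expect n \<Omega> \<omega> Q = (\<Sum>is\<in>index_lists n d. a is * expect n \<Omega> \<omega> (\<lambda>h. \<Prod>i\<leftarrow>is. h i))"
      by (simp add: Q_def expect_sum expect_scale)
    also have "\<dots> = F"
      unfolding F
    proof (intro sum.cong refl arg_cong2[of _ _ _ _ "(*)"])
      fix "is" assume "is \<in> index_lists n d"
      then have "set is \<subseteq> {..<n}" by (auto simp: index_lists_def)
      then have "expect n \<Omega> \<omega> (\<lambda>h. \<Prod>i\<leftarrow>is. h i) = (\<Prod>i\<in>set is. \<Sum>x\<in>\<Omega>. \<omega> x * x ^ count_list is i)"
        using expect_prod_list[OF fin one, of "is" n "\<lambda>x. x"] by simp
      also have "\<dots> = (\<Prod>i\<in>set is. if even (count_list is i) then (\<Sum>v\<in>V. w v * v ^ count_list is i) / real n else 0)"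
      proof (rule prod.cong[OF refl])
        fix i assume "i \<in> set is"
        then have "0 < count_list is i" using count_list_0_iff[of "is" i] by linarith
        then show "(\<Sum>x\<in>\<Omega>. \<omega> x * x ^ count_list is i)
          = (if even (count_list is i) then (\<Sum>v\<in>V. w v * v ^ count_list is i) / real n else 0)"
          by (rule moment)
      qed
      finally show "expect n \<Omega> \<omega> (\<lambda>h. \<Prod>i\<leftarrow>is. h i) = \<dots>" .
    qed
    finally show ?thesis .
  qed
  have "2 powr (-\<kappa>) / 2 * \<mu> powr \<kappa> \<le> expect n \<Omega> \<omega> (\<lambda>h. (\<Sum>i<n. Y (h i)) powr \<kappa>)"
    by (rule expect_powr_lower[OF fin pos one Y \<mu>' \<mu>(2) \<kappa>(1)])
  also have "\<dots> \<le> expect n \<Omega> \<omega> Q"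
    using lower by (intro expect_mono pos) (auto simp: Y_def Q_def)
  finally show "2 powr (-\<kappa>) / 2 * \<mu> powr \<kappa> \<le> F" by (simp add: EQ)
  have "expect n \<Omega> \<omega> Q \<le> expect n \<Omega> \<omega> (\<lambda>h. C * (\<Sum>i<n. Y (h i)) powr \<kappa>)"
    using upper by (intro expect_mono pos) (auto simp: Y_def Q_def)
  also have "\<dots> = C * expect n \<Omega> \<omega> (\<lambda>h. (\<Sum>i<n. Y (h i)) powr \<kappa>)"
    by (rule expect_scale)
  also have "\<dots> \<le> C * ((1 + (real k + 1) ^ k) * \<mu> powr \<kappa>)"
    using \<mu>(2) by (intro mult_left_mono expect_powr_upper[OF fin pos one Y \<mu>' _ \<kappa>] C) auto
  finally show "F \<le> C * (1 + (real k + 1) ^ k) * \<mu> powr \<kappa>" by (simp add: EQ mult.assoc)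
qed

text \<open>\<open>\<kappa>\<close> stands for p/q, so the powers of the sum are p-th powers of the
  q-norm. The order of quantifiers matters: d and C serve all large n, while the coefficients a may
  change arbitrarily with n.\<close>

definition uniformly_comparable :: "real \<Rightarrow> real \<Rightarrow> nat \<Rightarrow> real \<Rightarrow> nat \<Rightarrow> bool" where
  "uniformly_comparable q \<kappa> d C n0 \<longleftrightarrow>
     (\<forall>n\<ge>n0. \<exists>a. \<forall>h. (\<Sum>i<n. \<bar>h i\<bar> powr q) powr \<kappa> \<le> (\<Sum>is\<in>index_lists n d. a is * (\<Prod>i\<leftarrow>is. h i)) \<and>
        (\<Sum>is\<in>index_lists n d. a is * (\<Prod>i\<leftarrow>is. h i)) \<le> C * (\<Sum>i<n. \<bar>h i\<bar> powr q) powr \<kappa>)"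

lemma card_set_index_lists: "is \<in> index_lists n d \<Longrightarrow> card (set is) \<le> d"
  using card_length[of "is"] by (auto simp: index_lists_def)

text \<open>The excluded ratio 1 would give the linear function L + s. That exception is the source
  of both arithmetic conclusions: ratio 1 arises only from c = q in one case and from an integer p/q
  in the other.\<close>

lemma exp_sums_geometric:
  fixes \<beta> :: real
  assumes "\<beta> \<noteq> 1"
  shows "(\<lambda>L. (\<Sum>j<L + s. \<beta> ^ j)) \<in> exp_sums {1, \<beta>}"
proof -
  have "(\<Sum>j<L + s. \<beta> ^ j) = (-1 / (\<beta> - 1)) * 1 ^ L + (\<beta> ^ s / (\<beta> - 1)) * \<beta> ^ L" for L
    unfolding geometric_sum[OF assms] by (simp add: power_add diff_divide_distrib mult.commute)
  then show ?thesis
    by (simp only:) (intro exp_sums_add exp_sums_scale exp_sums_single, auto)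
qed

lemma uniformly_comparable_even:
  assumes H: "uniformly_comparable q \<kappa> d C n0" and q: "0 < q" and \<kappa>: "0 < \<kappa>" and C: "0 \<le> C"
  shows "\<exists>m::nat. q = real (2 * m)"
proof (rule ccontr)
  assume no: "\<nexists>m::nat. q = real (2 * m)"
  define k where "k = nat \<lceil>\<kappa>\<rceil>"
  have k: "\<kappa> \<le> real k" using \<kappa> by (simp add: k_def)
  define \<beta> where "\<beta> = (\<lambda>c::nat. 2 powr (q - real c))"
  define A where "A = insert 1 (\<beta> ` {..d})"
  define B where "B = set_power A d"
  have A: "finite A" "1 \<in> A" "\<And>a. a \<in> A \<Longrightarrow> 0 < a" by (auto simp: A_def \<beta>_def)
  have B: "finite B" "\<And>b. b \<in> B \<Longrightarrow> 0 < b"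
    unfolding B_def using A finite_set_power set_power_pos by blast+
  \<comment> \<open>The factor 8^k comes from L + 8 \<le> 8 (1 + L).\<close>
  define C' where "C' = C * (1 + (real k + 1) ^ k) * 8 ^ k"
  have C': "0 \<le> C'" using C by (simp add: C'_def)
  obtain K where K: "\<And>T F. F \<in> exp_sums B \<Longrightarrow>
           (\<forall>L \<le> 4 ^ card B * (T + 1). \<bar>F L\<bar> \<le> C' * (1 + real L) ^ k) \<Longrightarrow> \<bar>F T\<bar> \<le> K"
    using exp_sums_bounded[OF B C', of k] by blast
  define c0 where "c0 = 2 powr (-\<kappa>) / 2"
  have c0: "c0 > 0" by (simp add: c0_def)
  have "filterlim (\<lambda>T::nat. c0 * real (T + 8) powr \<kappa>) at_top sequentially"
    using c0 \<kappa> by real_asymp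
  then obtain T :: nat where T: "c0 * real (T + 8) powr \<kappa> > K"
    by (metis (mono_tags, lifting) eventually_at_top_dense eventually_sequentially filterlim_at_top_dense le_refl)
  define V where "V = (\<lambda>L. (\<lambda>j. (1/2::real) ^ j) ` {..<L})"
  define w where "w = (\<lambda>v::real. v powr (- q))"
  \<comment> \<open>N is the largest number of atoms used. The shift by 8 gives
    \<open>\<mu> = L + 8\<close>, so that the moment estimates apply from L = 0 on.\<close>
  define N where "N = 4 ^ card B * (T + 1) + 8"
  \<comment> \<open>Only now is n chosen: it carries the weight of the longest law, hence of every
    law in the range, while K and T stay fixed.\<close>
  obtain n where n: "n \<ge> n0" "n > 0" "sum w (V N) \<le> real n"
  proof -
    obtain n' where "sum w (V N) \<le> real n'" using real_arch_simple by blast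
    then show ?thesis by (intro that[of "Suc (max n' n0)"]) auto
  qed
  obtain a where a: "\<And>h. (\<Sum>i<n. \<bar>h i\<bar> powr q) powr \<kappa> \<le> (\<Sum>is\<in>index_lists n d. a is * (\<Prod>i\<leftarrow>is. h i))"
     "\<And>h. (\<Sum>is\<in>index_lists n d. a is * (\<Prod>i\<leftarrow>is. h i)) \<le> C * (\<Sum>i<n. \<bar>h i\<bar> powr q) powr \<kappa>"
    using H n(1) unfolding uniformly_comparable_def by blast
  define F where "F = (\<lambda>L. \<Sum>is\<in>index_lists n d. a is * (\<Prod>i\<in>set is.
              if even (count_list is i) then (\<Sum>v\<in>V (L + 8). w v * v ^ count_list is i) / real n else 0))"
  have V: "finite (V L)" "V L \<subseteq> {0<..1}" for L
    by (auto simp: V_def power_le_one)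
  have sumV: "(\<Sum>v\<in>V L. g v) = (\<Sum>j<L. g ((1/2) ^ j))" for L and g :: "real \<Rightarrow> real"
    unfolding V_def by (subst sum.reindex) (auto simp: inj_on_def power_one_over)
  have wt: "w ((1/2) ^ j) * ((1/2) ^ j) ^ c = \<beta> c ^ j" for j c
  proof -
    have half: "(1/2::real) ^ i = 2 powr (- real i)" for i
      unfolding powr_minus by (subst powr_realpow) (simp_all only: zero_less_numeral power_one_over inverse_eq_divide)
    have "w ((1/2) ^ j) = 2 powr (real j * q)"
      unfolding w_def half powr_powr by simp
    moreover have "((1/2::real) ^ j) ^ c = 2 powr (- (real j * real c))"
    proof -
      have "((1/2::real) ^ j) ^ c = (1/2) ^ (j * c)" by (simp only: power_mult)
      then show ?thesis by (simp only: half of_nat_mult)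
    qed
    moreover have "\<beta> c ^ j = 2 powr ((q - real c) * real j)"
      unfolding \<beta>_def powr_powr[symmetric] by (rule powr_realpow[symmetric]) simp
    ultimately show ?thesis by (simp add: algebra_simps flip: powr_add)
  qed
  have est: "c0 * real (L + 8) powr \<kappa> \<le> F L \<and> F L \<le> C * (1 + (real k + 1) ^ k) * real (L + 8) powr \<kappa>"
    if "L \<le> 4 ^ card B * (T + 1)" for L
  proof -
    have w0: "0 \<le> w v" for v by (simp add: w_def)
    have "sum w (V (L + 8)) \<le> sum w (V N)"
      using that w0 by (intro sum_mono2) (auto simp: V_def N_def)
    then have wn: "sum w (V (L + 8)) \<le> real n" using n by linarith
    have "w ((1/2) ^ j) * ((1/2) ^ j) powr q = 1" for j
      by (simp add: w_def flip: powr_add)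
    then have \<mu>: "real (L + 8) = (\<Sum>v\<in>V (L + 8). w v * v powr q)" by (simp add: sumV)
    show ?thesis
      using symmetric_random_form_bounds[OF V w0 wn n(2) q \<kappa> k C a \<mu> _ F_def[THEN fun_cong, of L]]
      by (simp add: c0_def)
  qed
  have "F \<in> exp_sums B"
    unfolding F_def B_def
  proof (intro exp_sums_sum exp_sums_scale exp_sums_prod A finite_set card_set_index_lists)
    fix "is" i assume i: "is \<in> index_lists n d" "i \<in> set is"
    define c where "c = count_list is i"
    have "c \<le> d" using i count_le_length[of "is" i] by (auto simp: c_def index_lists_def)
    show "(\<lambda>L. if even c then (\<Sum>v\<in>V (L + 8). w v * v ^ c) / real n else 0) \<in> exp_sums A"
    proof (cases "even c")
      case True
      \<comment> \<open>This is where the assumption on q enters: c = q would make the moment linear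
        in L.\<close>
      then have "q \<noteq> real c" using no by (auto elim!: evenE)
      then have "\<beta> c \<noteq> 1" by (simp add: \<beta>_def)
      then have "(\<lambda>L. \<Sum>j<L + 8. \<beta> c ^ j) \<in> exp_sums A"
        using exp_sums_geometric[of "\<beta> c" 8] exp_sums_mono[OF A(1), of "{1, \<beta> c}"] \<open>c \<le> d\<close>
        by (auto simp: A_def)
      from exp_sums_scale[OF this, of "1 / real n"] show ?thesis using True by (simp add: sumV wt)
    qed (simp add: exp_sums_zero)
  qed
  then have "\<bar>F T\<bar> \<le> K"
  proof (rule K, intro allI impI)
    fix L assume L: "L \<le> 4 ^ card B * (T + 1)"
    have "0 \<le> c0 * real (L + 8) powr \<kappa>" using c0 by simp
    then have "0 \<le> F L" using est[OF L] by linarith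
    moreover have "real (L + 8) powr \<kappa> \<le> (8 * (1 + real L)) ^ k"
    proof -
      have "real (L + 8) powr \<kappa> \<le> real (L + 8) powr real k" using k by (intro powr_mono) auto
      also have "\<dots> = real (L + 8) ^ k" by (intro powr_realpow) auto
      also have "\<dots> \<le> (8 * (1 + real L)) ^ k" by (intro power_mono) auto
      finally show ?thesis .
    qed
    then have "C * (1 + (real k + 1) ^ k) * real (L + 8) powr \<kappa> \<le> C * (1 + (real k + 1) ^ k) * (8 * (1 + real L)) ^ k"
      using C by (intro mult_left_mono) auto
    moreover have "C * (1 + (real k + 1) ^ k) * (8 * (1 + real L)) ^ k = C' * (1 + real L) ^ k"
      unfolding C'_def power_mult_distrib by (simp only: mult.assoc)
    ultimately show "\<bar>F L\<bar> \<le> C' * (1 + real L) ^ k"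
      using est[OF L] by linarith
  qed
  moreover have "c0 * real (T + 8) powr \<kappa> \<le> F T"
  proof -
    have "T \<le> 4 ^ card B * T" by simp
    moreover have "4 ^ card B * (T + 1) = 4 ^ card B * T + 4 ^ card B" by simp
    ultimately have "T \<le> 4 ^ card B * (T + 1)" by linarith
    then show ?thesis using est by blast
  qed
  ultimately show False using T by linarith
qed

text \<open>With the single atom 1 of weight \<open>\<mu>\<close>, every even moment is
  \<open>\<mu> / n\<close>, so the mean F is a polynomial in \<open>\<mu>\<close> of degree at most
  d. For \<mu> = 8 * 2^j, the quotient G is an exponential sum in j with bases 2^(e - \<kappa>),
  none of them 1, and lies in [c0, C'].\<close>

lemma uniformly_comparable_nat:
  assumes H: "uniformly_comparable q \<kappa> d C n0" and q: "0 < q" and \<kappa>: "0 < \<kappa>" and C: "0 \<le> C"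
  shows "\<exists>m::nat. \<kappa> = real m"
proof (rule ccontr)
  assume no: "\<nexists>m::nat. \<kappa> = real m"
  define k where "k = nat \<lceil>\<kappa>\<rceil>"
  have k: "\<kappa> \<le> real k" using \<kappa> by (simp add: k_def)
  define \<beta> where "\<beta> = (\<lambda>e::nat. 2 powr (real e - \<kappa>))"
  have \<beta>: "\<beta> e \<noteq> 1" for e using no by (auto simp: \<beta>_def)
  define B where "B = insert 1 (\<beta> ` {..d})"
  have B: "finite B" "\<And>b. b \<in> B \<Longrightarrow> 0 < b" by (auto simp: B_def \<beta>_def)
  define C' where "C' = C * (1 + (real k + 1) ^ k)"
  have C': "0 \<le> C'" using C by (simp add: C'_def)
  obtain K where K: "\<And>T F. F \<in> exp_sums B \<Longrightarrow>
           (\<forall>L \<le> 4 ^ card B * (T + 1). \<bar>F L\<bar> \<le> C' * (1 + real L) ^ 1) \<Longrightarrow> \<bar>F T\<bar> \<le> K"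
    using exp_sums_bounded[OF B C', of 1] by blast
  define c0 where "c0 = 2 powr (-\<kappa>) / 2"
  have c0: "c0 > 0" by (simp add: c0_def)
  obtain T :: nat where T: "real T > K / c0" using reals_Archimedean2 by blast
  define N where "N = 4 ^ card B * (T + 1)"
  define n where "n = Suc (max (8 * 2 ^ N) n0)"
  have n: "n \<ge> n0" "n > 0" "8 * 2 ^ N \<le> n" by (auto simp: n_def)
  obtain a where a: "\<And>h. (\<Sum>i<n. \<bar>h i\<bar> powr q) powr \<kappa> \<le> (\<Sum>is\<in>index_lists n d. a is * (\<Prod>i\<leftarrow>is. h i))"
     "\<And>h. (\<Sum>is\<in>index_lists n d. a is * (\<Prod>i\<leftarrow>is. h i)) \<le> C * (\<Sum>i<n. \<bar>h i\<bar> powr q) powr \<kappa>"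
    using H n(1) unfolding uniformly_comparable_def by blast
  define \<mu> where "\<mu> = (\<lambda>j::nat. 8 * 2 ^ j :: real)"
  define F where "F = (\<lambda>j. \<Sum>is\<in>index_lists n d. a is * (\<Prod>i\<in>set is.
              if even (count_list is i) then (\<Sum>v\<in>{1::real}. \<mu> j * v ^ count_list is i) / real n else 0))"
  define G where "G = (\<lambda>j. F j / \<mu> j powr \<kappa>)"
  have est: "c0 \<le> G j \<and> G j \<le> C'" if "j \<le> N" for j
  proof -
    have "\<mu> j \<le> 8 * 2 ^ N" using that by (simp add: \<mu>_def)
    also have "\<dots> \<le> real n" using n(3) by (metis of_nat_le_iff of_nat_mult of_nat_numeral of_nat_power)
    finally have "sum (\<lambda>_. \<mu> j) {1::real} \<le> real n" by simp
    moreover have "8 \<le> \<mu> j" by (simp add: \<mu>_def)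
    moreover have "\<mu> j = (\<Sum>v\<in>{1::real}. \<mu> j * v powr q)" by simp
    ultimately have "c0 * \<mu> j powr \<kappa> \<le> F j" "F j \<le> C' * \<mu> j powr \<kappa>"
      using symmetric_random_form_bounds[where V = "{1}" and w = "\<lambda>_. \<mu> j" and n = n and q = q and \<kappa> = \<kappa> and k = k
          and C = C and d = d and a = a and \<mu> = "\<mu> j" and F = "F j"] n(2) q \<kappa> k C a F_def[THEN fun_cong, of j]
      by (auto simp: c0_def C'_def)
    then show ?thesis using \<open>8 \<le> \<mu> j\<close> by (simp add: G_def field_simps)
  qed
  have G: "G j = (\<Sum>is\<in>index_lists n d. (a is * (\<Prod>i\<in>set is. if even (count_list is i) then 8 / real n else 0)
                  / 8 powr \<kappa>) * \<beta> (card (set is)) ^ j)" for j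
  proof -
    have "\<mu> j powr \<kappa> = 8 powr \<kappa> * (2 powr \<kappa>) ^ j"
      by (simp add: \<mu>_def powr_mult powr_powr flip: powr_realpow) (simp add: mult.commute)
    moreover have "(\<Prod>i\<in>set is. if even (count_list is i) then (\<Sum>v\<in>{1::real}. \<mu> j * v ^ count_list is i) / real n else 0)
       = (\<Prod>i\<in>set is. if even (count_list is i) then 8 / real n else 0) * (2 ^ card (set is)) ^ j" for "is" :: "nat list"
    proof -
      have "(\<Prod>i\<in>set is. if even (count_list is i) then (\<Sum>v\<in>{1::real}. \<mu> j * v ^ count_list is i) / real n else 0)
        = (\<Prod>i\<in>set is. (if even (count_list is i) then 8 / real n else 0) * 2 ^ j)"
        by (rule prod.cong) (auto simp: \<mu>_def)
      then show ?thesis by (simp add: prod.distrib power_mult[symmetric] mult.commute)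
    qed
    moreover have "\<beta> e ^ j = (2 ^ e) ^ j / (2 powr \<kappa>) ^ j" for e
      by (simp add: \<beta>_def powr_diff powr_realpow power_divide)
    ultimately show ?thesis
      by (simp add: G_def F_def sum_divide_distrib mult.assoc)
  qed
  \<comment> \<open>Since no base is 1, the partial sums are again exponential sums; they grow at
    least like c0 * L and at most linearly, so the coefficient-free bound K is violated at T. The
    \<open>+ 0\<close> matches the shift in \<open>exp_sums_geometric\<close>.\<close>
  define S where "S = (\<lambda>L. \<Sum>j<L + 0. G j)"
  have "S = (\<lambda>L. \<Sum>is\<in>index_lists n d. (a is * (\<Prod>i\<in>set is. if even (count_list is i) then 8 / real n else 0)
                  / 8 powr \<kappa>) * (\<Sum>j<L + 0. \<beta> (card (set is)) ^ j))"
    unfolding S_def G sum_distrib_left by (rule ext, rule sum.swap)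
  moreover have "\<dots> \<in> exp_sums B"
  proof (intro exp_sums_sum exp_sums_scale)
    fix "is" assume "is \<in> index_lists n d"
    then have "{1, \<beta> (card (set is))} \<subseteq> B" using card_set_index_lists by (auto simp: B_def)
    then show "(\<lambda>L. \<Sum>j<L + 0. \<beta> (card (set is)) ^ j) \<in> exp_sums B"
      using exp_sums_mono[OF B(1)] exp_sums_geometric[OF \<beta>] by blast
  qed
  ultimately have "S \<in> exp_sums B" by simp
  then have "\<bar>S T\<bar> \<le> K"
  proof (rule K, intro allI impI)
    fix L assume L: "L \<le> 4 ^ card B * (T + 1)"
    have "\<bar>S L\<bar> \<le> (\<Sum>j<L. \<bar>G j\<bar>)" by (simp add: S_def sum_abs)
    also have "\<dots> \<le> (\<Sum>j<L. C')"
    proof (rule sum_mono)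
      fix j assume "j \<in> {..<L}"
      then have "j \<le> N" using L unfolding N_def by simp
      then show "\<bar>G j\<bar> \<le> C'" using est[of j] c0 by linarith
    qed
    finally show "\<bar>S L\<bar> \<le> C' * (1 + real L) ^ 1" using C' by (simp add: algebra_simps)
  qed
  moreover have "c0 * real T \<le> S T"
  proof -
    have "(\<Sum>j<T. c0) \<le> (\<Sum>j<T. G j)"
    proof (rule sum_mono)
      fix j assume "j \<in> {..<T}"
      moreover have "T \<le> 4 ^ card B * T" by simp
      moreover have "N = 4 ^ card B * T + 4 ^ card B" by (simp add: N_def)
      ultimately have "j \<le> N" unfolding lessThan_iff by linarith
      then show "c0 \<le> G j" using est by blast
    qed
    then show ?thesis by (simp add: S_def mult.commute)
  qed
  ultimately show False using T c0 by (simp add: field_simps)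
qed

section \<open>The norm of X\<close>

lemma powr_le_imp_le:
  fixes a b r :: real
  assumes "a powr r \<le> b powr r" "0 \<le> b" "0 < r"
  shows "a \<le> b"
  using powr_less_mono2[of r b a] assms by linarith

lemma powr_convex_nonneg:
  fixes l s t r :: real
  assumes "1 \<le> r" "0 \<le> l" "l \<le> 1" "0 \<le> s" "0 \<le> t"
  shows "(l * s + (1 - l) * t) powr r \<le> l * s powr r + (1 - l) * t powr r"
proof -
  have scale: "(l * s) powr r \<le> l * s powr r" if "0 \<le> l" "l \<le> 1" "0 \<le> s" for l s :: real
  proof (cases "l = 0")
    case False
    then have "l powr r \<le> l powr 1" using that assms(1) by (intro powr_mono') auto
    then have "l powr r \<le> l" using that by simp
    then show ?thesis using that by (simp add: powr_mult mult_right_mono)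
  qed simp
  consider "s = 0" | "t = 0" | "s > 0" "t > 0" using assms by linarith
  then show ?thesis
  proof cases
    case 3
    have "convex_on {0<..} (\<lambda>x. x powr r)" by (rule powr_convex[OF assms(1)])
    from convex_onD[OF this, of l t s] 3 assms show ?thesis by (simp add: algebra_simps)
  qed (use scale[of "1 - l" t] scale[of l s] assms in auto)
qed

lemma minkowski_finite_sum:
  fixes u v :: "'a \<Rightarrow> real" and r :: real
  assumes "finite I" "1 \<le> r"
  shows "(\<Sum>i\<in>I. \<bar>u i + v i\<bar> powr r) powr (1 / r)
       \<le> (\<Sum>i\<in>I. \<bar>u i\<bar> powr r) powr (1 / r) + (\<Sum>i\<in>I. \<bar>v i\<bar> powr r) powr (1 / r)"
proof -
  define a where "a = (\<Sum>i\<in>I. \<bar>u i\<bar> powr r) powr (1 / r)"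
  define b where "b = (\<Sum>i\<in>I. \<bar>v i\<bar> powr r) powr (1 / r)"
  have r: "r > 0" using assms by simp
  have a0: "0 \<le> a" "0 \<le> b" by (simp_all add: a_def b_def)
  have ar: "a powr r = (\<Sum>i\<in>I. \<bar>u i\<bar> powr r)" "b powr r = (\<Sum>i\<in>I. \<bar>v i\<bar> powr r)"
    using r by (simp_all add: a_def b_def powr_powr sum_nonneg)
  consider "a = 0" | "b = 0" | "a > 0" "b > 0" using a0 by linarith
  then show ?thesis
  proof cases
    case 1
    then have "(\<Sum>i\<in>I. \<bar>u i\<bar> powr r) = 0" using ar(1) r by simp
    then have "\<forall>i\<in>I. u i = 0" using assms(1) by (simp add: sum_nonneg_eq_0_iff)
    then show ?thesis by simp
  next
    case 2
    then have "(\<Sum>i\<in>I. \<bar>v i\<bar> powr r) = 0" using ar(2) r by simp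
    then have "\<forall>i\<in>I. v i = 0" using assms(1) by (simp add: sum_nonneg_eq_0_iff)
    then show ?thesis by simp
  next
    case 3
    \<comment> \<open>With this weight, |u + v| / (a + b) is at most the convex combination of |u| /
      a and |v| / b, whose r-th powers each sum to 1.\<close>
    define l where "l = a / (a + b)"
    have l: "0 \<le> l" "l \<le> 1" "1 - l = b / (a + b)" using 3 by (auto simp: l_def field_simps)
    have "\<bar>u i + v i\<bar> powr r \<le> (a + b) powr r * (l * (\<bar>u i\<bar> / a) powr r + (1 - l) * (\<bar>v i\<bar> / b) powr r)" for i
    proof -
      have "\<bar>u i + v i\<bar> \<le> (a + b) * (l * (\<bar>u i\<bar> / a) + (1 - l) * (\<bar>v i\<bar> / b))"
        using 3 unfolding l(3) by (simp add: l_def distrib_left)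
      then have "\<bar>u i + v i\<bar> powr r \<le> ((a + b) * (l * (\<bar>u i\<bar> / a) + (1 - l) * (\<bar>v i\<bar> / b))) powr r"
        using r by (intro powr_mono2) auto
      also have "\<dots> = (a + b) powr r * (l * (\<bar>u i\<bar> / a) + (1 - l) * (\<bar>v i\<bar> / b)) powr r"
        using 3 l by (intro powr_mult) 
      also have "\<dots> \<le> (a + b) powr r * (l * (\<bar>u i\<bar> / a) powr r + (1 - l) * (\<bar>v i\<bar> / b) powr r)"
        using 3 l by (intro mult_left_mono powr_convex_nonneg assms) auto
      finally show ?thesis .
    qed
    then have "(\<Sum>i\<in>I. \<bar>u i + v i\<bar> powr r)
        \<le> (\<Sum>i\<in>I. (a + b) powr r * (l * (\<bar>u i\<bar> / a) powr r + (1 - l) * (\<bar>v i\<bar> / b) powr r))"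
      by (rule sum_mono)
    also have "\<dots> = (a + b) powr r * (l * ((\<Sum>i\<in>I. \<bar>u i\<bar> powr r) / a powr r) + (1 - l) * ((\<Sum>i\<in>I. \<bar>v i\<bar> powr r) / b powr r))"
      by (simp add: powr_divide sum.distrib sum_divide_distrib sum_distrib_left distrib_left)
    also have "\<dots> = (a + b) powr r" using 3 unfolding ar[symmetric] by simp
    finally have "(\<Sum>i\<in>I. \<bar>u i + v i\<bar> powr r) powr (1 / r) \<le> ((a + b) powr r) powr (1 / r)"
      using r by (intro powr_mono2) (auto intro!: sum_nonneg)
    also have "\<dots> = a + b" using 3 r by (simp add: powr_powr)
    finally show ?thesis by (simp add: a_def b_def)
  qed
qed

lemma blk_norm_nonneg: "0 \<le> blk_norm q n v"
  by (simp add: blk_norm_def)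

lemma blk_norm_cong: "(\<And>i. i < n \<Longrightarrow> u i = v i) \<Longrightarrow> blk_norm q n u = blk_norm q n v"
  by (simp add: blk_norm_def)

definition vsub :: "seqvec \<Rightarrow> seqvec \<Rightarrow> seqvec" where
  "vsub x y = vadd x (vscale (-1) y)"

lemma vsub_apply: "vsub x y n i = x n i - y n i"
  by (simp add: vsub_def vscale_def vadd_def)

definition emb :: "nat \<Rightarrow> (nat \<Rightarrow> real) \<Rightarrow> seqvec" where
  "emb n h = (\<lambda>m i. if m = n \<and> i < n then h i else 0)"

section \<open>X as a complete normed space\<close>

locale lp_lq =
  fixes p q :: real
  assumes p: "1 < p" and q: "1 < q"
begin

abbreviation "X \<equiv> X_space p q"
abbreviation "N \<equiv> X_norm p q"
abbreviation "\<beta> n x \<equiv> blk_norm q n (x n)"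

lemma blk_norm_powr: "blk_norm q n v powr q = (\<Sum>i<n. \<bar>v i\<bar> powr q)"
  using q by (simp add: blk_norm_def powr_powr sum_nonneg)

lemma blk_norm_scale: "blk_norm q n (\<lambda>i. c * v i) = \<bar>c\<bar> * blk_norm q n v"
proof -
  have "(\<Sum>i<n. \<bar>c * v i\<bar> powr q) = \<bar>c\<bar> powr q * (\<Sum>i<n. \<bar>v i\<bar> powr q)"
    by (simp add: abs_mult powr_mult sum_distrib_left)
  then show ?thesis
    using q by (simp add: blk_norm_def powr_mult powr_powr sum_nonneg)
qed

lemma blk_norm_triangle: "blk_norm q n (\<lambda>i. u i + v i) \<le> blk_norm q n u + blk_norm q n v"
  unfolding blk_norm_def using q by (intro minkowski_finite_sum) auto

lemma blk_norm_0 [simp]: "blk_norm q n (\<lambda>_. 0) = 0"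
  by (simp add: blk_norm_def)

lemma abs_le_blk_norm: "i < n \<Longrightarrow> \<bar>v i\<bar> \<le> blk_norm q n v"
proof -
  assume "i < n"
  then have "\<bar>v i\<bar> powr q \<le> (\<Sum>i<n. \<bar>v i\<bar> powr q)" by (intro member_le_sum) auto
  then have "\<bar>v i\<bar> powr q \<le> blk_norm q n v powr q" by (simp add: blk_norm_powr)
  then show ?thesis using q blk_norm_nonneg by (rule_tac powr_le_imp_le) auto
qed

lemma X_I:
  assumes "\<And>n i. n = 0 \<or> n \<le> i \<Longrightarrow> x n i = 0" "0 \<le> M" "\<And>m. (\<Sum>n<m. \<beta> n x powr p) \<le> M powr p"
  shows "x \<in> X" "N x \<le> M"
proof -
  have s: "summable (\<lambda>n. \<beta> n x powr p)"
    by (rule summableI_nonneg_bounded[of _ "M powr p"]) (use assms(3) in auto)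
  then show "x \<in> X" using assms(1) by (auto simp: X_space_def)
  have "(\<Sum>n. \<beta> n x powr p) \<le> M powr p" using assms(3) by (intro suminf_le_const s)
  then have "N x \<le> (M powr p) powr (1 / p)"
    unfolding X_norm_def using p s by (intro powr_mono2) (auto intro!: suminf_nonneg)
  also have "\<dots> = M" using assms(2) p by (simp add: powr_powr)
  finally show "N x \<le> M" .
qed

lemma X_zero: "x \<in> X \<Longrightarrow> n = 0 \<or> n \<le> i \<Longrightarrow> x n i = 0"
  by (auto simp: X_space_def)

lemma X_summable: "x \<in> X \<Longrightarrow> summable (\<lambda>n. \<beta> n x powr p)"
  by (auto simp: X_space_def)

lemma N_nonneg: "0 \<le> N x"
  by (simp add: X_norm_def)

lemma N_powr: "x \<in> X \<Longrightarrow> N x powr p = (\<Sum>n. \<beta> n x powr p)"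
  using p by (simp add: X_norm_def powr_powr suminf_nonneg X_summable)

lemma sum_le_N: "x \<in> X \<Longrightarrow> finite I \<Longrightarrow> (\<Sum>n\<in>I. \<beta> n x powr p) \<le> N x powr p"
  unfolding N_powr by (intro sum_le_suminf X_summable) auto

lemma blk_le_N: "x \<in> X \<Longrightarrow> \<beta> n x \<le> N x"
proof -
  assume "x \<in> X"
  then have "\<beta> n x powr p \<le> N x powr p" using sum_le_N[of x "{n}"] by simp
  then show ?thesis using p N_nonneg by (rule_tac powr_le_imp_le) auto
qed

lemma coord_le_N: "x \<in> X \<Longrightarrow> \<bar>x n i\<bar> \<le> N x"
  using abs_le_blk_norm[of i n "x n"] blk_le_N[of x n] X_zero[of x n i] N_nonneg[of x]
  by (cases "i < n") fastforce+

lemma X_vadd: "vadd x y \<in> X" and N_triangle: "N (vadd x y) \<le> N x + N y"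
  if "x \<in> X" "y \<in> X"
proof -
  have *: "(\<Sum>n<m. \<beta> n (vadd x y) powr p) \<le> (N x + N y) powr p" for m
  proof -
    have "(\<Sum>n<m. \<beta> n (vadd x y) powr p) \<le> (\<Sum>n<m. \<bar>\<beta> n x + \<beta> n y\<bar> powr p)"
      using p blk_norm_triangle[of _ "x _" "y _"]
      by (intro sum_mono powr_mono2) (auto simp: vadd_def blk_norm_nonneg intro: order_trans)
    also have "\<dots> = ((\<Sum>n<m. \<bar>\<beta> n x + \<beta> n y\<bar> powr p) powr (1 / p)) powr p"
      using p by (simp add: powr_powr sum_nonneg)
    also have "\<dots> \<le> ((\<Sum>n<m. \<bar>\<beta> n x\<bar> powr p) powr (1 / p) + (\<Sum>n<m. \<bar>\<beta> n y\<bar> powr p) powr (1 / p)) powr p"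
      using p by (intro powr_mono2 minkowski_finite_sum) auto
    also have "\<dots> \<le> ((N x powr p) powr (1 / p) + (N y powr p) powr (1 / p)) powr p"
      using p that sum_le_N by (intro powr_mono2 add_mono) (auto simp: blk_norm_nonneg intro!: sum_nonneg)
    also have "\<dots> = (N x + N y) powr p"
      using p by (simp add: powr_powr N_nonneg)
    finally show ?thesis .
  qed
  have z: "vadd x y n i = 0" if "n = 0 \<or> n \<le> i" for n i
    using X_zero[OF \<open>x \<in> X\<close> that] X_zero[OF \<open>y \<in> X\<close> that] by (simp add: vadd_def)
  show "vadd x y \<in> X" "N (vadd x y) \<le> N x + N y"
    using X_I[OF z _ *] N_nonneg by auto
qed

lemma X_vscale: "x \<in> X \<Longrightarrow> vscale c x \<in> X"
  and N_vscale: "x \<in> X \<Longrightarrow> N (vscale c x) = \<bar>c\<bar> * N x"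
proof -
  assume x: "x \<in> X"
  have b: "\<beta> n (vscale c x) powr p = \<bar>c\<bar> powr p * \<beta> n x powr p" for n
    using blk_norm_scale[of n c "x n"] by (simp add: vscale_def powr_mult blk_norm_nonneg)
  show s: "vscale c x \<in> X"
    using x unfolding X_space_def by (auto simp: b summable_mult) (auto simp: vscale_def)
  have "N (vscale c x) powr p = \<bar>c\<bar> powr p * N x powr p"
    unfolding N_powr[OF s] N_powr[OF x] b by (rule suminf_mult[OF X_summable[OF x]])
  then have "N (vscale c x) powr p = (\<bar>c\<bar> * N x) powr p" by (simp add: powr_mult N_nonneg)
  then show "N (vscale c x) = \<bar>c\<bar> * N x"
    using p N_nonneg[of x] N_nonneg[of "vscale c x"]
    by (intro antisym; rule_tac powr_le_imp_le[where r = p]) simp_all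
qed

lemma X_vsub: "x \<in> X \<Longrightarrow> y \<in> X \<Longrightarrow> vsub x y \<in> X"
  by (simp add: vsub_def X_vadd X_vscale)

lemma N_vsub_commute: "x \<in> X \<Longrightarrow> y \<in> X \<Longrightarrow> N (vsub x y) = N (vsub y x)"
proof -
  assume "x \<in> X" "y \<in> X"
  moreover have "vsub x y = vscale (-1) (vsub y x)"
    by (auto simp: fun_eq_iff vsub_apply vscale_def)
  ultimately show ?thesis by (simp add: N_vscale X_vsub)
qed

lemma N_vsub_triangle:
  assumes "x \<in> X" "y \<in> X" "z \<in> X"
  shows "N (vsub x z) \<le> N (vsub x y) + N (vsub y z)"
proof -
  have "vsub x z = vadd (vsub x y) (vsub y z)"
    by (auto simp: fun_eq_iff vsub_apply vadd_def)
  then show ?thesis using N_triangle X_vsub assms by simp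
qed

lemma vzero_X: "vzero \<in> X" and N_vzero: "N vzero = 0"
  using X_I[of vzero 0] N_nonneg[of vzero] p by (auto simp: vzero_def)

lemma N_vsub_self: "N (vsub x x) = 0"
proof -
  have "vsub x x = vzero" by (auto simp: fun_eq_iff vsub_apply vzero_def)
  then show ?thesis by (simp add: N_vzero)
qed

lemma N_diff_le: "x \<in> X \<Longrightarrow> y \<in> X \<Longrightarrow> \<bar>N x - N y\<bar> \<le> N (vsub x y)"
proof -
  assume *: "x \<in> X" "y \<in> X"
  have "x = vadd (vsub x y) y" "y = vadd (vsub y x) x"
    by (auto simp: fun_eq_iff vsub_apply vadd_def)
  then have "N x \<le> N (vsub x y) + N y" "N y \<le> N (vsub y x) + N x"
    using N_triangle X_vsub * by metis+
  then show ?thesis using N_vsub_commute[OF *] by linarith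
qed

text \<open>The limit is taken coordinatewise. A bound on N survives it because each finite partial
  sum involves finitely many coordinates; y is in X as the difference of \<open>x M\<close> and
  \<open>vsub (x M) y\<close>.\<close>

lemma complete:
  assumes x: "\<And>k. x k \<in> X" and cauchy: "\<And>e. 0 < e \<Longrightarrow> \<exists>M. \<forall>i\<ge>M. \<forall>j\<ge>M. N (vsub (x i) (x j)) \<le> e"
  shows "\<exists>y\<in>X. (\<lambda>k. N (vsub (x k) y)) \<longlonglongrightarrow> 0"
proof -
  have "Cauchy (\<lambda>k. x k n i)" for n i
  proof (rule CauchyI)
    fix e :: real assume "0 < e"
    then obtain M where "\<forall>i\<ge>M. \<forall>j\<ge>M. N (vsub (x i) (x j)) \<le> e / 2" using cauchy[of "e/2"] by auto
    moreover have "norm (x k n i - x j n i) \<le> N (vsub (x k) (x j))" for k j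
      using coord_le_N[OF X_vsub[OF x x], of k j n i] by (simp add: vsub_apply)
    ultimately have "\<forall>k\<ge>M. \<forall>j\<ge>M. norm (x k n i - x j n i) \<le> e / 2"
      using order_trans by blast
    moreover have "e / 2 < e" using \<open>0 < e\<close> by simp
    ultimately have "\<forall>k\<ge>M. \<forall>j\<ge>M. norm (x k n i - x j n i) < e"
      using le_less_trans by blast
    then show "\<exists>M. \<forall>k\<ge>M. \<forall>j\<ge>M. norm (x k n i - x j n i) < e" by blast
  qed
  then have "\<exists>l. (\<lambda>k. x k n i) \<longlonglongrightarrow> l" for n i
    using real_Cauchy_convergent convergent_def by blast
  then obtain y where y: "\<And>n i. (\<lambda>k. x k n i) \<longlonglongrightarrow> y n i" by metis
  have close: "vsub (x k) y \<in> X \<and> N (vsub (x k) y) \<le> e"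
    if "0 < e" "k \<ge> M" and M: "\<forall>i\<ge>M. \<forall>j\<ge>M. N (vsub (x i) (x j)) \<le> e" for e M k
  proof -
    have lim: "(\<lambda>j. \<Sum>n<m. \<beta> n (vsub (x k) (x j)) powr p) \<longlonglongrightarrow> (\<Sum>n<m. \<beta> n (vsub (x k) y) powr p)" for m
      unfolding blk_norm_def vsub_apply using p q
      by (intro tendsto_sum tendsto_powr' tendsto_rabs tendsto_diff y tendsto_const)
         (auto intro!: sum_nonneg always_eventually)
    have "(\<Sum>n<m. \<beta> n (vsub (x k) y) powr p) \<le> e powr p" for m
    proof (rule LIMSEQ_le_const2[OF lim], intro exI allI impI)
      fix j assume "j \<ge> M"
      then have "N (vsub (x k) (x j)) powr p \<le> e powr p"
        using M that p N_nonneg by (intro powr_mono2) auto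
      then show "(\<Sum>n<m. \<beta> n (vsub (x k) (x j)) powr p) \<le> e powr p"
        using sum_le_N[OF X_vsub[OF x x], of "{..<m}" k j] by simp
    qed
    moreover have "vsub (x k) y n i = 0" if "n = 0 \<or> n \<le> i" for n i
    proof -
      have eq: "(\<lambda>k. x k n i) = (\<lambda>k. 0)" using X_zero[OF x that] by auto
      have "y n i = 0" by (rule LIMSEQ_unique[OF y[of n i, unfolded eq] tendsto_const])
      then show ?thesis using X_zero[OF x that] by (simp add: vsub_apply)
    qed
    ultimately show ?thesis using X_I[of "vsub (x k) y" e] that(1) by auto
  qed
  obtain M where "\<forall>i\<ge>M. \<forall>j\<ge>M. N (vsub (x i) (x j)) \<le> 1" using cauchy[of 1] by auto
  then have "vsub (x M) y \<in> X" using close[of 1 M M] by auto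
  then have "vsub (x M) (vsub (x M) y) \<in> X" using X_vsub x by blast
  moreover have "vsub (x M) (vsub (x M) y) = y" by (auto simp: fun_eq_iff vsub_apply)
  ultimately have "y \<in> X" by simp
  moreover have "(\<lambda>k. N (vsub (x k) y)) \<longlonglongrightarrow> 0"
  proof (rule LIMSEQ_I)
    fix e :: real assume "0 < e"
    then obtain M where "\<forall>i\<ge>M. \<forall>j\<ge>M. N (vsub (x i) (x j)) \<le> e / 2" using cauchy[of "e/2"] by auto
    then have "norm (N (vsub (x k) y) - 0) < e" if "k \<ge> M" for k
      using close[of "e/2" M k] \<open>0 < e\<close> that N_nonneg[of "vsub (x k) y"] by simp
    then show "\<exists>M. \<forall>k\<ge>M. norm (N (vsub (x k) y) - 0) < e" by blast
  qed
  ultimately show ?thesis by blast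
qed

section \<open>Vectors supported in a single block\<close>

lemma emb_X: "emb n h \<in> X" and N_emb: "N (emb n h) = blk_norm q n h"
proof -
  have b: "\<beta> m (emb n h) = (if m = n then blk_norm q n h else 0)" for m
    by (auto simp: emb_def cong: blk_norm_cong intro: blk_norm_cong)
  have "(\<lambda>m. \<beta> m (emb n h) powr p) sums (\<Sum>m\<in>{n}. \<beta> m (emb n h) powr p)"
    by (rule sums_finite) (auto simp: b)
  then have s: "(\<lambda>m. \<beta> m (emb n h) powr p) sums (blk_norm q n h powr p)" by (simp add: b)
  then show X: "emb n h \<in> X" by (auto simp: X_space_def sums_iff) (auto simp: emb_def)
  show "N (emb n h) = blk_norm q n h"
    using s p blk_norm_nonneg by (simp add: X_norm_def sums_iff powr_powr)
qed

lemma N_add_emb: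
  assumes "z \<in> X"
  shows "N (vadd z (emb n h)) powr p = N z powr p - \<beta> n z powr p + blk_norm q n (\<lambda>i. z n i + h i) powr p"
proof -
  have b: "\<beta> m (vadd z (emb n h)) powr p = \<beta> m z powr p
      + (if m = n then blk_norm q n (\<lambda>i. z n i + h i) powr p - \<beta> n z powr p else 0)" for m
  proof -
    have "\<beta> m (vadd z (emb n h)) = (if m = n then blk_norm q n (\<lambda>i. z n i + h i) else \<beta> m z)"
      by (auto simp: emb_def vadd_def intro: blk_norm_cong)
    then show ?thesis by simp
  qed
  have "(\<lambda>m. \<beta> m z powr p) sums (N z powr p)"
    using X_summable[OF assms] N_powr[OF assms] by (simp add: summable_sums)
  moreover have "(\<lambda>m. if m = n then blk_norm q n (\<lambda>i. z n i + h i) powr p - \<beta> n z powr p else 0)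
     sums (blk_norm q n (\<lambda>i. z n i + h i) powr p - \<beta> n z powr p)"
    using sums_single[of n "\<lambda>m. blk_norm q n (\<lambda>i. z n i + h i) powr p - \<beta> n z powr p"] by simp
  ultimately have "(\<lambda>m. \<beta> m (vadd z (emb n h)) powr p) sums
      (N z powr p + (blk_norm q n (\<lambda>i. z n i + h i) powr p - \<beta> n z powr p))"
    unfolding b by (rule sums_add)
  then show ?thesis using N_powr[OF X_vadd[OF assms emb_X]] by (simp add: sums_iff)
qed

lemma blk_tendsto_0: "x \<in> X \<Longrightarrow> (\<lambda>n. \<beta> n x) \<longlonglongrightarrow> 0"
proof -
  assume "x \<in> X"
  then have "(\<lambda>n. \<beta> n x powr p) \<longlonglongrightarrow> 0" by (intro summable_LIMSEQ_zero X_summable)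
  then have "(\<lambda>n. (\<beta> n x powr p) powr (1/p)) \<longlonglongrightarrow> 0 powr (1/p)"
    using p by (intro tendsto_powr') auto
  then show ?thesis using p by (simp add: powr_powr blk_norm_nonneg)
qed

text \<open>If block n of z is small, adding a vector there acts almost like adding disjoint
  supports. The new block norm lies between t - \<delta> and t + \<delta>, so \<delta> depends on t
  and \<eta> only and not on z, n or h.\<close>

lemma N_add_emb_approx:
  assumes "0 < t" "0 < \<eta>"
  shows "\<exists>\<delta>>0. \<forall>z\<in>X. \<forall>n h. \<beta> n z \<le> \<delta> \<longrightarrow> blk_norm q n h = t \<longrightarrow>
           \<bar>N (vadd z (emb n h)) powr p - N z powr p - t powr p\<bar> \<le> \<eta>"
proof -
  have "((\<lambda>b. (t + b) powr p) \<longlongrightarrow> (t + 0) powr p) (at_right 0)"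
    "((\<lambda>b. (t - b) powr p - b powr p) \<longlongrightarrow> (t - 0) powr p - 0 powr p) (at_right 0)"
  proof -
    have lin: "((\<lambda>b. t + b) \<longlongrightarrow> t + 0) (at_right 0)" "((\<lambda>b. t - b) \<longlongrightarrow> t - 0) (at_right 0)"
      by (intro tendsto_intros)+
    have b: "((\<lambda>b. b powr p) \<longlongrightarrow> 0 powr p) (at_right 0)"
      using p eventually_at_right_less[of "0::real"]
      by (intro tendsto_powr') (auto elim: eventually_mono)
    show "((\<lambda>b. (t + b) powr p) \<longlongrightarrow> (t + 0) powr p) (at_right 0)"
      by (rule tendsto_powr[OF lin(1)]) (use assms in auto)
    show "((\<lambda>b. (t - b) powr p - b powr p) \<longlongrightarrow> (t - 0) powr p - 0 powr p) (at_right 0)"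
      by (intro tendsto_diff b tendsto_powr[OF lin(2)]) (use assms in auto)
  qed
  then have "\<forall>\<^sub>F b in at_right 0. (t + b) powr p < t powr p + \<eta> \<and> t powr p - \<eta> < (t - b) powr p - b powr p \<and> b < t"
    using assms p
    by (intro eventually_conj order_tendstoD(1)[where a = "t powr p - \<eta>"] order_tendstoD(2)[where a = "t powr p + \<eta>"])
       (auto simp: eventually_at_right_field intro!: exI[of _ t])
  then obtain \<delta>0 where \<delta>0: "\<delta>0 > 0" "\<And>b. 0 < b \<Longrightarrow> b < \<delta>0 \<Longrightarrow>
      (t + b) powr p < t powr p + \<eta> \<and> t powr p - \<eta> < (t - b) powr p - b powr p \<and> b < t"
    unfolding eventually_at_right_field by blast
  define \<delta> where "\<delta> = \<delta>0 / 2"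
  have \<delta>: "\<delta> > 0" "(t + \<delta>) powr p < t powr p + \<eta>" "t powr p - \<eta> < (t - \<delta>) powr p - \<delta> powr p" "\<delta> < t"
    using \<delta>0(1) \<delta>0(2)[of \<delta>] by (auto simp: \<delta>_def)
  show ?thesis
  proof (intro exI[of _ \<delta>] conjI ballI allI impI)
    fix z n h assume z: "z \<in> X" and b: "\<beta> n z \<le> \<delta>" and h: "blk_norm q n h = t"
    have up: "blk_norm q n (\<lambda>i. z n i + h i) \<le> t + \<delta>"
      using blk_norm_triangle[of n "z n" h] b h by simp
    have "blk_norm q n (\<lambda>i. - z n i) = \<beta> n z" using blk_norm_scale[of n "-1" "z n"] by simp
    then have lo: "t - \<delta> \<le> blk_norm q n (\<lambda>i. z n i + h i)"
      using blk_norm_triangle[of n "\<lambda>i. z n i + h i" "\<lambda>i. - z n i"] b h by simp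
    have "blk_norm q n (\<lambda>i. z n i + h i) powr p \<le> (t + \<delta>) powr p"
      using up p blk_norm_nonneg by (intro powr_mono2) auto
    moreover have "(t - \<delta>) powr p \<le> blk_norm q n (\<lambda>i. z n i + h i) powr p"
      using lo p \<delta> by (intro powr_mono2) auto
    moreover have "\<beta> n z powr p \<le> \<delta> powr p"
      using b p blk_norm_nonneg by (intro powr_mono2) auto
    ultimately show "\<bar>N (vadd z (emb n h)) powr p - N z powr p - t powr p\<bar> \<le> \<eta>"
      using \<delta> N_add_emb[OF z, of n h] powr_ge_zero[of "\<beta> n z" p] by linarith
  qed (rule \<delta>)
qed

end

section \<open>A greedy variational principle\<close>

text \<open>Each new term almost minimises F among the points not excluded by the earlier terms.\<close>

lemma greedy_sequence:
  fixes F :: "'a \<Rightarrow> real" and \<rho> :: "'a \<Rightarrow> 'a \<Rightarrow> real"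
  assumes x0: "x0 \<in> B" and bdd: "\<And>x. x \<in> B \<Longrightarrow> l \<le> F x"
    and \<rho>: "\<And>x. \<rho> x x = 0" "\<And>x y. 0 \<le> \<rho> x y"
  shows "\<exists>x. x 0 = x0 \<and> (\<forall>k. x k \<in> B) \<and> (\<forall>k. \<forall>j<k. F (x k) + \<rho> (x k) (x j) \<le> F (x j)) \<and>
     (\<forall>k>0. \<forall>z\<in>B. (\<forall>j\<le>k. F z + \<rho> z (x j) \<le> F (x j)) \<longrightarrow> \<rho> z (x k) \<le> (1/2) ^ k)"
proof -
  \<comment> \<open>A state (x, S) holds the current point and the points not excluded before it. As
    \<open>\<rho> x x = 0\<close>, x survives its own cut, so the next infimum runs over a nonempty
    set.\<close>
  define nxt where "nxt = (\<lambda>S x. S \<inter> {z. F z + \<rho> z x \<le> F x})"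
  define P where "P = (\<lambda>(k::nat) (x, S). x \<in> S \<and> S \<subseteq> B \<and> (k = 0 \<longrightarrow> x = x0 \<and> S = B))"
  define Q where "Q = (\<lambda>(k::nat) (x, S) (x', S'). S' = nxt S x \<and> (\<forall>z\<in>S'. F x' \<le> F z + (1/2) ^ Suc k))"
  have "\<exists>f. \<forall>n. P n (f n) \<and> Q n (f n) (f (Suc n))"
  proof (rule dependent_nat_choice)
    show "\<exists>x. P 0 x" using x0 by (auto simp: P_def)
  next
    fix xS :: "'a \<times> 'a set" and k assume "P k xS"
    obtain x S where xS: "xS = (x, S)" by force
    then have x: "x \<in> S" "S \<subseteq> B" using \<open>P k xS\<close> by (auto simp: P_def)
    define S' where "S' = nxt S x"
    have ne: "F ` S' \<noteq> {}" using x \<rho>(1)[of x] by (auto simp: S'_def nxt_def)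
    have bb: "bdd_below (F ` S')" using bdd x by (intro bdd_belowI[of _ l]) (auto simp: S'_def nxt_def)
    have "Inf (F ` S') < Inf (F ` S') + (1/2) ^ Suc k" by simp
    then have "\<exists>y\<in>F ` S'. y < Inf (F ` S') + (1/2) ^ Suc k"
      by (simp only: cInf_less_iff[OF ne bb])
    then obtain x' where x': "x' \<in> S'" "F x' < Inf (F ` S') + (1/2) ^ Suc k"
      by blast
    have "F x' \<le> F z + (1/2) ^ Suc k" if "z \<in> S'" for z
      using cInf_lower[OF _ bb, of "F z"] that x'(2) by fastforce
    then have "P (Suc k) (x', S') \<and> Q k xS (x', S')"
      using x' x by (auto simp: P_def Q_def xS S'_def nxt_def)
    then show "\<exists>y. P (Suc k) y \<and> Q k xS y" by blast
  qed
  then obtain f where f: "\<And>n. P n (f n)" "\<And>n. Q n (f n) (f (Suc n))" by blast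
  define x where "x = (\<lambda>n. fst (f n))"
  define S where "S = (\<lambda>n. snd (f n))"
  have xS: "x n \<in> S n" "S n \<subseteq> B" "x 0 = x0" "S 0 = B" for n
    using f(1)[of n] f(1)[of 0] by (auto simp: P_def x_def S_def split: prod.splits)
  have S_Suc: "S (Suc n) = S n \<inter> {z. F z + \<rho> z (x n) \<le> F (x n)}" for n
    using f(2)[of n] by (auto simp: Q_def x_def S_def nxt_def split: prod.splits)
  have min: "F (x (Suc n)) \<le> F z + (1/2) ^ Suc n" if "z \<in> S (Suc n)" for n z
    using f(2)[of n] that by (auto simp: Q_def x_def S_def split: prod.splits)
  have S_eq: "S n = {z\<in>B. \<forall>j<n. F z + \<rho> z (x j) \<le> F (x j)}" for n
    by (induction n) (auto simp: xS S_Suc less_Suc_eq)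
  show ?thesis
  proof (intro exI[of _ x] conjI allI impI ballI)
    fix k z assume k: "0 < k" and z: "z \<in> B" "\<forall>j\<le>k. F z + \<rho> z (x j) \<le> F (x j)"
    obtain k' where k': "k = Suc k'" using k by (cases k) auto
    have "z \<in> S (Suc k')" using z k' by (auto simp: S_eq)
    \<comment> \<open>\<open>x k\<close> is within 2^(-k) of the infimum over a set containing z, so
      a point z that also passes the cut at \<open>x k\<close> can pay only a penalty of that
      size.\<close>
    then have "F (x k) \<le> F z + (1/2) ^ k" using min k' by blast
    moreover have "F z + \<rho> z (x k) \<le> F (x k)" using z by blast
    ultimately show "\<rho> z (x k) \<le> (1/2) ^ k" by linarith
  next
    fix k j assume "j < (k::nat)"
    then show "F (x k) + \<rho> (x k) (x j) \<le> F (x j)" using xS(1)[of k] by (auto simp: S_eq)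
  next
    fix k show "x k \<in> B" using xS(1,2) by blast
  qed (rule xS(3))
qed

context lp_lq
begin

text \<open>If a block vector h of norm t decreased F by 2 * \<epsilon> * t powr p at the limit y, then y + h, whose distance to each
  x j satisfies N (y + h - x j)^p \<le> N (y - x j)^p + 2 * t^p, would also survive all the exclusions.\<close>

lemma block_minimum:
  assumes cont: "\<And>x y. (\<And>k. x k \<in> X) \<Longrightarrow> y \<in> X \<Longrightarrow> (\<lambda>k. N (vsub (x k) y)) \<longlonglongrightarrow> 0 \<Longrightarrow> (\<lambda>k. F (x k)) \<longlonglongrightarrow> F y"
    and x0: "x0 \<in> X" "N x0 \<le> R" and bdd: "\<And>x. x \<in> X \<Longrightarrow> N x \<le> R \<Longrightarrow> l \<le> F x" and \<epsilon>: "0 < \<epsilon>"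
  shows "\<exists>y\<in>X. N y \<le> R \<and> F y \<le> F x0 \<and> (\<forall>t>0. \<exists>n0. \<forall>n\<ge>n0. \<forall>h. blk_norm q n h = t \<longrightarrow>
           N (vadd y (emb n h)) \<le> R \<longrightarrow> F y - 2 * \<epsilon> * t powr p < F (vadd y (emb n h)))"
proof -
  define B where "B = {x\<in>X. N x \<le> R}"
  define \<rho> where "\<rho> = (\<lambda>x y. \<epsilon> * N (vsub x y) powr p)"
  have \<rho>: "\<rho> x x = 0" "0 \<le> \<rho> x y" for x y
    using \<epsilon> by (simp_all add: \<rho>_def N_vsub_self)
  have lB: "l \<le> F x" if "x \<in> B" for x using bdd that by (auto simp: B_def)
  have x0B: "x0 \<in> B" using x0 by (simp add: B_def)
  have "\<exists>x. x 0 = x0 \<and> (\<forall>k. x k \<in> B) \<and> (\<forall>k. \<forall>j<k. F (x k) + \<rho> (x k) (x j) \<le> F (x j)) \<and>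
     (\<forall>k>0. \<forall>z\<in>B. (\<forall>j\<le>k. F z + \<rho> z (x j) \<le> F (x j)) \<longrightarrow> \<rho> z (x k) \<le> (1/2) ^ k)"
    by (rule greedy_sequence[OF x0B _ \<rho>]) (rule lB)
  then obtain x where xs: "x 0 = x0" "\<forall>k. x k \<in> B"
    "\<forall>k. \<forall>j<k. F (x k) + \<rho> (x k) (x j) \<le> F (x j)"
    "\<forall>k>0. \<forall>z\<in>B. (\<forall>j\<le>k. F z + \<rho> z (x j) \<le> F (x j)) \<longrightarrow> \<rho> z (x k) \<le> (1/2) ^ k"
    by (elim exE conjE) (rule that; assumption)
  have x: "x 0 = x0" "\<And>k. x k \<in> B" "\<And>k j. j < k \<Longrightarrow> F (x k) + \<rho> (x k) (x j) \<le> F (x j)"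
    using xs(1-3) by auto
  have x4: "\<rho> z (x k) \<le> (1/2) ^ k" if "0 < k" "z \<in> B" "\<forall>j\<le>k. F z + \<rho> z (x j) \<le> F (x j)" for k z
    using xs(4) that by blast
  have xX: "x k \<in> X" "N (x k) \<le> R" for k using x(2) by (auto simp: B_def)
  have shrink: "N (vsub z (x k)) \<le> ((1/2) ^ k / \<epsilon>) powr (1 / p)"
    if "0 < k" "z \<in> B" "\<forall>j\<le>k. F z + \<rho> z (x j) \<le> F (x j)" for k z
  proof -
    have "N (vsub z (x k)) powr p \<le> (1/2) ^ k / \<epsilon>"
      using x4[OF that] \<epsilon> by (simp add: \<rho>_def field_simps)
    then have "(N (vsub z (x k)) powr p) powr (1 / p) \<le> ((1/2) ^ k / \<epsilon>) powr (1 / p)"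
      using p by (intro powr_mono2) auto
    then show ?thesis using p by (simp add: powr_powr N_nonneg)
  qed
  have rad: "(\<lambda>k::nat. ((1/2) ^ k / \<epsilon>) powr (1 / p)) \<longlonglongrightarrow> 0"
  proof -
    have "(\<lambda>k::nat. (1/2) ^ k / \<epsilon>) \<longlonglongrightarrow> 0 / \<epsilon>" using \<epsilon> by (intro tendsto_intros) (auto intro!: LIMSEQ_power_zero)
    then have "(\<lambda>k::nat. ((1/2) ^ k / \<epsilon>) powr (1 / p)) \<longlonglongrightarrow> (0 / \<epsilon>) powr (1 / p)"
      using \<epsilon> p by (intro tendsto_powr') auto
    then show ?thesis by simp
  qed
  have tail: "N (vsub (x m) (x k)) \<le> ((1/2) ^ k / \<epsilon>) powr (1 / p)" if "0 < k" "k \<le> m" for k m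
  proof (cases "k = m")
    case True
    then show ?thesis by (simp add: N_vsub_self)
  next
    case False
    then show ?thesis using x(2,3) that by (intro shrink) auto
  qed
  have cauchy: "\<exists>M. \<forall>i\<ge>M. \<forall>j\<ge>M. N (vsub (x i) (x j)) \<le> e" if "0 < e" for e
  proof -
    have "\<forall>\<^sub>F k in sequentially. ((1/2) ^ k / \<epsilon>) powr (1 / p) < e / 2"
      using rad that by (intro order_tendstoD) auto
    then obtain M where M: "\<And>k. k \<ge> M \<Longrightarrow> ((1/2) ^ k / \<epsilon>) powr (1 / p) < e / 2"
      by (auto simp: eventually_sequentially)
    have "N (vsub (x i) (x j)) \<le> e" if "i \<ge> Suc M" "j \<ge> Suc M" for i j
    proof -
      have "N (vsub (x i) (x j)) \<le> N (vsub (x i) (x (Suc M))) + N (vsub (x (Suc M)) (x j))"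
        by (intro N_vsub_triangle xX)
      also have "N (vsub (x (Suc M)) (x j)) = N (vsub (x j) (x (Suc M)))" by (intro N_vsub_commute xX)
      finally show ?thesis using tail[of "Suc M" i] tail[of "Suc M" j] M[of "Suc M"] that by linarith
    qed
    then show ?thesis by blast
  qed
  have "\<exists>y\<in>X. (\<lambda>k. N (vsub (x k) y)) \<longlonglongrightarrow> 0"
    by (rule complete[OF xX(1)]) (rule cauchy)
  then obtain y where y: "y \<in> X" "(\<lambda>k. N (vsub (x k) y)) \<longlonglongrightarrow> 0" by blast
  have lim: "(\<lambda>k. N (vsub (x k) z)) \<longlonglongrightarrow> N (vsub y z)" if "z \<in> X" for z
  proof (rule Lim_transform2)
    show "(\<lambda>k. N (vsub y z)) \<longlonglongrightarrow> N (vsub y z)" by simp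
    have "vsub (vsub y z) (vsub (x k) z) = vsub y (x k)" for k
      by (auto simp: fun_eq_iff vsub_apply)
    then have "\<bar>N (vsub y z) - N (vsub (x k) z)\<bar> \<le> N (vsub (x k) y)" for k
      using N_diff_le[of "vsub y z" "vsub (x k) z"] N_vsub_commute[OF y(1) xX(1), of k] X_vsub[OF y(1) that] X_vsub[OF xX(1)[of k] that] by simp
    then show "(\<lambda>k. N (vsub y z) - N (vsub (x k) z)) \<longlonglongrightarrow> 0"
      by (intro Lim_null_comparison[OF _ y(2)]) auto
  qed
  have zero: "vsub z vzero = z" for z by (auto simp: fun_eq_iff vsub_apply vzero_def)
  have "N y \<le> R" using lim[OF vzero_X] xX(2) unfolding zero by (intro LIMSEQ_le_const2) auto
  \<comment> \<open>Each cut is a closed condition, F and N being continuous, so the limit y passes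
    all of them.\<close>
  have yj: "F y + \<rho> y (x j) \<le> F (x j)" for j
  proof (rule LIMSEQ_le_const2)
    show "(\<lambda>k. F (x k) + \<rho> (x k) (x j)) \<longlonglongrightarrow> F y + \<rho> y (x j)"
      unfolding \<rho>_def using p
      by (intro tendsto_add cont xX y tendsto_mult tendsto_const tendsto_powr' lim) (auto simp: N_nonneg)
    show "\<exists>M. \<forall>k\<ge>M. F (x k) + \<rho> (x k) (x j) \<le> F (x j)"
      using x(3) by (intro exI[of _ "Suc j"]) auto
  qed
  show ?thesis
  proof (intro bexI[OF _ y(1)] conjI allI impI)
    show "N y \<le> R" by fact
    show "F y \<le> F x0" using yj[of 0] \<rho>(2)[of y "x 0"] x(1) by simp
    fix t :: real assume t: "0 < t"
    obtain \<delta> where \<delta>: "\<delta> > 0" "\<And>z n h. z \<in> X \<Longrightarrow> \<beta> n z \<le> \<delta> \<Longrightarrow> blk_norm q n h = t \<Longrightarrow>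
           \<bar>N (vadd z (emb n h)) powr p - N z powr p - t powr p\<bar> \<le> t powr p"
      using N_add_emb_approx[OF t, of "t powr p"] t by auto
    \<comment> \<open>For j \<ge> J the whole of y - x j is below \<delta>; for the finitely many
      other j its n-th block tends to 0. Thus one n0 serves all j.\<close>
    obtain J where J: "\<And>j. j \<ge> J \<Longrightarrow> N (vsub (x j) y) < \<delta>"
      using order_tendstoD(2)[OF y(2) \<delta>(1)] by (auto simp: eventually_sequentially)
    have "\<forall>\<^sub>F n in sequentially. \<forall>j\<in>{..<J}. \<beta> n (vsub y (x j)) < \<delta>"
      using order_tendstoD(2)[OF blk_tendsto_0 \<delta>(1)] X_vsub xX y by (intro eventually_ball_finite) auto
    then obtain n0 where n0: "\<And>n j. n \<ge> n0 \<Longrightarrow> j < J \<Longrightarrow> \<beta> n (vsub y (x j)) < \<delta>"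
      by (auto simp: eventually_sequentially)
    have small: "\<beta> n (vsub y (x j)) \<le> \<delta>" if "n \<ge> n0" for n j
      using n0[OF that, of j] J[of j] blk_le_N[OF X_vsub[OF y(1) xX(1)], of n j] N_vsub_commute[OF y(1) xX(1), of j]
      by (cases "j < J") auto
    show "\<exists>n0. \<forall>n\<ge>n0. \<forall>h. blk_norm q n h = t \<longrightarrow>
           N (vadd y (emb n h)) \<le> R \<longrightarrow> F y - 2 * \<epsilon> * t powr p < F (vadd y (emb n h))"
    proof (intro exI[of _ n0] allI impI)
      fix n h assume n: "n \<ge> n0" and h: "blk_norm q n h = t" and R: "N (vadd y (emb n h)) \<le> R"
      define z where "z = vadd y (emb n h)"
      have zX: "z \<in> X" using y emb_X X_vadd by (simp add: z_def)
      then have zB: "z \<in> B" using R by (simp add: B_def z_def)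
      show "F y - 2 * \<epsilon> * t powr p < F (vadd y (emb n h))"
      proof (rule ccontr)
        assume "\<not> ?thesis"
        then have le: "F z \<le> F y - 2 * \<epsilon> * t powr p" by (simp add: z_def)
        have zj: "F z + \<rho> z (x j) \<le> F (x j)" for j
        proof -
          have "vsub z (x j) = vadd (vsub y (x j)) (emb n h)"
            by (auto simp: z_def fun_eq_iff vsub_apply vadd_def)
          then have "N (vsub z (x j)) powr p \<le> N (vsub y (x j)) powr p + 2 * t powr p"
            using \<delta>(2)[OF X_vsub[OF y(1) xX(1)] small[OF n] h, of j] by (simp add: abs_le_iff)
          then have "\<rho> z (x j) \<le> \<epsilon> * (N (vsub y (x j)) powr p + 2 * t powr p)"
            using \<epsilon> unfolding \<rho>_def by (intro mult_left_mono) auto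
          then have "\<rho> z (x j) \<le> \<rho> y (x j) + 2 * \<epsilon> * t powr p" by (simp add: \<rho>_def algebra_simps)
          then show ?thesis using le yj[of j] by linarith
        qed
        \<comment> \<open>Passing every cut forces z to be the limit of \<open>x k\<close> too,
          although z and y are at distance t > 0.\<close>
        have "(\<lambda>k. N (vsub z (x k))) \<longlonglongrightarrow> 0"
        proof (rule Lim_null_comparison[OF _ rad])
          show "\<forall>\<^sub>F k in sequentially. norm (N (vsub z (x k))) \<le> ((1/2) ^ k / \<epsilon>) powr (1 / p)"
            using shrink[OF _ zB] zj by (intro eventually_sequentiallyI[of 1]) (auto simp: N_nonneg)
        qed
        moreover have "(\<lambda>k. N (vsub (x k) z)) \<longlonglongrightarrow> N (vsub y z)" by (rule lim[OF zX])
        then have "(\<lambda>k. N (vsub z (x k))) \<longlonglongrightarrow> N (vsub y z)"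
          by (simp add: N_vsub_commute[OF zX xX(1)])
        ultimately have "N (vsub y z) = 0" using LIMSEQ_unique by blast
        moreover have "vsub z y = emb n h" by (auto simp: z_def fun_eq_iff vsub_apply vadd_def)
        ultimately show False using t h N_vsub_commute[OF y(1) zX] by (simp add: N_emb)
      qed
    qed
  qed
qed

end

section \<open>Multilinear forms\<close>

text \<open>The coefficient of \<open>A (map u is)\<close> in the expansion of A at linear
  combinations of u with coefficient functions cs.\<close>

definition weight_prod :: "(nat \<Rightarrow> real) list \<Rightarrow> nat list \<Rightarrow> real" where
  "weight_prod cs is = (\<Prod>(c, i)\<leftarrow>zip cs is. c i)"

lemma weight_prod_simps [simp]:
  "weight_prod [] [] = 1" "weight_prod (c # cs) (i # is) = c i * weight_prod cs is"
  by (simp_all add: weight_prod_def)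

lemma weight_prod_replicate: "weight_prod (replicate (length is) h) is = (\<Prod>i\<leftarrow>is. h i)"
  by (induction "is") auto

definition comb :: "nat \<Rightarrow> (nat \<Rightarrow> seqvec) \<Rightarrow> (nat \<Rightarrow> real) \<Rightarrow> seqvec" where
  "comb m u c = (\<lambda>n i. \<Sum>j<m. c j * u j n i)"

lemma comb_0: "comb 0 u c = vzero"
  by (simp add: comb_def vzero_def)

lemma comb_Suc: "comb (Suc m) u c = vadd (comb m u c) (vscale (c m) (u m))"
  by (simp add: comb_def vadd_def vscale_def)

definition signs :: "(nat \<Rightarrow> real) \<Rightarrow> bool" where
  "signs c \<longleftrightarrow> (\<forall>i. c i \<in> {1, -1})"

lemma average_signs:
  "expect m {1, -1} (\<lambda>_. 1/2) (\<lambda>\<sigma>. \<sigma> i * \<sigma> j) = (if i = j then 1 else 0)" if "i < m" "j < m"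
  using expect_prod_list[of "{1, -1}" "\<lambda>_. 1/2" "[i, j]" m "\<lambda>x. x"] that by auto

text \<open>Averaging over the sign of the second argument relative to the first identifies the first two indices.\<close>

lemma diagonal_sum_le:
  fixes T :: "nat list \<Rightarrow> real"
  assumes "\<And>cs. length cs = Suc k \<Longrightarrow> (\<forall>c\<in>set cs. signs c) \<Longrightarrow>
             \<bar>\<Sum>is\<in>index_lists m (Suc k). weight_prod cs is * T is\<bar> \<le> M"
    and "signs \<tau>"
  shows "\<bar>\<Sum>i<m. \<tau> i * T (replicate (Suc k) i)\<bar> \<le> M"
  using assms(1)
proof (induction k arbitrary: T)
  case 0
  show ?case using 0[of "[\<tau>]"] assms(2) by (simp add: sum_index_lists_Suc)
next
  case (Suc k)
  \<comment> \<open>T' has one index fewer because the first is repeated, and its diagonal agrees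
    with that of T.\<close>
  define T' where "T' = (\<lambda>is. T (hd is # is))"
  have "\<bar>\<Sum>is\<in>index_lists m (Suc k). weight_prod cs is * T' is\<bar> \<le> M"
    if cs: "length cs = Suc k" "\<forall>c\<in>set cs. signs c" for cs
  proof -
    obtain c cs' where c: "cs = c # cs'" using cs by (cases cs) auto
    \<comment> \<open>Signs \<sigma> go into the first slot and \<sigma> * c into the second.
      Averaging \<open>\<sigma> i * \<sigma> j\<close> keeps only i = j, while each single value of
      G is a signed sum that the hypothesis bounds by M.\<close>
    define G where "G = (\<lambda>\<sigma>::nat \<Rightarrow> real. \<Sum>i<m. \<Sum>j<m. \<Sum>is\<in>index_lists m k.
        (c j * weight_prod cs' is * T (i # j # is)) * (\<sigma> i * \<sigma> j))"
    have "expect m {1, -1} (\<lambda>_. 1/2) G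
        = (\<Sum>i<m. \<Sum>j<m. \<Sum>is\<in>index_lists m k. (c j * weight_prod cs' is * T (i # j # is)) * (if i = j then 1 else 0))"
      unfolding G_def expect_sum expect_scale by (intro sum.cong refl) (simp add: average_signs)
    also have "\<dots> = (\<Sum>i<m. \<Sum>is\<in>index_lists m k. c i * weight_prod cs' is * T (i # i # is))"
    proof (rule sum.cong[OF refl])
      fix i assume i: "i \<in> {..<m}"
      have "(\<Sum>j<m. \<Sum>is\<in>index_lists m k. (c j * weight_prod cs' is * T (i # j # is)) * (if i = j then 1 else 0))
          = (\<Sum>j<m. if i = j then \<Sum>is\<in>index_lists m k. c j * weight_prod cs' is * T (i # j # is) else 0)"
        by (intro sum.cong) auto
      then show "(\<Sum>j<m. \<Sum>is\<in>index_lists m k. (c j * weight_prod cs' is * T (i # j # is)) * (if i = j then 1 else 0))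
          = (\<Sum>is\<in>index_lists m k. c i * weight_prod cs' is * T (i # i # is))"
        using i by simp
    qed
    also have "\<dots> = (\<Sum>is\<in>index_lists m (Suc k). weight_prod cs is * T' is)"
      by (simp add: sum_index_lists_Suc c T'_def)
    finally have E: "(\<Sum>is\<in>index_lists m (Suc k). weight_prod cs is * T' is) = expect m {1, -1} (\<lambda>_. 1/2) G" ..
    have G: "\<bar>G \<sigma>\<bar> \<le> M" if \<sigma>: "\<sigma> \<in> {..<m} \<rightarrow>\<^sub>E {1, -1}" for \<sigma>
    proof -
      \<comment> \<open>Functions in the extensional product are \<open>undefined\<close> from m on,
        whereas \<open>signs\<close> speaks of all indices.\<close>
      define \<sigma>' where "\<sigma>' = (\<lambda>i. if i < m then \<sigma> i else 1)"
      have s: "\<sigma>' i \<in> {1, -1}" for i using \<sigma> by (auto simp: \<sigma>'_def PiE_iff)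
      have "\<forall>c\<in>set (\<sigma>' # (\<lambda>j. \<sigma>' j * c j) # cs'). signs c"
      proof -
        have "signs \<sigma>'" using s by (simp only: signs_def) blast
        moreover have "signs (\<lambda>j. \<sigma>' j * c j)"
          unfolding signs_def
        proof
          fix j
          have "c j \<in> {1, -1}" using cs(2) c by (simp add: signs_def)
          then show "\<sigma>' j * c j \<in> {1, -1}" using s[of j] by (elim insertE emptyE) simp_all
        qed
        ultimately show ?thesis using cs(2) c by simp
      qed
      then have "\<bar>\<Sum>is\<in>index_lists m (Suc (Suc k)). weight_prod (\<sigma>' # (\<lambda>j. \<sigma>' j * c j) # cs') is * T is\<bar> \<le> M"
        using cs c by (intro Suc.prems) auto
      moreover have "(\<Sum>is\<in>index_lists m (Suc (Suc k)). weight_prod (\<sigma>' # (\<lambda>j. \<sigma>' j * c j) # cs') is * T is) = G \<sigma>"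
        unfolding G_def sum_index_lists_Suc by (intro sum.cong refl) (simp add: \<sigma>'_def mult_ac)
      ultimately show ?thesis by simp
    qed
    have "expect m {1, -1} (\<lambda>_. 1/2) G \<le> expect m {1, -1} (\<lambda>_. 1/2) (\<lambda>_. M)"
      using G by (intro expect_mono) (auto simp: abs_le_iff)
    moreover have "expect m {1, -1} (\<lambda>_. 1/2) (\<lambda>_. - M) \<le> expect m {1, -1} (\<lambda>_. 1/2) G"
    proof (rule expect_mono)
      fix h :: "nat \<Rightarrow> real" assume "h \<in> {..<m} \<rightarrow>\<^sub>E {1, -1}"
      then show "- M \<le> G h" using G[of h] by linarith
    qed auto
    ultimately show ?thesis unfolding E by (simp add: expect_const abs_le_iff)
  qed
  from Suc.IH[OF this] show ?case by (simp add: T'_def)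
qed

section \<open>Bounded multilinear forms on X\<close>

context lp_lq
begin

lemma multilinear_bound:
  assumes "bounded_multilinear_X p q k A"
  obtains C where "0 \<le> C" "\<And>xs. length xs = k \<Longrightarrow> set xs \<subseteq> X \<Longrightarrow> \<bar>A xs\<bar> \<le> C * prod_list (map N xs)"
proof -
  obtain C where C: "\<And>xs. length xs = k \<Longrightarrow> set xs \<subseteq> X \<Longrightarrow> \<bar>A xs\<bar> \<le> C * prod_list (map N xs)"
    using assms unfolding bounded_multilinear_X_def by blast
  show ?thesis
  proof (rule that[of "\<bar>C\<bar>"])
    fix xs assume "length xs = k" "set xs \<subseteq> X"
    then have "\<bar>A xs\<bar> \<le> C * prod_list (map N xs)" by (rule C)
    also have "\<dots> \<le> \<bar>C\<bar> * prod_list (map N xs)"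
      by (intro mult_right_mono prod_list_nonneg) (auto simp: N_nonneg)
    finally show "\<bar>A xs\<bar> \<le> \<bar>C\<bar> * prod_list (map N xs)" .
  qed simp
qed

lemma multilinear_Cons_linear:
  assumes "bounded_multilinear_X p q (Suc k) A" "x \<in> X" "y \<in> X" "length xs = k" "set xs \<subseteq> X"
  shows "A (vadd x (vscale c y) # xs) = A (x # xs) + c * A (y # xs)"
proof -
  have "A ((x # xs)[0 := vadd ((x # xs) ! 0) (vscale c y)]) = A (x # xs) + c * A ((x # xs)[0 := y])"
    using assms unfolding bounded_multilinear_X_def by (metis insert_subset length_Cons list.simps(15) zero_less_Suc)
  then show ?thesis by simp
qed

lemma multilinear_tail:
  assumes A: "bounded_multilinear_X p q (Suc k) A" and x: "x \<in> X"
  shows "bounded_multilinear_X p q k (\<lambda>xs. A (x # xs))"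
proof -
  obtain C where C: "\<And>xs. length xs = Suc k \<Longrightarrow> set xs \<subseteq> X \<Longrightarrow> \<bar>A xs\<bar> \<le> C * prod_list (map N xs)"
    using multilinear_bound[OF A] by blast
  have "\<bar>A (x # xs)\<bar> \<le> C * N x * prod_list (map N xs)" if "length xs = k" "set xs \<subseteq> X" for xs
    using C[of "x # xs"] that x by (simp add: mult.assoc)
  moreover have "A (x # xs[j := vadd (xs ! j) (vscale c y)]) = A (x # xs) + c * A (x # xs[j := y])"
    if "length xs = k" "set xs \<subseteq> X" "j < k" "y \<in> X" for xs j y c
  proof -
    have "length (x # xs) = Suc k \<and> set (x # xs) \<subseteq> X \<and> Suc j < Suc k \<and> y \<in> X"
      using that x by simp
    then have "A ((x # xs)[Suc j := vadd ((x # xs) ! Suc j) (vscale c y)]) = A (x # xs) + c * A ((x # xs)[Suc j := y])"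
      using A unfolding bounded_multilinear_X_def by blast
    then show ?thesis by simp
  qed
  ultimately show ?thesis unfolding bounded_multilinear_X_def by blast
qed

lemma comb_X: "(\<And>j. j < m \<Longrightarrow> u j \<in> X) \<Longrightarrow> comb m u c \<in> X"
  by (induction m) (simp_all add: comb_0 comb_Suc vzero_X X_vadd X_vscale)

lemma multilinear_comb_Cons:
  assumes A: "bounded_multilinear_X p q (Suc k) A" and u: "\<And>j. j < m \<Longrightarrow> u j \<in> X"
    and xs: "length xs = k" "set xs \<subseteq> X"
  shows "A (comb m u c # xs) = (\<Sum>j<m. c j * A (u j # xs))"
  using u
proof (induction m)
  case 0
  have "vadd vzero (vscale 1 vzero) = vzero" by (simp add: vadd_def vscale_def vzero_def)
  then show ?case using multilinear_Cons_linear[OF A vzero_X vzero_X xs, of 1] by (simp add: comb_0)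
next
  case (Suc m)
  then show ?case
    using multilinear_Cons_linear[OF A comb_X _ xs, of m u "u m" c "c m"] by (simp add: comb_Suc)
qed

lemma multilinear_expand:
  assumes "bounded_multilinear_X p q k A" and u: "\<And>j. j < m \<Longrightarrow> u j \<in> X" and "length cs = k"
  shows "A (map (comb m u) cs) = (\<Sum>is\<in>index_lists m k. weight_prod cs is * A (map u is))"
  using assms(1,3)
proof (induction k arbitrary: A cs)
  case 0
  then show ?case by simp
next
  case (Suc k)
  obtain c cs' where c: "cs = c # cs'" "length cs' = k" using Suc.prems(2) by (cases cs) auto
  have "A (map (comb m u) cs) = (\<Sum>j<m. c j * A (u j # map (comb m u) cs'))"
    unfolding c(1) list.map
    by (rule multilinear_comb_Cons[OF Suc.prems(1) u]) (use c comb_X[OF u] in auto)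
  also have "\<dots> = (\<Sum>j<m. c j * (\<Sum>is\<in>index_lists m k. weight_prod cs' is * A (u j # map u is)))"
    using Suc.IH[OF multilinear_tail[OF Suc.prems(1) u] c(2)] by simp
  also have "\<dots> = (\<Sum>is\<in>index_lists m (Suc k). weight_prod cs is * A (map u is))"
    by (simp add: sum_index_lists_Suc c sum_distrib_left mult.assoc)
  finally show ?case .
qed

lemma multilinear_scale:
  assumes "bounded_multilinear_X p q k A" "x \<in> X"
  shows "A (replicate k (vscale c x)) = c ^ k * A (replicate k x)"
proof -
  have "vscale c x = comb 1 (\<lambda>_. x) (\<lambda>_. c)" by (simp add: comb_def vscale_def)
  moreover have l: "index_lists 1 k = {replicate k 0}"
    by (auto simp: index_lists_def intro!: replicate_eqI)
  moreover have "weight_prod (replicate k (\<lambda>_. c)) (replicate k 0) = c ^ k"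
    by (induction k) auto
  ultimately show ?thesis
    using multilinear_expand[OF assms(1), of 1 "\<lambda>_. x" "replicate k (\<lambda>_. c)"] assms(2)
    by (simp add: map_replicate_const)
qed

lemma multilinear_emb:
  assumes "bounded_multilinear_X p q k A"
  shows "A (replicate k (emb n h))
       = (\<Sum>is\<in>index_lists n k. A (map (\<lambda>i. emb n (\<lambda>j. if j = i then 1 else 0)) is) * (\<Prod>i\<leftarrow>is. h i))"
proof -
  let ?u = "\<lambda>i. emb n (\<lambda>j. if j = i then 1 else 0)"
  have "emb n h = comb n ?u h"
  proof (intro ext)
    fix m i
    have "(\<Sum>j<n. h j * (if m = n \<and> i < n then if i = j then 1 else 0 else 0))
        = (\<Sum>j<n. if i = j then (if m = n \<and> i < n then h j else 0) else 0)"
      by (intro sum.cong) auto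
    then show "emb n h m i = comb n ?u h m i" by (simp add: emb_def comb_def)
  qed
  then have "A (replicate k (emb n h)) = A (map (comb n ?u) (replicate k h))" by simp
  also have "\<dots> = (\<Sum>is\<in>index_lists n k. weight_prod (replicate k h) is * A (map ?u is))"
    by (rule multilinear_expand[OF assms]) (simp_all add: emb_X)
  also have "\<dots> = (\<Sum>is\<in>index_lists n k. A (map ?u is) * (\<Prod>i\<leftarrow>is. h i))"
  proof (rule sum.cong[OF refl])
    fix "is" assume "is \<in> index_lists n k"
    then have "length is = k" by (simp add: index_lists_def)
    then show "weight_prod (replicate k h) is * A (map ?u is) = A (map ?u is) * (\<Prod>i\<leftarrow>is. h i)"
      using weight_prod_replicate[of "is" h] by simp
  qed
  finally show ?thesis .
qed

lemma multilinear_diag_bound: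
  assumes "bounded_multilinear_X p q k A"
  obtains C where "0 \<le> C" "\<And>x. x \<in> X \<Longrightarrow> \<bar>A (replicate k x)\<bar> \<le> C * N x ^ k"
proof -
  obtain C where C: "0 \<le> C" "\<And>xs. length xs = k \<Longrightarrow> set xs \<subseteq> X \<Longrightarrow> \<bar>A xs\<bar> \<le> C * prod_list (map N xs)"
    using multilinear_bound[OF assms] by blast
  show ?thesis
  proof (rule that[OF C(1)])
    fix x assume "x \<in> X"
    then show "\<bar>A (replicate k x)\<bar> \<le> C * N x ^ k"
      using C(2)[of "replicate k x"] by (simp add: prod_list_replicate set_replicate_conv_if)
  qed
qed

text \<open>Injectivity of \<nu> leaves block \<open>\<nu> m\<close> empty until the m-th step, so
  each step adds at most 1 to the p-th power of the norm.\<close>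

lemma N_disjoint_sum:
  assumes \<nu>: "inj \<nu>" and h: "\<And>i. blk_norm q (\<nu> i) (h i) \<le> 1" and c: "signs c"
  shows "N (comb m (\<lambda>i. emb (\<nu> i) (h i)) c) \<le> real m powr (1 / p)"
proof -
  define x where "x = (\<lambda>m. comb m (\<lambda>i. emb (\<nu> i) (h i)) c)"
  have xX: "x m \<in> X" for m unfolding x_def by (rule comb_X) (rule emb_X)
  have "N (x m) powr p \<le> real m" for m
  proof (induction m)
    case 0
    show ?case by (simp add: x_def comb_0 N_vzero)
  next
    case (Suc m)
    have "x (Suc m) = vadd (x m) (emb (\<nu> m) (\<lambda>i. c m * h m i))"
      by (auto simp: x_def comb_Suc vadd_def vscale_def emb_def fun_eq_iff)
    moreover have z: "x m (\<nu> m) = (\<lambda>i. 0)"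
      using \<nu> by (auto simp: x_def comb_def emb_def fun_eq_iff inj_eq intro!: sum.neutral)
    have "\<bar>c m\<bar> = 1" using c by (auto simp: signs_def dest!: spec[of _ m])
    then have "blk_norm q (\<nu> m) (\<lambda>i. c m * h m i) \<le> 1" using h[of m] blk_norm_scale by simp
    then have "blk_norm q (\<nu> m) (\<lambda>i. c m * h m i) powr p \<le> 1"
      using p by (intro powr_le1) (auto simp: blk_norm_nonneg)
    ultimately show ?case
      using Suc N_add_emb[OF xX, of m "\<nu> m" "\<lambda>i. c m * h m i"] by (simp add: z)
  qed
  then have "(N (x m) powr p) powr (1 / p) \<le> real m powr (1 / p)"
    using p by (intro powr_mono2) auto
  then show ?thesis using p by (simp add: powr_powr N_nonneg x_def)
qed

text \<open>The diagonal sum over m disjoint unit blocks is at most C * m powr (k / p), which is o(m) when k < p.\<close>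

lemma low_degree_vanishes:
  assumes A: "bounded_multilinear_X p q k A" and k: "0 < k" "real k < p" and \<eta>: "0 < \<eta>"
  shows "\<exists>n0. \<forall>n\<ge>n0. \<forall>h. blk_norm q n h \<le> 1 \<longrightarrow> \<bar>A (replicate k (emb n h))\<bar> \<le> \<eta>"
proof (rule ccontr)
  assume no: "\<not> ?thesis"
  \<comment> \<open>Failure of the claim gives infinitely many bad blocks; enumerating them yields
    unit vectors in distinct blocks.\<close>
  define bad where "bad = {n. \<exists>h. blk_norm q n h \<le> 1 \<and> \<eta> < \<bar>A (replicate k (emb n h))\<bar>}"
  have inf: "infinite bad"
    using no unfolding infinite_nat_iff_unbounded_le bad_def by (force simp: not_le)
  define \<nu> where "\<nu> = enumerate bad"
  have \<nu>: "inj \<nu>" "\<And>i. \<nu> i \<in> bad"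
    unfolding \<nu>_def using strict_mono_enumerate[OF inf] enumerate_in_set[OF inf]
    by (auto intro: strict_mono_imp_inj_on)
  then obtain h where h: "\<And>i. blk_norm q (\<nu> i) (h i) \<le> 1" "\<And>i. \<eta> < \<bar>A (replicate k (emb (\<nu> i) (h i)))\<bar>"
    unfolding bad_def by simp metis
  define u where "u = (\<lambda>i. emb (\<nu> i) (h i))"
  have uX: "u i \<in> X" for i by (simp add: u_def emb_X)
  obtain C where C: "0 \<le> C" "\<And>xs. length xs = k \<Longrightarrow> set xs \<subseteq> X \<Longrightarrow> \<bar>A xs\<bar> \<le> C * prod_list (map N xs)"
    using multilinear_bound[OF A] by blast
  \<comment> \<open>These signs align the diagonal terms, so that m blocks contribute at least
    \<eta> * m.\<close>
  define \<tau> where "\<tau> = (\<lambda>i. if 0 \<le> A (replicate k (u i)) then 1 else -1 :: real)"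
  have \<tau>: "signs \<tau>" by (simp add: signs_def \<tau>_def)
  obtain k' where k': "k = Suc k'" using k(1) by (cases k) auto
  have bound: "\<eta> * real m \<le> C * (real m powr (1 / p)) ^ k" for m
  proof -
    have "\<bar>\<Sum>is\<in>index_lists m k. weight_prod cs is * A (map u is)\<bar> \<le> C * (real m powr (1 / p)) ^ k"
      if cs: "length cs = k" "\<forall>c\<in>set cs. signs c" for cs
    proof -
      have "\<bar>\<Sum>is\<in>index_lists m k. weight_prod cs is * A (map u is)\<bar> = \<bar>A (map (comb m u) cs)\<bar>"
        by (simp add: multilinear_expand[OF A uX cs(1)])
      also have "\<dots> \<le> C * prod_list (map N (map (comb m u) cs))"
        using cs comb_X[OF uX] by (intro C) auto
      also have "prod_list (map N (map (comb m u) cs)) \<le> (real m powr (1 / p)) ^ length cs"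
        using cs(2)
      proof (induction cs)
        case (Cons c cs)
        have "N (comb m u c) \<le> real m powr (1 / p)"
          unfolding u_def using Cons.prems by (intro N_disjoint_sum \<nu> h) auto
        then show ?case
          using Cons by (auto intro!: mult_mono prod_list_nonneg simp: N_nonneg)
      qed simp
      finally show ?thesis using C(1) cs(1) by (simp add: mult_left_mono)
    qed
    from diagonal_sum_le[where k = k' and m = m and T = "\<lambda>is. A (map u is)" and \<tau> = \<tau>, folded k', OF this \<tau>]
    have "\<bar>\<Sum>i<m. \<tau> i * A (replicate k (u i))\<bar> \<le> C * (real m powr (1 / p)) ^ k" by simp
    moreover have "(\<Sum>i<m. \<eta>) \<le> (\<Sum>i<m. \<tau> i * A (replicate k (u i)))"
    proof (rule sum_mono)
      fix i show "\<eta> \<le> \<tau> i * A (replicate k (u i))"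
        using h(2)[of i] by (auto simp: \<tau>_def u_def)
    qed
    ultimately show ?thesis by (simp add: mult.commute)
  qed
  have "(\<lambda>m::nat. C * (real m powr (1 / p)) ^ k / real m) \<longlonglongrightarrow> 0"
  proof -
    have "(\<lambda>m::nat. C * real m powr (real k / p - 1)) \<longlonglongrightarrow> C * 0"
      using k p by (intro tendsto_mult tendsto_const tendsto_neg_powr filterlim_real_sequentially) auto
    moreover have "\<forall>\<^sub>F m in sequentially. C * real m powr (real k / p - 1) = C * (real m powr (1 / p)) ^ k / real m"
      by (intro eventually_sequentiallyI[of 1]) (auto simp: powr_power powr_diff)
    ultimately show ?thesis by (simp add: tendsto_cong)
  qed
  from order_tendstoD(2)[OF this \<eta>]
  obtain m0 where m0: "\<And>m. m \<ge> m0 \<Longrightarrow> C * (real m powr (1 / p)) ^ k / real m < \<eta>"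
    by (auto simp: eventually_sequentially)
  define m where "m = Suc m0"
  have "C * (real m powr (1 / p)) ^ k / real m < \<eta>" "0 < real m" using m0[of m] by (simp_all add: m_def)
  then show False using bound[of m] by (simp add: field_simps)
qed

end

section \<open>The Taylor polynomial at a perturbed minimum\<close>

context lp_lq
begin

text \<open>The Taylor polynomial has no constant term: at h = 0 the error estimate reads |P 0|
  \<le> 0, because \<open>0 powr p = 0\<close>, and the terms of positive degree vanish
  there.\<close>

lemma taylor_expansion:
  assumes "T_smooth_X p q p f" "y \<in> X"
  obtains A where "\<And>k. k \<le> nat \<lfloor>p\<rfloor> \<Longrightarrow> bounded_multilinear_X p q k (A k)"
    "\<And>\<epsilon>. 0 < \<epsilon> \<Longrightarrow> \<exists>\<delta>>0. \<forall>h\<in>X. N h < \<delta> \<longrightarrow>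
        \<bar>f (vadd y h) - f y - (\<Sum>k=1..nat \<lfloor>p\<rfloor>. A k (replicate k h))\<bar> \<le> \<epsilon> * N h powr p"
proof -
  define d where "d = nat \<lfloor>p\<rfloor>"
  obtain P where P: "cont_poly_X p q d P" "\<And>\<epsilon>. 0 < \<epsilon> \<Longrightarrow> \<exists>\<delta>>0. \<forall>h\<in>X. N h < \<delta> \<longrightarrow>
        \<bar>f (vadd y h) - f y - P h\<bar> \<le> \<epsilon> * N h powr p"
    using assms unfolding T_smooth_X_def d_def by blast
  obtain A where A: "\<And>k. k \<le> d \<Longrightarrow> bounded_multilinear_X p q k (A k)"
    "\<And>h. h \<in> X \<Longrightarrow> P h = (\<Sum>k\<le>d. A k (replicate k h))"
    using P(1) unfolding cont_poly_X_def by blast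
  have split: "P h = A 0 [] + (\<Sum>k=1..d. A k (replicate k h))" if "h \<in> X" for h
    unfolding A(2)[OF that] atMost_atLeast0 by (subst sum.atLeast_Suc_atMost) auto
  have "A k (replicate k vzero) = 0" if k: "k \<in> {1..d}" for k
  proof -
    have "k \<le> d" using k by simp
    from multilinear_diag_bound[OF A(1)[OF this]]
    obtain C where "\<And>x. x \<in> X \<Longrightarrow> \<bar>A k (replicate k x)\<bar> \<le> C * N x ^ k"
      by metis
    from this[OF vzero_X] show ?thesis using k by (simp add: N_vzero power_0_left)
  qed
  then have "P vzero = A 0 []" using split[OF vzero_X] by simp
  moreover have "P vzero = 0"
  proof -
    obtain \<delta> where "\<delta> > 0" "\<And>h. h \<in> X \<Longrightarrow> N h < \<delta> \<Longrightarrow> \<bar>f (vadd y h) - f y - P h\<bar> \<le> 1 * N h powr p"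
      using P(2)[of 1] by auto
    moreover have "vadd y vzero = y" by (simp add: vadd_def vzero_def)
    ultimately show ?thesis using vzero_X N_vzero by fastforce
  qed
  ultimately have "P h = (\<Sum>k=1..d. A k (replicate k h))" if "h \<in> X" for h
    using split[OF that] by simp
  then show ?thesis
    using that[of A] A(1) P(2) by (simp add: d_def cong: ball_cong)
qed

lemma smooth_continuous:
  assumes f: "T_smooth_X p q p f" and x: "\<And>k. x k \<in> X" and y: "y \<in> X"
    and lim: "(\<lambda>k. N (vsub (x k) y)) \<longlonglongrightarrow> 0"
  shows "(\<lambda>k. f (x k)) \<longlonglongrightarrow> f y"
proof -
  obtain A where A: "\<And>k. k \<le> nat \<lfloor>p\<rfloor> \<Longrightarrow> bounded_multilinear_X p q k (A k)"
    "\<And>\<epsilon>. 0 < \<epsilon> \<Longrightarrow> \<exists>\<delta>>0. \<forall>h\<in>X. N h < \<delta> \<longrightarrow>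
        \<bar>f (vadd y h) - f y - (\<Sum>k=1..nat \<lfloor>p\<rfloor>. A k (replicate k h))\<bar> \<le> \<epsilon> * N h powr p"
    using taylor_expansion[OF f y] by blast
  define h where "h = (\<lambda>k. vsub (x k) y)"
  have h: "h k \<in> X" "vadd y (h k) = x k" for k
    using X_vsub[OF x y] by (auto simp: h_def vadd_def vsub_apply fun_eq_iff)
  have hlim: "(\<lambda>k. N (h k)) \<longlonglongrightarrow> 0" using lim by (simp add: h_def)
  define S where "S = (\<lambda>k. \<Sum>j=1..nat \<lfloor>p\<rfloor>. A j (replicate j (h k)))"
  have "(\<lambda>k. A j (replicate j (h k))) \<longlonglongrightarrow> 0" if j: "j \<in> {1..nat \<lfloor>p\<rfloor>}" for j
  proof -
    have "j \<le> nat \<lfloor>p\<rfloor>" using j by simp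
    from multilinear_diag_bound[OF A(1)[OF this]]
    obtain C where "\<And>x. x \<in> X \<Longrightarrow> \<bar>A j (replicate j x)\<bar> \<le> C * N x ^ j"
      by metis
    then have "\<forall>k. norm (A j (replicate j (h k))) \<le> C * N (h k) ^ j" using h by simp
    moreover have "(\<lambda>k. C * N (h k) ^ j) \<longlonglongrightarrow> C * 0 ^ j"
      by (intro tendsto_mult tendsto_const tendsto_power hlim)
    then have "(\<lambda>k. C * N (h k) ^ j) \<longlonglongrightarrow> 0" using j by (simp add: power_0_left)
    ultimately show ?thesis by (rule Lim_null_comparison[OF always_eventually])
  qed
  then have "S \<longlonglongrightarrow> (\<Sum>j=1..nat \<lfloor>p\<rfloor>. 0)" unfolding S_def by (rule tendsto_sum)
  then have S: "S \<longlonglongrightarrow> 0" by simp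
  obtain \<delta> where \<delta>: "\<delta> > 0" "\<And>h. h \<in> X \<Longrightarrow> N h < \<delta> \<Longrightarrow>
      \<bar>f (vadd y h) - f y - (\<Sum>k=1..nat \<lfloor>p\<rfloor>. A k (replicate k h))\<bar> \<le> N h powr p"
    using A(2)[of 1] by auto
  have "(\<lambda>k. f (x k) - f y - S k) \<longlonglongrightarrow> 0"
  proof (rule Lim_null_comparison)
    show "\<forall>\<^sub>F k in sequentially. norm (f (x k) - f y - S k) \<le> N (h k) powr p"
      using order_tendstoD(2)[OF hlim \<delta>(1)]
    proof (rule eventually_mono)
      fix k assume "N (h k) < \<delta>"
      from \<delta>(2)[OF h(1) this] show "norm (f (x k) - f y - S k) \<le> N (h k) powr p"
        by (simp add: h(2) S_def)
    qed
    have "(\<lambda>k. N (h k) powr p) \<longlonglongrightarrow> 0 powr p"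
      using p hlim by (intro tendsto_powr') (auto simp: N_nonneg)
    then show "(\<lambda>k. N (h k) powr p) \<longlonglongrightarrow> 0" by simp
  qed
  from tendsto_add[OF this S] have "(\<lambda>k. f (x k) - f y) \<longlonglongrightarrow> 0" by simp
  then show ?thesis by (simp add: LIM_zero_iff)
qed

text \<open>Take \<open>a = f x0 \<noteq> 0\<close>, so that F x0 \<le> 0. The constant c makes c *
  N^p at most a^2/2 on the ball of radius R' = R + 1, hence (f y - a)^2 \<le> a^2/2 < a^2 and f y is
  nonzero. So y lies in the ball of radius R, which leaves room for steps of length t \<le>
  1.\<close>

lemma bump_point:
  assumes bump: "bump_X p q f" and f: "T_smooth_X p q p f"
  obtains y a c where "y \<in> X" "0 < c"
    "\<And>t. 0 < t \<Longrightarrow> t \<le> 1 \<Longrightarrow> \<exists>n0. \<forall>n\<ge>n0. \<forall>h. blk_norm q n h = t \<longrightarrow>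
        c * t powr p \<le> (f (vadd y (emb n h)) - a)\<^sup>2 - (f y - a)\<^sup>2"
proof -
  obtain x0 R where x0: "x0 \<in> X" "f x0 \<noteq> 0" and R: "\<And>x. x \<in> X \<Longrightarrow> f x \<noteq> 0 \<Longrightarrow> N x \<le> R"
    using bump unfolding bump_X_def by blast
  define a where "a = f x0"
  define R' where "R' = R + 1"
  have "0 \<le> R" using R[OF x0] N_nonneg[of x0] by linarith
  then have R': "0 < R'" by (simp add: R'_def)
  define c where "c = a\<^sup>2 / (2 * R' powr p)"
  have c: "0 < c" using x0 R' by (simp add: c_def a_def)
  define F where "F = (\<lambda>x. (f x - a)\<^sup>2 - c * N x powr p)"
  have cont: "(\<lambda>k. F (x k)) \<longlonglongrightarrow> F y"
    if x: "\<And>k. x k \<in> X" and y: "y \<in> X" and lim: "(\<lambda>k. N (vsub (x k) y)) \<longlonglongrightarrow> 0" for x y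
  proof -
    have "(\<lambda>k. N (x k) - N y) \<longlonglongrightarrow> 0"
      by (rule Lim_null_comparison[OF _ lim]) (auto simp: N_diff_le x y)
    then have Nlim: "(\<lambda>k. N (x k)) \<longlonglongrightarrow> N y" by (simp add: LIM_zero_iff)
    show ?thesis
      unfolding F_def using p
      by (intro tendsto_diff tendsto_mult tendsto_power tendsto_const tendsto_powr' Nlim smooth_continuous[OF f x y lim])
         (auto simp: N_nonneg)
  qed
  have cR: "c * N x powr p \<le> a\<^sup>2 / 2" if "N x \<le> R'" for x
  proof -
    have "N x powr p \<le> R' powr p" using that p N_nonneg by (intro powr_mono2) auto
    then have "c * N x powr p \<le> c * R' powr p" using c by (intro mult_left_mono) auto
    then show ?thesis using R' by (simp add: c_def)
  qed
  have "- (a\<^sup>2 / 2) \<le> F x" if "x \<in> X" "N x \<le> R'" for x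
    using cR[OF that(2)] zero_le_power2[of "f x - a"] unfolding F_def by linarith
  \<comment> \<open>Budget in units of c * t^p: the perturbation costs 2/8 = 1/4, the term c * N^p
    gains at least 3/4 by near additivity, and 1/2 remains.\<close>
  then have "\<exists>y\<in>X. N y \<le> R' \<and> F y \<le> F x0 \<and> (\<forall>t>0. \<exists>n0. \<forall>n\<ge>n0. \<forall>h. blk_norm q n h = t \<longrightarrow>
           N (vadd y (emb n h)) \<le> R' \<longrightarrow> F y - 2 * (c / 8) * t powr p < F (vadd y (emb n h)))"
    using R[OF x0] c by (intro block_minimum cont x0) (auto simp: R'_def)
  then obtain y where y: "y \<in> X" "N y \<le> R'" "F y \<le> F x0" and min: "\<And>t. 0 < t \<Longrightarrow> \<exists>n0. \<forall>n\<ge>n0. \<forall>h. blk_norm q n h = t \<longrightarrow>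
           N (vadd y (emb n h)) \<le> R' \<longrightarrow> F y - 2 * (c / 8) * t powr p < F (vadd y (emb n h))"
    by blast
  have "F x0 \<le> 0" using c by (simp add: F_def a_def)
  then have "(f y - a)\<^sup>2 \<le> a\<^sup>2 / 2" using y cR[OF y(2)] by (simp add: F_def)
  moreover have "a \<noteq> 0" using x0 by (simp add: a_def)
  ultimately have "f y \<noteq> 0" by (auto simp: field_simps)
  then have yR: "N y \<le> R" using R y by blast
  show ?thesis
  proof (rule that[of y "c / 2" a])
    fix t :: real assume t: "0 < t" "t \<le> 1"
    obtain n1 where n1: "\<And>n h. n \<ge> n1 \<Longrightarrow> blk_norm q n h = t \<Longrightarrow>
           N (vadd y (emb n h)) \<le> R' \<Longrightarrow> F y - 2 * (c / 8) * t powr p < F (vadd y (emb n h))"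
      using min[OF t(1)] by blast
    obtain \<delta> where \<delta>: "\<delta> > 0" "\<And>z n h. z \<in> X \<Longrightarrow> \<beta> n z \<le> \<delta> \<Longrightarrow> blk_norm q n h = t \<Longrightarrow>
           \<bar>N (vadd z (emb n h)) powr p - N z powr p - t powr p\<bar> \<le> t powr p / 4"
      using N_add_emb_approx[OF t(1), of "t powr p / 4"] t by auto
    obtain n2 where n2: "\<And>n. n \<ge> n2 \<Longrightarrow> \<beta> n y < \<delta>"
      using order_tendstoD(2)[OF blk_tendsto_0[OF y(1)] \<delta>(1)] by (auto simp: eventually_sequentially)
    show "\<exists>n0. \<forall>n\<ge>n0. \<forall>h. blk_norm q n h = t \<longrightarrow>
        c / 2 * t powr p \<le> (f (vadd y (emb n h)) - a)\<^sup>2 - (f y - a)\<^sup>2"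
    proof (intro exI[of _ "max n1 n2"] allI impI)
      fix n h assume n: "max n1 n2 \<le> n" and h: "blk_norm q n h = t"
      have "N (vadd y (emb n h)) \<le> N y + t" using N_triangle[OF y(1) emb_X, of n h] h by (simp add: N_emb)
      then have "N (vadd y (emb n h)) \<le> R'" using yR t by (simp add: R'_def)
      then have 1: "F y - 2 * (c / 8) * t powr p < F (vadd y (emb n h))" using n h by (intro n1) auto
      have "\<bar>N (vadd y (emb n h)) powr p - N y powr p - t powr p\<bar> \<le> t powr p / 4"
        using n h n2[of n] by (intro \<delta>(2) y) auto
      then have "3 / 4 * t powr p \<le> N (vadd y (emb n h)) powr p - N y powr p"
        using abs_le_D2 by fastforce
      then have "c * (3 / 4 * t powr p) \<le> c * (N (vadd y (emb n h)) powr p - N y powr p)"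
        using c by (intro mult_left_mono) auto
      then show "c / 2 * t powr p \<le> (f (vadd y (emb n h)) - a)\<^sup>2 - (f y - a)\<^sup>2"
        using 1 unfolding F_def by (simp add: algebra_simps)
    qed
  qed (use y c in auto)
qed

lemma exists_block_vector: "\<exists>n\<ge>n0. \<exists>h. blk_norm q n h = t" if "0 \<le> t"
\<comment> \<open>\<open>Suc n0\<close> rather than n0, because block 0 has no coordinate.\<close>
proof (intro exI[of _ "Suc n0"] conjI exI[of _ "\<lambda>i. if i = 0 then t else 0"])
  have "(\<Sum>i<Suc n0. \<bar>if i = 0 then t else 0\<bar> powr q) = t powr q"
    using that by (subst sum.remove[of _ 0]) auto
  then show "blk_norm q (Suc n0) (\<lambda>i. if i = 0 then t else 0) = t"
    using that q by (simp add: blk_norm_def powr_powr)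
qed simp

lemma low_degree_sum_vanishes:
  assumes "\<And>k. k \<in> K \<Longrightarrow> bounded_multilinear_X p q k (A k)" "\<And>k. k \<in> K \<Longrightarrow> 0 < k \<and> real k < p"
    and "finite K" "0 < \<eta>"
  shows "\<exists>n0. \<forall>n\<ge>n0. \<forall>h. blk_norm q n h \<le> 1 \<longrightarrow> \<bar>\<Sum>k\<in>K. A k (replicate k (emb n h))\<bar> \<le> \<eta>"
  using assms(3,1,2,4)
proof (induction K arbitrary: \<eta> rule: finite_induct)
  case (insert k K)
  have "\<exists>n0. \<forall>n\<ge>n0. \<forall>h. blk_norm q n h \<le> 1 \<longrightarrow> \<bar>\<Sum>k\<in>K. A k (replicate k (emb n h))\<bar> \<le> \<eta> / 2"
    by (rule insert.IH) (use insert.prems in auto)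
  then obtain n1 where n1: "\<And>n h. n \<ge> n1 \<Longrightarrow> blk_norm q n h \<le> 1 \<Longrightarrow> \<bar>\<Sum>k\<in>K. A k (replicate k (emb n h))\<bar> \<le> \<eta> / 2"
    by blast
  obtain n2 where n2: "\<And>n h. n \<ge> n2 \<Longrightarrow> blk_norm q n h \<le> 1 \<Longrightarrow> \<bar>A k (replicate k (emb n h))\<bar> \<le> \<eta> / 2"
    using low_degree_vanishes[of k "A k" "\<eta> / 2"] insert.prems by (metis half_gt_zero insertI1)
  show ?case
  proof (intro exI[of _ "max n1 n2"] allI impI)
    fix n h assume "max n1 n2 \<le> n" "blk_norm q n h \<le> 1"
    then have "\<bar>\<Sum>k\<in>K. A k (replicate k (emb n h))\<bar> \<le> \<eta> / 2" "\<bar>A k (replicate k (emb n h))\<bar> \<le> \<eta> / 2"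
      using n1 n2 by auto
    then show "\<bar>\<Sum>k\<in>insert k K. A k (replicate k (emb n h))\<bar> \<le> \<eta>"
      using insert.hyps by simp
  qed
qed auto

text \<open>With D = f (y + h) - f y and b = f y - a, the square increases by 2 * b * D + D^2. Up to
  a small multiple of t^p, D is the part Q of degree p, and D^2 is of order t^(2p). So 2 * b * Q is
  at least (c/4) * t^p on the sphere of radius t in every late block; Q cannot vanish there, nor
  change sign under h \<mapsto> -h.\<close>

lemma block_form:
  assumes bump: "bump_X p q f" and f: "T_smooth_X p q p f"
  obtains d A n0 where "p = real d" "even d" "bounded_multilinear_X p q d A"
    "\<And>n h. n \<ge> n0 \<Longrightarrow> blk_norm q n h ^ d \<le> A (replicate d (emb n h))"
proof -
  obtain y a c where y: "y \<in> X" and c: "0 < c" and incr: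
    "\<And>t. 0 < t \<Longrightarrow> t \<le> 1 \<Longrightarrow> \<exists>n0. \<forall>n\<ge>n0. \<forall>h. blk_norm q n h = t \<longrightarrow>
        c * t powr p \<le> (f (vadd y (emb n h)) - a)\<^sup>2 - (f y - a)\<^sup>2"
    using bump_point[OF bump f] by metis
  define b where "b = f y - a"
  define d where "d = nat \<lfloor>p\<rfloor>"
  have d: "0 < d" "real d \<le> p" "p < real d + 1" using p by (auto simp: d_def)
  obtain A where A: "\<And>k. k \<le> d \<Longrightarrow> bounded_multilinear_X p q k (A k)"
    "\<And>\<epsilon>. 0 < \<epsilon> \<Longrightarrow> \<exists>\<delta>>0. \<forall>h\<in>X. N h < \<delta> \<longrightarrow>
        \<bar>f (vadd y h) - f y - (\<Sum>k=1..d. A k (replicate k h))\<bar> \<le> \<epsilon> * N h powr p"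
    using taylor_expansion[OF f y] unfolding d_def by metis
  \<comment> \<open>As d is the integer part of p, all other degrees are below p and fade on late
    blocks. If p is not an integer nothing of degree p remains, which \<open>pd\<close> turns into a
    contradiction.\<close>
  define Q where "Q = (\<lambda>h. if p = real d then A d (replicate d h) else 0)"
  have approx: "\<exists>t0>0. \<forall>t. 0 < t \<longrightarrow> t \<le> t0 \<longrightarrow> (\<exists>n0. \<forall>n\<ge>n0. \<forall>h. blk_norm q n h = t \<longrightarrow>
      (\<exists>D. \<bar>D - Q (emb n h)\<bar> \<le> \<epsilon> * t powr p \<and> c * t powr p \<le> 2 * b * D + D\<^sup>2))"
    if \<epsilon>: "0 < \<epsilon>" for \<epsilon>
  proof -
    obtain \<delta> where \<delta>: "\<delta> > 0" "\<And>h. h \<in> X \<Longrightarrow> N h < \<delta> \<Longrightarrow>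
        \<bar>f (vadd y h) - f y - (\<Sum>k=1..d. A k (replicate k h))\<bar> \<le> \<epsilon> / 2 * N h powr p"
      using A(2)[of "\<epsilon> / 2"] \<epsilon> by auto
    show ?thesis
    proof (intro exI[of _ "min 1 (\<delta> / 2)"] conjI allI impI)
      show "0 < min 1 (\<delta> / 2)" using \<delta> by simp
      fix t :: real assume t: "0 < t" "t \<le> min 1 (\<delta> / 2)"
      obtain n1 where n1: "\<And>n h. n \<ge> n1 \<Longrightarrow> blk_norm q n h = t \<Longrightarrow>
          c * t powr p \<le> (f (vadd y (emb n h)) - a)\<^sup>2 - (f y - a)\<^sup>2"
        using incr[of t] t by auto
      define K where "K = {k\<in>{1..d}. real k < p}"
      have "\<exists>n0. \<forall>n\<ge>n0. \<forall>h. blk_norm q n h \<le> 1 \<longrightarrow> \<bar>\<Sum>k\<in>K. A k (replicate k (emb n h))\<bar> \<le> \<epsilon> / 2 * t powr p"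
        by (rule low_degree_sum_vanishes) (use A(1) \<epsilon> t in \<open>auto simp: K_def\<close>)
      then obtain n2 where n2: "\<And>n h. n \<ge> n2 \<Longrightarrow> blk_norm q n h \<le> 1 \<Longrightarrow>
          \<bar>\<Sum>k\<in>K. A k (replicate k (emb n h))\<bar> \<le> \<epsilon> / 2 * t powr p" by blast
      have split: "(\<Sum>k=1..d. A k (replicate k h)) = (\<Sum>k\<in>K. A k (replicate k h)) + Q h" for h
      proof (cases "p = real d")
        case True
        then have ins: "{1..d} = insert d K" "d \<notin> K" using d by (auto simp: K_def)
        have "finite K" by (simp add: K_def)
        then have "(\<Sum>k=1..d. A k (replicate k h)) = A d (replicate d h) + (\<Sum>k\<in>K. A k (replicate k h))"
          unfolding ins(1) using ins(2) by (rule sum.insert)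
        then show ?thesis using True by (simp add: Q_def)
      next
        case False
        then have "K = {1..d}" using d by (fastforce simp: K_def)
        then show ?thesis using False by (simp add: Q_def)
      qed
      show "\<exists>n0. \<forall>n\<ge>n0. \<forall>h. blk_norm q n h = t \<longrightarrow>
        (\<exists>D. \<bar>D - Q (emb n h)\<bar> \<le> \<epsilon> * t powr p \<and> c * t powr p \<le> 2 * b * D + D\<^sup>2)"
      proof (intro exI[of _ "max n1 n2"] allI impI)
        fix n h assume n: "max n1 n2 \<le> n" and h: "blk_norm q n h = t"
        define D where "D = f (vadd y (emb n h)) - f y"
        have "\<bar>D - (\<Sum>k=1..d. A k (replicate k (emb n h)))\<bar> \<le> \<epsilon> / 2 * t powr p"
          using \<delta>(2)[OF emb_X, of n h] h t \<delta>(1) by (simp add: N_emb D_def)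
        moreover have "\<bar>\<Sum>k\<in>K. A k (replicate k (emb n h))\<bar> \<le> \<epsilon> / 2 * t powr p"
          using n h t by (intro n2) auto
        ultimately have "\<bar>D - Q (emb n h)\<bar> \<le> \<epsilon> / 2 * t powr p + \<epsilon> / 2 * t powr p"
          unfolding split by linarith
        moreover have "c * t powr p \<le> (D + b)\<^sup>2 - b\<^sup>2"
          using n1[OF _ h] n by (simp add: D_def b_def algebra_simps)
        then have "c * t powr p \<le> 2 * b * D + D\<^sup>2" by (simp add: power2_eq_square algebra_simps)
        ultimately show "\<exists>D. \<bar>D - Q (emb n h)\<bar> \<le> \<epsilon> * t powr p \<and> c * t powr p \<le> 2 * b * D + D\<^sup>2"
          by (intro exI[of _ D]) simp
      qed
    qed
  qed
  obtain M where M: "0 \<le> M" "\<And>x. x \<in> X \<Longrightarrow> \<bar>A d (replicate d x)\<bar> \<le> M * N x ^ d"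
    using multilinear_diag_bound[OF A(1)[OF order_refl]] by metis
  have QM: "\<bar>Q (emb n h)\<bar> \<le> M * t powr p" if "blk_norm q n h = t" "0 < t" for n h t
  proof (cases "p = real d")
    case True
    have "\<bar>A d (replicate d (emb n h))\<bar> \<le> M * t ^ d"
      using M(2)[OF emb_X, of n h] unfolding N_emb that(1) .
    moreover have "t powr p = t ^ d" using True that(2) by (simp add: powr_realpow)
    ultimately show ?thesis using True unfolding Q_def by simp
  qed (use M(1) in \<open>simp add: Q_def\<close>)
  \<comment> \<open>This makes the error 2 * |b| * \<epsilon> * t^p at most (c/2) * t^p; the summand
    1 covers b = 0, and \<epsilon> \<le> 1 gives |D| \<le> (M + 1) * t^p.\<close>
  define \<epsilon> where "\<epsilon> = min 1 (c / (4 * (\<bar>b\<bar> + 1)))"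
  have \<epsilon>: "0 < \<epsilon>" "\<epsilon> \<le> 1" "4 * (\<bar>b\<bar> + 1) * \<epsilon> \<le> c"
  proof -
    show "0 < \<epsilon>" "\<epsilon> \<le> 1" using c by (simp_all add: \<epsilon>_def)
    have "4 * (\<bar>b\<bar> + 1) * \<epsilon> \<le> 4 * (\<bar>b\<bar> + 1) * (c / (4 * (\<bar>b\<bar> + 1)))"
      by (intro mult_left_mono) (simp_all add: \<epsilon>_def)
    then show "4 * (\<bar>b\<bar> + 1) * \<epsilon> \<le> c" by simp
  qed
  obtain t0 where t0: "t0 > 0" "\<And>t. 0 < t \<Longrightarrow> t \<le> t0 \<Longrightarrow> \<exists>n0. \<forall>n\<ge>n0. \<forall>h. blk_norm q n h = t \<longrightarrow>
      (\<exists>D. \<bar>D - Q (emb n h)\<bar> \<le> \<epsilon> * t powr p \<and> c * t powr p \<le> 2 * b * D + D\<^sup>2)"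
    using approx[OF \<epsilon>(1)] by metis
  have "((\<lambda>t. (M + 1)\<^sup>2 * t powr p) \<longlongrightarrow> (M + 1)\<^sup>2 * 0 powr p) (at_right 0)"
    using p eventually_at_right_less[of "0::real"]
    by (intro tendsto_mult tendsto_const tendsto_powr') (auto elim: eventually_mono)
  then have "\<forall>\<^sub>F t in at_right 0. (M + 1)\<^sup>2 * t powr p < c / 4"
    using c by (intro order_tendstoD) auto
  then obtain t1 where t1: "t1 > 0" "\<And>t. 0 < t \<Longrightarrow> t < t1 \<Longrightarrow> (M + 1)\<^sup>2 * t powr p < c / 4"
    unfolding eventually_at_right_field by blast
  \<comment> \<open>Small enough for D^2 \<le> (c/4) * t^p, so that c - c/2 - c/4 leaves the c/4 of
    \<open>key\<close>. The index n0 depends on t, but this single t suffices: homogeneity covers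
    all other norms.\<close>
  define t where "t = min t0 (t1 / 2)"
  have t: "0 < t" "t \<le> t0" "(M + 1)\<^sup>2 * t powr p \<le> c / 4"
    using t0 t1 by (auto simp: t_def intro!: less_imp_le)
  define \<pi> where "\<pi> = t powr p"
  have \<pi>: "0 < \<pi>" "(M + 1)\<^sup>2 * \<pi> \<le> c / 4" using t by (simp_all add: \<pi>_def)
  obtain n0 where n0: "\<And>n h. n \<ge> n0 \<Longrightarrow> blk_norm q n h = t \<Longrightarrow>
      \<exists>D. \<bar>D - Q (emb n h)\<bar> \<le> \<epsilon> * \<pi> \<and> c * \<pi> \<le> 2 * b * D + D\<^sup>2"
    using t0(2)[OF t(1,2)] unfolding \<pi>_def by blast
  have key: "c / 4 * \<pi> \<le> 2 * b * Q (emb n h)" if n: "n \<ge> n0" and h: "blk_norm q n h = t" for n h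
  proof -
    obtain D where D: "\<bar>D - Q (emb n h)\<bar> \<le> \<epsilon> * \<pi>" "c * \<pi> \<le> 2 * b * D + D\<^sup>2"
      using n0[OF n h] by blast
    have "\<epsilon> * \<pi> \<le> 1 * \<pi>" using \<epsilon> \<pi> by (intro mult_right_mono) auto
    then have "\<bar>D\<bar> \<le> (M + 1) * \<pi>" using D(1) QM[OF h t(1)] by (simp add: \<pi>_def algebra_simps)
    then have "\<bar>D\<bar>\<^sup>2 \<le> ((M + 1) * \<pi>)\<^sup>2" by (intro power_mono) auto
    also have "\<dots> = ((M + 1)\<^sup>2 * \<pi>) * \<pi>" by (simp add: power2_eq_square algebra_simps)
    also have "\<dots> \<le> c / 4 * \<pi>" using \<pi> by (intro mult_right_mono) auto
    finally have D2: "D\<^sup>2 \<le> c / 4 * \<pi>" by simp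
    have "2 * b * (D - Q (emb n h)) \<le> \<bar>2 * b * (D - Q (emb n h))\<bar>" by simp
    also have "\<dots> = 2 * \<bar>b\<bar> * \<bar>D - Q (emb n h)\<bar>" by (simp add: abs_mult)
    also have "\<dots> \<le> 2 * \<bar>b\<bar> * (\<epsilon> * \<pi>)" by (intro mult_left_mono D) auto
    also have "\<dots> \<le> (2 * (\<bar>b\<bar> + 1) * \<epsilon>) * \<pi>"
      using \<epsilon> \<pi> by (simp add: algebra_simps)
    also have "\<dots> \<le> c / 2 * \<pi>" using \<epsilon>(3) \<pi> by (intro mult_right_mono) (simp_all add: algebra_simps)
    finally have "2 * b * D \<le> 2 * b * Q (emb n h) + c / 2 * \<pi>" by (simp add: algebra_simps)
    then show ?thesis using D(2) D2 by (simp add: algebra_simps)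
  qed
  obtain n h where n: "n \<ge> n0" and h: "blk_norm q n h = t"
    using exists_block_vector[of t n0] t by auto
  have pd: "p = real d"
  proof (rule ccontr)
    assume "p \<noteq> real d"
    then have "c / 4 * \<pi> \<le> 0" using key[OF n h] by (simp add: Q_def)
    then show False using c \<pi> by (simp add: mult_le_0_iff)
  qed
  have Q: "Q x = A d (replicate d x)" for x using pd by (simp add: Q_def)
  have Q_scale: "Q (emb n (\<lambda>i. s * h i)) = s ^ d * Q (emb n h)" for s n h
  proof -
    have "emb n (\<lambda>i. s * h i) = vscale s (emb n h)" by (auto simp: emb_def vscale_def fun_eq_iff)
    then show ?thesis using multilinear_scale[OF A(1)[OF order_refl] emb_X] by (simp add: Q)
  qed
  have "even d"
  proof (rule ccontr)
    assume "odd d"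
    then have "Q (emb n (\<lambda>i. (-1) * h i)) = - Q (emb n h)" unfolding Q_scale by simp
    moreover have "blk_norm q n (\<lambda>i. (-1) * h i) = t" unfolding blk_norm_scale using h by simp
    ultimately have "c / 4 * \<pi> \<le> - (2 * b * Q (emb n h))" using key[OF n, of "\<lambda>i. (-1) * h i"] by simp
    moreover have "0 < c / 4 * \<pi>" using c \<pi> by simp
    ultimately show False using key[OF n h] by linarith
  qed
  \<comment> \<open>The factor 8 * b / c normalises the lower constant to 1 and carries the sign of
    b.\<close>
  define A' where "A' = (\<lambda>xs. 8 * b / c * A d xs)"
  show ?thesis
  proof (rule that[OF pd \<open>even d\<close>, of A' n0])
    have lin: "A' (xs[j := vadd (xs ! j) (vscale s z)]) = A' xs + s * A' (xs[j := z])"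
      if "length xs = d \<and> set xs \<subseteq> X \<and> j < d \<and> z \<in> X" for xs j z s
    proof -
      have "A d (xs[j := vadd (xs ! j) (vscale s z)]) = A d xs + s * A d (xs[j := z])"
        using A(1)[OF order_refl] that unfolding bounded_multilinear_X_def by blast
      then show ?thesis by (simp add: A'_def algebra_simps add_divide_distrib)
    qed
    obtain C where C: "\<And>xs. length xs = d \<Longrightarrow> set xs \<subseteq> X \<Longrightarrow> \<bar>A d xs\<bar> \<le> C * prod_list (map N xs)"
      using multilinear_bound[OF A(1)[OF order_refl]] by metis
    have "\<bar>A' xs\<bar> \<le> (\<bar>8 * b / c\<bar> * C) * prod_list (map N xs)" if "length xs = d \<and> set xs \<subseteq> X" for xs
      unfolding A'_def abs_mult mult.assoc using that by (intro mult_left_mono C) auto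
    then show "bounded_multilinear_X p q d A'"
      unfolding bounded_multilinear_X_def using lin by blast
  next
    fix n h assume n: "n \<ge> n0"
    define r where "r = blk_norm q n h"
    show "blk_norm q n h ^ d \<le> A' (replicate d (emb n h))"
    proof (cases "r = 0")
      case True
      then have "A d (replicate d (emb n h)) = 0"
        using M(2)[OF emb_X, of n h] d(1) by (simp add: N_emb r_def power_0_left)
      then show ?thesis using True d(1) by (simp add: A'_def r_def power_0_left)
    next
      case False
      then have r: "0 < r" using blk_norm_nonneg[of q n h] by (simp add: r_def)
      define h' where "h' = (\<lambda>i. t / r * h i)"
      have "blk_norm q n h' = t" unfolding h'_def blk_norm_scale using r t by (simp add: r_def[symmetric])
      then have "c / 4 * \<pi> \<le> 2 * b * Q (emb n h')" by (rule key[OF n])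
      also have "Q (emb n h') = (t / r) ^ d * Q (emb n h)" unfolding h'_def by (rule Q_scale)
      finally have "c / 4 * t ^ d \<le> 2 * b * ((t / r) ^ d * Q (emb n h))"
        using t(1) by (simp add: \<pi>_def pd powr_realpow)
      then have "c / 4 * t ^ d * r ^ d \<le> (2 * b * ((t / r) ^ d * Q (emb n h))) * r ^ d"
        using r by (intro mult_right_mono) auto
      also have "\<dots> = t ^ d * (2 * b * Q (emb n h))" using r by (simp add: power_divide)
      finally have "t ^ d * (c / 4 * r ^ d) \<le> t ^ d * (2 * b * Q (emb n h))" by (simp add: mult_ac)
      then have "c / 4 * r ^ d \<le> 2 * b * Q (emb n h)" using t(1) by simp
      then show ?thesis using c by (simp add: A'_def Q r_def field_simps)
    qed
  qed
qed

text \<open>The lower bound of \<open>block_form\<close> and the boundedness of A give two-sided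
  estimates uniform in n; with p = d, the p-th power of the block norm is the power p/q of the q-th
  power sum.\<close>

lemma exponents:
  assumes "bump_X p q f" "T_smooth_X p q p f"
  shows "\<exists>m::nat. p = real (2 * m)" "\<exists>m::nat. q = real (2 * m)" "\<exists>k::nat. p = real k * q"
proof -
  obtain d A n0 where d: "p = real d" "even d" and A: "bounded_multilinear_X p q d A"
    and low: "\<And>n h. n \<ge> n0 \<Longrightarrow> blk_norm q n h ^ d \<le> A (replicate d (emb n h))"
    using block_form[OF assms] by metis
  obtain C where C: "0 \<le> C" "\<And>x. x \<in> X \<Longrightarrow> \<bar>A (replicate d x)\<bar> \<le> C * N x ^ d"
    using multilinear_diag_bound[OF A] by metis
  have pw: "blk_norm q n h ^ d = (\<Sum>i<n. \<bar>h i\<bar> powr q) powr (p / q)" for n h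
    unfolding blk_norm_def using p d(1) by (cases "(\<Sum>i<n. \<bar>h i\<bar> powr q) = 0") (auto simp: powr_power power_0_left)
  have cmp: "uniformly_comparable q (p / q) d C n0"
    unfolding uniformly_comparable_def
  proof (intro allI impI exI conjI)
    fix n h assume n: "n0 \<le> n"
    note E = multilinear_emb[OF A, of n h]
    show "(\<Sum>i<n. \<bar>h i\<bar> powr q) powr (p / q)
      \<le> (\<Sum>is\<in>index_lists n d. A (map (\<lambda>i. emb n (\<lambda>j. if j = i then 1 else 0)) is) * (\<Prod>i\<leftarrow>is. h i))"
      using low[OF n, of h] unfolding E pw .
    have "A (replicate d (emb n h)) \<le> C * blk_norm q n h ^ d"
      using C(2)[OF emb_X, of n h] by (simp add: N_emb)
    then show "(\<Sum>is\<in>index_lists n d. A (map (\<lambda>i. emb n (\<lambda>j. if j = i then 1 else 0)) is) * (\<Prod>i\<leftarrow>is. h i))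
      \<le> C * (\<Sum>i<n. \<bar>h i\<bar> powr q) powr (p / q)"
      unfolding E pw .
  qed
  have pq: "0 < q" "0 < p / q" using p q by simp_all
  show "\<exists>m::nat. q = real (2 * m)" by (rule uniformly_comparable_even[OF cmp pq C(1)])
  obtain k :: nat where "p / q = real k" using uniformly_comparable_nat[OF cmp pq C(1)] by blast
  then have "p = real k * q" using pq by (simp add: field_simps)
  then show "\<exists>k::nat. p = real k * q" by blast
  show "\<exists>m::nat. p = real (2 * m)" using d by (auto elim!: evenE)
qed

end

section \<open>The separating polynomial\<close>

text \<open>A crude arithmetic-geometric inequality, by replacing every factor by the largest
  one.\<close>

lemma prod_le_sum_power:
  fixes x :: "nat \<Rightarrow> real"
  assumes "0 < m" "\<And>l. l < m \<Longrightarrow> 0 \<le> x l"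
  shows "(\<Prod>l<m. x l) \<le> (\<Sum>l<m. x l ^ m)"
proof -
  define M where "M = Max (x ` {..<m})"
  have "M \<in> x ` {..<m}" unfolding M_def using assms(1) by (intro Max_in) auto
  then obtain l0 where l0: "l0 < m" "M = x l0" by auto
  have "(\<Prod>l<m. x l) \<le> (\<Prod>l<m. M)"
    using assms by (intro prod_mono) (auto simp: M_def)
  also have "\<dots> = x l0 ^ m" by (simp add: l0)
  also have "\<dots> \<le> (\<Sum>l<m. x l ^ m)"
    using l0 assms by (intro member_le_sum) auto
  finally show ?thesis .
qed

text \<open>Hoelder's inequality for m functions in the m-norm, with constant m instead of 1, which
  is harmless for boundedness. The functions are normalised and \<open>prod_le_sum_power\<close> is
  applied pointwise.\<close>

lemma sum_prod_le_prod_norms: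
  fixes u :: "nat \<Rightarrow> 'a \<Rightarrow> real"
  assumes "finite I" "0 < m" and u: "\<And>l i. 0 \<le> u l i"
  shows "(\<Sum>i\<in>I. \<Prod>l<m. u l i) \<le> real m * (\<Prod>l<m. (\<Sum>i\<in>I. u l i ^ m) powr (1 / real m))"
proof -
  define S where "S = (\<lambda>l. (\<Sum>i\<in>I. u l i ^ m) powr (1 / real m))"
  have S0: "0 \<le> S l" for l by (simp add: S_def)
  have Sm: "S l ^ m = (\<Sum>i\<in>I. u l i ^ m)" for l
    using assms(2) u by (cases "(\<Sum>i\<in>I. u l i ^ m) = 0") (auto simp: S_def powr_power power_0_left sum_nonneg)
  show ?thesis
  proof (cases "\<exists>l<m. S l = 0")
    case True
    then obtain l where l: "l < m" "S l = 0" by blast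
    then have "(\<Sum>i\<in>I. u l i ^ m) = 0" using Sm[of l] assms(2) by (simp add: power_0_left)
    then have "u l i = 0" if "i \<in> I" for i using that assms(1) u by (simp add: sum_nonneg_eq_0_iff)
    then have "(\<Prod>l<m. u l i) = 0" if "i \<in> I" for i using that l by (auto intro!: prod_zero)
    then have "(\<Sum>i\<in>I. \<Prod>l<m. u l i) = 0" by (intro sum.neutral ballI)
    also have "\<dots> \<le> real m * (\<Prod>l<m. S l)" using S0 by (simp add: prod_nonneg)
    finally show ?thesis by (simp add: S_def)
  next
    case False
    then have S: "0 < S l" if "l < m" for l using that S0[of l] by (metis less_eq_real_def)
    have eq: "(\<Sum>i\<in>I. \<Prod>l<m. u l i) = (\<Prod>l<m. S l) * (\<Sum>i\<in>I. \<Prod>l<m. u l i / S l)"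
      unfolding sum_distrib_left prod.distrib[symmetric]
      by (intro sum.cong prod.cong refl) (use S in \<open>force\<close>)
    have "(\<Sum>i\<in>I. \<Prod>l<m. u l i / S l) \<le> (\<Sum>i\<in>I. \<Sum>l<m. (u l i / S l) ^ m)"
      using assms S0 by (intro sum_mono prod_le_sum_power) auto
    also have "\<dots> = (\<Sum>l<m. \<Sum>i\<in>I. (u l i / S l) ^ m)" by (rule sum.swap)
    also have "\<dots> = (\<Sum>l<m. 1)"
    proof (rule sum.cong[OF refl])
      fix l assume "l \<in> {..<m}"
      then have "S l ^ m \<noteq> 0" using S[of l] by simp
      then show "(\<Sum>i\<in>I. (u l i / S l) ^ m) = 1"
        by (simp add: power_divide sum_divide_distrib[symmetric] Sm[symmetric])
    qed
    finally have "(\<Sum>i\<in>I. \<Prod>l<m. u l i / S l) \<le> real m" by simp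
    then have "(\<Sum>i\<in>I. \<Prod>l<m. u l i) \<le> (\<Prod>l<m. S l) * real m"
      unfolding eq using S0 by (intro mult_left_mono prod_nonneg) auto
    then show ?thesis by (simp add: S_def mult.commute)
  qed
qed

text \<open>An unsymmetrised multilinear form whose diagonal is (\<Sum>i<n. x_i^r)^k: the k * r
  arguments come in k consecutive groups of r.\<close>

definition block_product :: "nat \<Rightarrow> nat \<Rightarrow> nat \<Rightarrow> seqvec list \<Rightarrow> real" where
  "block_product r k n xs = (\<Prod>j<k. \<Sum>i<n. \<Prod>l<r. (xs ! (j * r + l)) n i)"

lemma prod_blocks: "(\<Prod>j<k. \<Prod>l<r. g (j * r + l)) = (\<Prod>s<k * r. g s)"
  for g :: "nat \<Rightarrow> 'a :: comm_monoid_mult"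
proof -
  have "(\<Prod>l<r. g (j * r + l)) = prod g {j * r..<j * r + r}" for j
    using prod.shift_bounds_nat_ivl[of g 0 "j * r" r] by (simp add: lessThan_atLeast0 add.commute)
  then show ?thesis by (simp add: prod.nat_group)
qed

text \<open>Argument s occurs once, in group s div r at place s mod r. R collects the rest of its
  group and W the other groups, so linearity in slot s becomes visible.\<close>

lemma block_product_update:
  assumes "s < k * r" "length xs = k * r"
  shows "\<exists>R W. \<forall>z. block_product r k n (xs[s := z]) = (\<Sum>i<n. z n i * R i) * W"
proof -
  have r: "0 < r" using assms by (cases r) auto
  define a where "a = s div r"
  define b where "b = s mod r"
  have a: "a < k" using assms r by (simp add: a_def less_mult_imp_div_less)
  have b: "b < r" using r by (simp add: b_def)
  have s: "s = a * r + b" by (simp add: a_def b_def)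
  have neq: "j * r + l \<noteq> s" if "l < r" "j \<noteq> a \<or> l \<noteq> b" for j l
  proof
    assume "j * r + l = s"
    then have "j = a" "l = b" using that(1) by (auto simp: a_def b_def)
    then show False using that(2) by blast
  qed
  have upd: "xs[s := z] ! (j * r + l) = xs ! (j * r + l)" if "l < r" "j \<noteq> a \<or> l \<noteq> b" for z j l
    using neq[OF that] by (metis nth_list_update_neq)
  define R where "R = (\<lambda>i. \<Prod>l\<in>{..<r} - {b}. (xs ! (a * r + l)) n i)"
  define W where "W = (\<Prod>j\<in>{..<k} - {a}. \<Sum>i<n. \<Prod>l<r. (xs ! (j * r + l)) n i)"
  have "block_product r k n (xs[s := z]) = (\<Sum>i<n. z n i * R i) * W" for z
  proof -
    have "block_product r k n (xs[s := z])
        = (\<Sum>i<n. \<Prod>l<r. (xs[s := z] ! (a * r + l)) n i) * (\<Prod>j\<in>{..<k} - {a}. \<Sum>i<n. \<Prod>l<r. (xs[s := z] ! (j * r + l)) n i)"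
      unfolding block_product_def using a by (simp add: prod.remove[of "{..<k}" a])
    also have "(\<Prod>j\<in>{..<k} - {a}. \<Sum>i<n. \<Prod>l<r. (xs[s := z] ! (j * r + l)) n i) = W"
      unfolding W_def by (intro prod.cong sum.cong refl) (simp add: upd)
    also have "(\<Sum>i<n. \<Prod>l<r. (xs[s := z] ! (a * r + l)) n i) = (\<Sum>i<n. z n i * R i)"
    proof (rule sum.cong[OF refl])
      fix i
      have "(\<Prod>l<r. (xs[s := z] ! (a * r + l)) n i)
          = (xs[s := z] ! (a * r + b)) n i * (\<Prod>l\<in>{..<r} - {b}. (xs[s := z] ! (a * r + l)) n i)"
        using b by (simp add: prod.remove[of "{..<r}" b])
      also have "xs[s := z] ! (a * r + b) = z" using s assms by simp
      also have "(\<Prod>l\<in>{..<r} - {b}. (xs[s := z] ! (a * r + l)) n i) = R i"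
        unfolding R_def by (intro prod.cong refl) (simp add: upd)
      finally show "(\<Prod>l<r. (xs[s := z] ! (a * r + l)) n i) = z n i * R i" .
    qed
    finally show ?thesis .
  qed
  then show ?thesis by blast
qed

lemma block_product_linear:
  assumes "s < k * r" "length xs = k * r"
  shows "block_product r k n (xs[s := vadd (xs ! s) (vscale c y)])
       = block_product r k n xs + c * block_product r k n (xs[s := y])"
proof -
  obtain R W where *: "\<And>z. block_product r k n (xs[s := z]) = (\<Sum>i<n. z n i * R i) * W"
    using block_product_update[OF assms] by blast
  have "block_product r k n xs = (\<Sum>i<n. (xs ! s) n i * R i) * W"
    using *[of "xs ! s"] by simp
  then show ?thesis
    unfolding * by (simp add: vadd_def vscale_def algebra_simps sum.distrib sum_distrib_left)
qed

context lp_lq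
begin

lemma block_product_bound:
  assumes r: "q = real r" and xs: "length xs = k * r"
  shows "\<bar>block_product r k n xs\<bar> \<le> real r ^ k * (\<Prod>s<k * r. \<beta> n (xs ! s))"
proof -
  have r0: "0 < r" using q r by simp
  have "\<bar>\<Sum>i<n. \<Prod>l<r. (xs ! (j * r + l)) n i\<bar> \<le> real r * (\<Prod>l<r. \<beta> n (xs ! (j * r + l)))" for j
  proof -
    have "\<bar>\<Sum>i<n. \<Prod>l<r. (xs ! (j * r + l)) n i\<bar> \<le> (\<Sum>i<n. \<Prod>l<r. \<bar>(xs ! (j * r + l)) n i\<bar>)"
      unfolding abs_prod[symmetric] by (rule sum_abs)
    also have "\<dots> \<le> real r * (\<Prod>l<r. (\<Sum>i<n. \<bar>(xs ! (j * r + l)) n i\<bar> ^ r) powr (1 / real r))"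
      using r0 by (intro sum_prod_le_prod_norms) auto
    also have "\<dots> = real r * (\<Prod>l<r. \<beta> n (xs ! (j * r + l)))"
      using r0 by (simp add: blk_norm_def r powr_realpow')
    finally show ?thesis .
  qed
  then have "(\<Prod>j<k. \<bar>\<Sum>i<n. \<Prod>l<r. (xs ! (j * r + l)) n i\<bar>)
      \<le> (\<Prod>j<k. real r * (\<Prod>l<r. \<beta> n (xs ! (j * r + l))))"
    by (intro prod_mono) auto
  then show ?thesis
    by (simp add: block_product_def abs_prod prod.distrib prod_blocks[where g = "\<lambda>s. \<beta> n (xs ! s)"])
qed

text \<open>The Hoelder-type inequality was used inside a block with exponent r = q; here it is used
  across the blocks with exponent d = p, which turns products of block norms into products of
  X-norms.\<close>

lemma block_product_summable:
  assumes r: "q = real r" and d: "p = real d" "d = k * r" and xs: "length xs = d" "set xs \<subseteq> X"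
  shows "summable (\<lambda>n. block_product r k n xs)"
    and "\<bar>\<Sum>n. block_product r k n xs\<bar> \<le> (real r ^ k * real d) * prod_list (map N xs)"
proof -
  have d0: "0 < d" using p unfolding d(1) by simp
  have X: "xs ! s \<in> X" if "s < d" for s using that xs by (metis nth_mem subsetD)
  have bd: "(\<Sum>n<m. \<bar>block_product r k n xs\<bar>) \<le> (real r ^ k * real d) * prod_list (map N xs)" for m
  proof -
    have "(\<Sum>n<m. \<bar>block_product r k n xs\<bar>) \<le> (\<Sum>n<m. real r ^ k * (\<Prod>s<d. \<beta> n (xs ! s)))"
      using block_product_bound[OF r] xs d by (intro sum_mono) auto
    also have "\<dots> = real r ^ k * (\<Sum>n<m. \<Prod>s<d. \<beta> n (xs ! s))" by (simp add: sum_distrib_left)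
    also have "(\<Sum>n<m. \<Prod>s<d. \<beta> n (xs ! s)) \<le> real d * (\<Prod>s<d. (\<Sum>n<m. \<beta> n (xs ! s) ^ d) powr (1 / real d))"
      using d0 by (intro sum_prod_le_prod_norms) (auto simp: blk_norm_nonneg)
    also have "\<dots> \<le> real d * (\<Prod>s<d. N (xs ! s))"
    proof (intro mult_left_mono prod_mono conjI)
      fix s assume "s \<in> {..<d}"
      then have "(\<Sum>n<m. \<beta> n (xs ! s) powr p) \<le> N (xs ! s) powr p" by (intro sum_le_N X) auto
      then have "(\<Sum>n<m. \<beta> n (xs ! s) ^ d) \<le> N (xs ! s) powr p"
        using d0 by (simp add: d(1) powr_realpow' blk_norm_nonneg)
      then have "(\<Sum>n<m. \<beta> n (xs ! s) ^ d) powr (1 / real d) \<le> (N (xs ! s) powr p) powr (1 / real d)"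
        by (intro powr_mono2) (auto intro!: sum_nonneg simp: blk_norm_nonneg)
      then show "(\<Sum>n<m. \<beta> n (xs ! s) ^ d) powr (1 / real d) \<le> N (xs ! s)"
        using d0 N_nonneg[of "xs ! s"] by (simp add: powr_powr d(1))
    qed auto
    also have "(\<Prod>s<d. N (xs ! s)) = prod_list (map N xs)"
      using xs by (simp add: prod.list_conv_set_nth lessThan_atLeast0)
    finally show ?thesis by (simp add: mult_left_mono mult.assoc)
  qed
  have abs: "summable (\<lambda>n. \<bar>block_product r k n xs\<bar>)"
    by (rule summableI_nonneg_bounded[OF _ bd]) simp
  then show "summable (\<lambda>n. block_product r k n xs)" by (rule summable_rabs_cancel)
  have "\<bar>\<Sum>n. block_product r k n xs\<bar> \<le> (\<Sum>n. \<bar>block_product r k n xs\<bar>)" by (rule summable_rabs[OF abs])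
  also have "\<dots> \<le> (real r ^ k * real d) * prod_list (map N xs)"
    by (rule suminf_le_const[OF abs bd])
  finally show "\<bar>\<Sum>n. block_product r k n xs\<bar> \<le> (real r ^ k * real d) * prod_list (map N xs)" .
qed

lemma separating_polynomial:
  assumes r: "q = real r" "even r" and pk: "p = real k * q"
  shows "\<exists>P. separating_poly_X p q P"
proof -
  define d where "d = k * r"
  have d: "p = real d" "d = k * r" using pk r by (simp_all add: d_def)
  have r0: "0 < r" using q r by simp
  define A where "A = (\<lambda>j xs. if j = d then \<Sum>n. block_product r k n xs else 0)"
  define P where "P = (\<lambda>h. \<Sum>j\<le>d. A j (replicate j h))"
  have "bounded_multilinear_X p q j (A j)" for j
  proof (cases "j = d")
    case True
    have "A d (xs[s := vadd (xs ! s) (vscale c y)]) = A d xs + c * A d (xs[s := y])"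
      if "length xs = d \<and> set xs \<subseteq> X \<and> s < d \<and> y \<in> X" for xs s y c
    proof -
      have "set (xs[s := y]) \<subseteq> X" using that set_update_subset_insert[of xs s y] by blast
      then have sm: "summable (\<lambda>n. block_product r k n xs)" "summable (\<lambda>n. block_product r k n (xs[s := y]))"
        using that by (auto intro!: block_product_summable(1)[OF r(1) d])
      have "(\<Sum>n. block_product r k n (xs[s := vadd (xs ! s) (vscale c y)]))
          = (\<Sum>n. block_product r k n xs + c * block_product r k n (xs[s := y]))"
        using that by (subst block_product_linear) (auto simp: d_def)
      also have "\<dots> = (\<Sum>n. block_product r k n xs) + c * (\<Sum>n. block_product r k n (xs[s := y]))"
        using sm by (simp add: suminf_add[symmetric] suminf_mult summable_mult)
      finally show ?thesis by (simp add: A_def)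
    qed
    moreover have "\<bar>A d xs\<bar> \<le> (real r ^ k * real d) * prod_list (map N xs)"
      if "length xs = d \<and> set xs \<subseteq> X" for xs
      using block_product_summable(2)[OF r(1) d] that by (simp add: A_def)
    ultimately show ?thesis unfolding True bounded_multilinear_X_def by blast
  next
    case False
    then show ?thesis unfolding bounded_multilinear_X_def by (auto simp: A_def intro!: exI[of _ 0])
  qed
  then have "cont_poly_X p q d P" unfolding cont_poly_X_def P_def by (intro exI[of _ A]) auto
  moreover have val: "P x = N x powr p" if "x \<in> X" for x
  proof -
    have "block_product r k n (replicate d x) = \<beta> n x powr p" for n
    proof -
      have "block_product r k n (replicate d x) = (\<Prod>j<k. \<Sum>i<n. \<Prod>l<r. x n i)"
        unfolding block_product_def
      proof (intro prod.cong sum.cong refl)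
        fix j i l assume "j \<in> {..<k}" "l \<in> {..<r}"
        then have "j * r + l < Suc j * r" "Suc j \<le> k" by auto
        moreover from this(2) have "Suc j * r \<le> k * r" by (rule mult_right_mono) simp
        ultimately have "j * r + l < k * r" by linarith
        then show "(replicate d x ! (j * r + l)) n i = x n i" by (simp add: d_def)
      qed
      \<comment> \<open>Evenness of r enters here: it lets x^r replace |x|^q.\<close>
      also have "\<dots> = (\<Sum>i<n. \<bar>x n i\<bar> powr q) ^ k"
        using r0 r by (simp add: powr_realpow' power_even_abs)
      also have "\<dots> = (\<beta> n x ^ r) ^ k"
        using r0 unfolding blk_norm_powr[symmetric] by (simp add: r powr_realpow' blk_norm_nonneg)
      also have "\<dots> = \<beta> n x powr p"
      proof -
        have "0 < d" using p unfolding d(1) by simp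
        then have "\<beta> n x powr p = \<beta> n x ^ d" by (simp add: d(1) powr_realpow' blk_norm_nonneg)
        then show ?thesis by (simp add: d_def power_mult[symmetric] mult.commute)
      qed
      finally show ?thesis .
    qed
    then have "A d (replicate d x) = N x powr p" by (simp add: A_def N_powr[OF that])
    moreover have "P x = (\<Sum>j\<in>{d}. A j (replicate j x))"
      unfolding P_def by (rule sum.mono_neutral_right) (auto simp: A_def)
    ultimately show ?thesis by simp
  qed
  ultimately have "separating_poly_X p q P"
    unfolding separating_poly_X_def using val[OF vzero_X] by (auto simp: N_vzero val)
  then show ?thesis by blast
qed

end

theorem theorem3p2:
  fixes p q :: real
  assumes "1 < p" and "1 < q"
    and "\<exists>f. bump_X p q f \<and> T_smooth_X p q p f"
  shows "(\<exists>m::nat. p = real (2 * m)) \<and> (\<exists>m::nat. q = real (2 * m)) \<and>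
         (\<exists>k::nat. p = real k * q) \<and>
         (\<exists>P. separating_poly_X p q P)"
proof -
  obtain f where f: "bump_X p q f" "T_smooth_X p q p f" using assms(3) by blast
  interpret lp_lq p q by unfold_locales (use assms in auto)
  obtain m k :: nat where m: "q = real (2 * m)" and k: "p = real k * q"
    using exponents(2,3)[OF f] by blast
  have "even (2 * m)" by simp
  then show ?thesis
    using exponents[OF f] separating_polynomial[OF m _ k] by blast
qed

end
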